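(* Let $\Omega\subset\mathbb R^d$ be a bounded convex domain and $\mathcal A$ a compact metric space with metric $d_{\mathcal A}$. Let $A\in L_\infty(\Omega;C^0(\mathcal A;\mathrm{Sym}(\mathbb R^{d\times d})))$, $b\in L_\infty(\Omega;C^0(\mathcal A;\mathbb R^d))$, $c\in L_\infty(\Omega;C^0(\mathcal A;\mathbb R))$ and $f\in L_2(\Omega;C^0(\mathcal A))$ be such that the following uniform convergence of policies holds: whenever $v_j\to v$ in $H^2(\Omega)$ with $v_j,v\in H^2(\Omega)\cap H^1_0(\Omega)$, and $q_j\in\mathcal N[v_j]$ for every $j\in\mathbb N$, one has $$\lim_{j\to\infty}\Big\|\inf_{q\in\mathcal N[v]}d_{\mathcal A}(q_j,q)\Big\|_{L_\infty(\Omega)}=0 .$$ Then the HJB operator $\mathcal F:H^2(\Omega)\cap H^1_0(\Omega)\to L_2(\Omega)$, $\mathcal F[v](x)=\sup_{\alpha\in\mathcal A}\big(\mathcal L^\alpha v(x)-f^\alpha(x)\big)$, is Newton differentiable on $H^2(\Omega)\cap H^1_0(\Omega)$ with Newton derivative $$\mathfrak D\mathcal F[v]:=\big\{\mathcal L^q=A^q:D^2+b^q\cdot\nabla-c^q \;:\; q\in\mathcal N[v]\big\},\qquad v\in H^2(\Omega)\cap H^1_0(\Omega).$$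
   Context: Notation. $\mathrm{Sym}(\mathbb R^{d\times d})$ is the space of symmetric $d\times d$ matrices, $M:N=\mathrm{tr}(M^{T}N)$ is the Frobenius product, $D^2v$ the Hessian. For $\alpha\in\mathcal A$, $A^\alpha(x),b^\alpha(x),c^\alpha(x),f^\alpha(x)$ are the values of the data at $x$ and $\alpha$, and $\mathcal L^\alpha v:=A^\alpha:D^2v+b^\alpha\cdot\nabla v-c^\alpha v$. The set of policy maps is $\mathcal Q:=\{q:\Omega\to\mathcal A : q\text{ measurable}\}$. For $q\in\mathcal Q$, $A^q(x):=A^{q(x)}(x)$, and similarly $b^q,c^q,f^q$ and $\mathcal L^q$. For $v\in H^2(\Omega)\cap H^1_0(\Omega)$, $$\mathcal N[v]:=\{q\in\mathcal Q : q(x)\in\mathrm{Argmax}_{\alpha\in\mathcal A}(\mathcal L^\alpha v(x)-f^\alpha(x))\text{ for a.e. }x\in\Omega\}.$$ The infimum $\inf_{q\in\mathcal N[v]}d_{\mathcal A}(q_j,q)$ is the function $x\mapsto\inf_{q\in\mathcal N[v]}d_{\mathcal A}(q_j(x),q(x))$. Newton differentiability. Let $X,Z$ be Banach spaces, $\emptyset\ne B\subset X$, and let $L(X,Z)$ be the set of bounded linear operators from $X$ to $Z$. A map $F:B\to Z$ is Newton differentiable at $x\in B$ if there are an open neighbourhood $N(x)\subset B$ and a set-valued map $\mathfrak DF$ from $N(x)$ to nonempty subsets of $L(X,Z)$ such that $$\lim_{\|e\|_X\to0}\frac1{\|e\|_X}\sup_{D\in\mathfrak DF[x+e]}\|F[x+e]-F[x]-De\|_Z=0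 .$$ $F$ is Newton differentiable on $B$ with Newton derivative $\mathfrak DF$, a map assigning to each point of $B$ a nonempty subset of $L(X,Z)$, if this holds at each $x\in B$ with this $\mathfrak DF$. Here $X=H^2(\Omega)\cap H^1_0(\Omega)$ with the $H^2(\Omega)$-norm and $Z=L_2(\Omega)$.
   Formalization: The infimum over q in N[v] of d_A(q_j,q) is taken as an essential infimum (a.e. order), since N[v] is constrained only almost everywhere: the pointwise infimum is identically 0, which would make the hypothesis void and the claim false (e.g. F[v]=max(v'',0) on (0,1)). *)

theory Defs
  imports "HOL-Analysis.Analysis" "HOL-Probability.Essential_Supremum"
begin

section \<open>Newton differentiability\<close>

text \<open>
  A normed space is given by a carrier \<open>X\<close> (a linear subspace of a real vector space) together with
  a norm \<open>nX\<close> on it. This is needed because the Sobolev spaces below depend on the domain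
  \<open>\<Omega>\<close>, which is a term, so they cannot be types. Operators on \<open>X\<close> are functions on the ambient type;
  their values outside \<open>X\<close> are irrelevant.
\<close>

definition bounded_operators ::
  "'x::real_vector set \<Rightarrow> ('x \<Rightarrow> real) \<Rightarrow> 'z::real_vector set \<Rightarrow> ('z \<Rightarrow> real) \<Rightarrow> ('x \<Rightarrow> 'z) set" where
  "bounded_operators X nX Z nZ =
     {T. T ` X \<subseteq> Z
       \<and> (\<forall>u\<in>X. \<forall>v\<in>X. T (u + v) = T u + T v)
       \<and> (\<forall>a. \<forall>u\<in>X. T (a *\<^sub>R u) = a *\<^sub>R T u)
       \<and> (\<exists>C. \<forall>u\<in>X. nZ (T u) \<le> C * nX u)}"

definition norm_open :: "'x::real_vector set \<Rightarrow> ('x \<Rightarrow> real) \<Rightarrow> 'x set \<Rightarrow> bool" where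
  "norm_open X nX N \<longleftrightarrow> N \<subseteq> X \<and> (\<forall>y\<in>N. \<exists>r>0. \<forall>z\<in>X. nX (z - y) < r \<longrightarrow> z \<in> N)"

text \<open>
  The supremum is taken in the extended nonnegative reals, so that an unbounded family of residuals
  has supremum \<open>\<infinity>\<close>. The filter below describes \<open>e \<in> X\<close>, \<open>\<parallel>e\<parallel> \<rightarrow> 0\<close>, \<open>\<parallel>e\<parallel> > 0\<close>.
\<close>

definition newton_differentiable_at ::
  "'x::real_vector set \<Rightarrow> ('x \<Rightarrow> real) \<Rightarrow> 'z::real_vector set \<Rightarrow> ('z \<Rightarrow> real)
     \<Rightarrow> 'x set \<Rightarrow> ('x \<Rightarrow> 'z) \<Rightarrow> ('x \<Rightarrow> ('x \<Rightarrow> 'z) set) \<Rightarrow> 'x \<Rightarrow> bool" where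
  "newton_differentiable_at X nX Z nZ B F DF x \<longleftrightarrow>
     (\<exists>N. norm_open X nX N \<and> x \<in> N \<and> N \<subseteq> B
        \<and> (\<forall>y\<in>N. DF y \<noteq> {} \<and> DF y \<subseteq> bounded_operators X nX Z nZ))
     \<and> ((\<lambda>e. (SUP D\<in>DF (x + e). ennreal (nZ (F (x + e) - F x - D e))) / ennreal (nX e))
          \<longlongrightarrow> 0) (inf (filtercomap nX (at_right 0)) (principal X))"

definition newton_differentiable_on ::
  "'x::real_vector set \<Rightarrow> ('x \<Rightarrow> real) \<Rightarrow> 'z::real_vector set \<Rightarrow> ('z \<Rightarrow> real)
     \<Rightarrow> 'x set \<Rightarrow> ('x \<Rightarrow> 'z) \<Rightarrow> ('x \<Rightarrow> ('x \<Rightarrow> 'z) set) \<Rightarrow> bool" where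
  "newton_differentiable_on X nX Z nZ B F DF \<longleftrightarrow>
     B \<noteq> {} \<and> B \<subseteq> X \<and> F ` B \<subseteq> Z
     \<and> (\<forall>x\<in>B. DF x \<noteq> {} \<and> DF x \<subseteq> bounded_operators X nX Z nZ)
     \<and> (\<forall>x\<in>B. newton_differentiable_at X nX Z nZ B F DF x)"


section \<open>Classes of measurable functions modulo equality almost everywhere\<close>

definition ae_rel :: "(real^'d \<Rightarrow> real) \<Rightarrow> (real^'d \<Rightarrow> real) \<Rightarrow> bool" where
  "ae_rel f g \<longleftrightarrow> f \<in> borel_measurable lebesgue \<and> g \<in> borel_measurable lebesgue
     \<and> (AE x in lebesgue. f x = g x)"

lemma part_equivp_ae_rel: "part_equivp (ae_rel :: (real^'d \<Rightarrow> real) \<Rightarrow> _)"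
proof (rule part_equivpI)
  show "\<exists>f :: real^'d \<Rightarrow> real. ae_rel f f"
    by (rule exI[of _ "\<lambda>_. 0"]) (simp add: ae_rel_def)
  show "symp (ae_rel :: (real^'d \<Rightarrow> real) \<Rightarrow> _)"
    by (rule sympI) (auto simp: ae_rel_def elim: eventually_mono)
  show "transp (ae_rel :: (real^'d \<Rightarrow> real) \<Rightarrow> _)"
    by (rule transpI) (auto simp: ae_rel_def elim: eventually_elim2)
qed

quotient_type (overloaded) 'd ae_fun = "real^'d \<Rightarrow> real" / partial: ae_rel
  by (rule part_equivp_ae_rel)

instantiation ae_fun :: (finite) real_vector
begin

lift_definition zero_ae_fun :: "'a ae_fun" is "\<lambda>_. 0"
  by (simp add: ae_rel_def)

lift_definition plus_ae_fun :: "'a ae_fun \<Rightarrow> 'a ae_fun \<Rightarrow> 'a ae_fun" is "\<lambda>f g x. f x + g x"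
  by (auto simp: ae_rel_def elim: eventually_elim2)

lift_definition minus_ae_fun :: "'a ae_fun \<Rightarrow> 'a ae_fun \<Rightarrow> 'a ae_fun" is "\<lambda>f g x. f x - g x"
  by (auto simp: ae_rel_def elim: eventually_elim2)

lift_definition uminus_ae_fun :: "'a ae_fun \<Rightarrow> 'a ae_fun" is "\<lambda>f x. - f x"
  by (auto simp: ae_rel_def elim: eventually_mono)

lift_definition scaleR_ae_fun :: "real \<Rightarrow> 'a ae_fun \<Rightarrow> 'a ae_fun" is "\<lambda>r f x. r * f x"
  by (auto simp: ae_rel_def elim: eventually_mono)

instance
proof
  fix a b c :: "'a ae_fun" and r s :: real
  show "a + b + c = a + (b + c)"
    by transfer (simp add: ae_rel_def add.assoc)
  show "a + b = b + a"
    by transfer (simp add: ae_rel_def add.commute)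
  show "0 + a = a"
    by transfer (simp add: ae_rel_def)
  show "- a + a = 0"
    by transfer (simp add: ae_rel_def)
  show "a - b = a + - b"
    by transfer (simp add: ae_rel_def)
  show "r *\<^sub>R (a + b) = r *\<^sub>R a + r *\<^sub>R b"
    by transfer (simp add: ae_rel_def distrib_left)
  show "(r + s) *\<^sub>R a = r *\<^sub>R a + s *\<^sub>R a"
    by transfer (simp add: ae_rel_def distrib_right)
  show "r *\<^sub>R s *\<^sub>R a = (r * s) *\<^sub>R a"
    by transfer (simp add: ae_rel_def mult.assoc)
  show "1 *\<^sub>R a = a"
    by transfer (simp add: ae_rel_def)
qed

end

text \<open>
  In the following \<open>rep_ae_fun u\<close> is some representative of \<open>u\<close>. All notions built from it depend
  only on the class, or are used only almost everywhere.

  The space \<open>L\<^sub>2(\<Omega>)\<close> is realised isometrically by extending functions by zero outside \<open>\<Omega>\<close>.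
  The same convention applies to \<open>H\<^sup>1(\<Omega>)\<close>, \<open>H\<^sup>2(\<Omega>)\<close> and to weak derivatives
  (which are always tested inside \<open>\<Omega>\<close> only).
\<close>

definition L2 :: "(real^'d) set \<Rightarrow> 'd::finite ae_fun set" where
  "L2 \<Omega> = {u. (AE x in lebesgue. x \<notin> \<Omega> \<longrightarrow> rep_ae_fun u x = 0)
              \<and> integrable (lebesgue_on \<Omega>) (\<lambda>x. (rep_ae_fun u x)\<^sup>2)}"

definition L2_norm :: "(real^'d) set \<Rightarrow> 'd::finite ae_fun \<Rightarrow> real" where
  "L2_norm \<Omega> u = sqrt (LINT x|lebesgue_on \<Omega>. (rep_ae_fun u x)\<^sup>2)"

definition class_on :: "(real^'d) set \<Rightarrow> (real^'d \<Rightarrow> real) \<Rightarrow> 'd::finite ae_fun" where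
  "class_on \<Omega> g = abs_ae_fun (\<lambda>x. if x \<in> \<Omega> then g x else 0)"


section \<open>Sobolev spaces\<close>

definition pderiv_at :: "'d::finite \<Rightarrow> (real^'d \<Rightarrow> real) \<Rightarrow> real^'d \<Rightarrow> real" where
  "pderiv_at i \<phi> x = frechet_derivative \<phi> (at x) (axis i 1)"

text \<open>\<open>C\<^sup>\<infinity>\<close>: all iterated partial derivatives are differentiable everywhere, hence also continuous.\<close>

definition smooth_fun :: "(real^'d::finite \<Rightarrow> real) \<Rightarrow> bool" where
  "smooth_fun \<phi> \<longleftrightarrow> (\<forall>is x. foldr pderiv_at is \<phi> differentiable (at x))"

definition test_funs :: "(real^'d::finite) set \<Rightarrow> (real^'d \<Rightarrow> real) set" where
  "test_funs \<Omega> = {\<phi>. smooth_fun \<phi> \<and> compact (closure {x. \<phi> x \<noteq> 0}) \<and> closure {x. \<phi> x \<noteq> 0} \<subseteq> \<Omega>}"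

definition is_weak_pderiv ::
  "(real^'d::finite) set \<Rightarrow> 'd \<Rightarrow> 'd ae_fun \<Rightarrow> 'd ae_fun \<Rightarrow> bool" where
  "is_weak_pderiv \<Omega> i u g \<longleftrightarrow>
     (\<forall>\<phi>\<in>test_funs \<Omega>. (LINT x|lebesgue_on \<Omega>. rep_ae_fun u x * pderiv_at i \<phi> x)
                       = - (LINT x|lebesgue_on \<Omega>. rep_ae_fun g x * \<phi> x))"

definition weak_pderiv :: "(real^'d::finite) set \<Rightarrow> 'd \<Rightarrow> 'd ae_fun \<Rightarrow> 'd ae_fun" where
  "weak_pderiv \<Omega> i u = (THE g. g \<in> L2 \<Omega> \<and> is_weak_pderiv \<Omega> i u g)"

definition H1 :: "(real^'d::finite) set \<Rightarrow> 'd ae_fun set" where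
  "H1 \<Omega> = {u \<in> L2 \<Omega>. \<forall>i. \<exists>g\<in>L2 \<Omega>. is_weak_pderiv \<Omega> i u g}"

definition H1_norm :: "(real^'d::finite) set \<Rightarrow> 'd ae_fun \<Rightarrow> real" where
  "H1_norm \<Omega> u = sqrt ((L2_norm \<Omega> u)\<^sup>2 + (\<Sum>i\<in>UNIV. (L2_norm \<Omega> (weak_pderiv \<Omega> i u))\<^sup>2))"

definition H10 :: "(real^'d::finite) set \<Rightarrow> 'd ae_fun set" where
  "H10 \<Omega> = {u \<in> H1 \<Omega>. \<forall>\<epsilon>>0. \<exists>\<phi>\<in>test_funs \<Omega>. H1_norm \<Omega> (u - class_on \<Omega> \<phi>) < \<epsilon>}"

definition H2 :: "(real^'d::finite) set \<Rightarrow> 'd ae_fun set" where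
  "H2 \<Omega> = {u \<in> H1 \<Omega>. \<forall>i. weak_pderiv \<Omega> i u \<in> H1 \<Omega>}"

definition H2_norm :: "(real^'d::finite) set \<Rightarrow> 'd ae_fun \<Rightarrow> real" where
  "H2_norm \<Omega> u = sqrt ((L2_norm \<Omega> u)\<^sup>2 + (\<Sum>i\<in>UNIV. (L2_norm \<Omega> (weak_pderiv \<Omega> i u))\<^sup>2)
     + (\<Sum>i\<in>UNIV. \<Sum>j\<in>UNIV. (L2_norm \<Omega> (weak_pderiv \<Omega> i (weak_pderiv \<Omega> j u)))\<^sup>2))"

definition weak_grad :: "(real^'d::finite) set \<Rightarrow> 'd ae_fun \<Rightarrow> real^'d \<Rightarrow> real^'d" where
  "weak_grad \<Omega> u x = (\<chi> i. rep_ae_fun (weak_pderiv \<Omega> i u) x)"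

definition weak_hessian :: "(real^'d::finite) set \<Rightarrow> 'd ae_fun \<Rightarrow> real^'d \<Rightarrow> real^'d^'d" where
  "weak_hessian \<Omega> u x = (\<chi> i j. rep_ae_fun (weak_pderiv \<Omega> i (weak_pderiv \<Omega> j u)) x)"


section \<open>Bochner spaces, essential infimum\<close>

text \<open>
  Used with values in \<open>C\<^sup>0(\<A>; E)\<close> for a compact metric space \<open>\<A>\<close> and Euclidean \<open>E\<close>, which is
  \<open>'a \<Rightarrow>\<^sub>C 'e\<close> with the supremum norm. That space is separable, so Borel measurability
  agrees with strong (Bochner) measurability.
\<close>

definition bochner_Linf :: "(real^'d::finite) set \<Rightarrow> (real^'d \<Rightarrow> 'e::real_normed_vector) set" where
  "bochner_Linf \<Omega> = {g. g \<in> borel_measurable (lebesgue_on \<Omega>)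
     \<and> (\<exists>C. AE x in lebesgue_on \<Omega>. norm (g x) \<le> C)}"

definition bochner_L2 :: "(real^'d::finite) set \<Rightarrow> (real^'d \<Rightarrow> 'e::real_normed_vector) set" where
  "bochner_L2 \<Omega> = {g. g \<in> borel_measurable (lebesgue_on \<Omega>)
     \<and> integrable (lebesgue_on \<Omega>) (\<lambda>x. (norm (g x))\<^sup>2)}"

definition Linf_norm :: "(real^'d::finite) set \<Rightarrow> (real^'d \<Rightarrow> real) \<Rightarrow> ereal" where
  "Linf_norm \<Omega> g = esssup (lebesgue_on \<Omega>) (\<lambda>x. ereal \<bar>g x\<bar>)"

text \<open>
  The greatest lower bound of a family of functions with respect to the order almost everywhere,
  that is, the infimum in a space of functions modulo equality almost everywhere. It is unique
  almost everywhere.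
\<close>

definition is_ess_inf :: "'x measure \<Rightarrow> ('x \<Rightarrow> real) set \<Rightarrow> ('x \<Rightarrow> real) \<Rightarrow> bool" where
  "is_ess_inf M G g \<longleftrightarrow> g \<in> borel_measurable M
     \<and> (\<forall>h\<in>G. AE x in M. g x \<le> h x)
     \<and> (\<forall>k\<in>borel_measurable M. (\<forall>h\<in>G. AE x in M. k x \<le> h x) \<longrightarrow> (AE x in M. k x \<le> g x))"

definition ess_inf :: "'x measure \<Rightarrow> ('x \<Rightarrow> real) set \<Rightarrow> 'x \<Rightarrow> real" where
  "ess_inf M G = (SOME g. is_ess_inf M G g)"


section \<open>The Hamilton--Jacobi--Bellman operator\<close>

definition frobenius :: "real^'d^'d \<Rightarrow> real^'d^'d \<Rightarrow> real" where
  "frobenius M N = trace (transpose M ** N)"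

definition ell_op ::
  "(real^'d::finite) set \<Rightarrow> (real^'d \<Rightarrow> ('a::topological_space \<Rightarrow>\<^sub>C (real^'d^'d)))
     \<Rightarrow> (real^'d \<Rightarrow> ('a \<Rightarrow>\<^sub>C (real^'d))) \<Rightarrow> (real^'d \<Rightarrow> ('a \<Rightarrow>\<^sub>C real))
     \<Rightarrow> 'a \<Rightarrow> 'd ae_fun \<Rightarrow> real^'d \<Rightarrow> real" where
  "ell_op \<Omega> A b c \<alpha> v x =
     frobenius (apply_bcontfun (A x) \<alpha>) (weak_hessian \<Omega> v x)
     + apply_bcontfun (b x) \<alpha> \<bullet> weak_grad \<Omega> v x
     - apply_bcontfun (c x) \<alpha> * rep_ae_fun v x"

definition policy_op ::
  "(real^'d::finite) set \<Rightarrow> (real^'d \<Rightarrow> ('a::topological_space \<Rightarrow>\<^sub>C (real^'d^'d)))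
     \<Rightarrow> (real^'d \<Rightarrow> ('a \<Rightarrow>\<^sub>C (real^'d))) \<Rightarrow> (real^'d \<Rightarrow> ('a \<Rightarrow>\<^sub>C real))
     \<Rightarrow> (real^'d \<Rightarrow> 'a) \<Rightarrow> 'd ae_fun \<Rightarrow> 'd ae_fun" where
  "policy_op \<Omega> A b c q v = class_on \<Omega> (\<lambda>x. ell_op \<Omega> A b c (q x) v x)"

definition HJB ::
  "(real^'d::finite) set \<Rightarrow> (real^'d \<Rightarrow> ('a::topological_space \<Rightarrow>\<^sub>C (real^'d^'d)))
     \<Rightarrow> (real^'d \<Rightarrow> ('a \<Rightarrow>\<^sub>C (real^'d))) \<Rightarrow> (real^'d \<Rightarrow> ('a \<Rightarrow>\<^sub>C real))
     \<Rightarrow> (real^'d \<Rightarrow> ('a \<Rightarrow>\<^sub>C real)) \<Rightarrow> 'd ae_fun \<Rightarrow> 'd ae_fun" where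
  "HJB \<Omega> A b c f v =
     class_on \<Omega> (\<lambda>x. SUP \<alpha>. ell_op \<Omega> A b c \<alpha> v x - apply_bcontfun (f x) \<alpha>)"

definition Argmax :: "('a \<Rightarrow> real) \<Rightarrow> 'a set" where
  "Argmax g = {\<alpha>. \<forall>\<beta>. g \<beta> \<le> g \<alpha>}"

text \<open>Policy maps are defined on all of \<open>\<real>\<^sup>d\<close>; their values outside \<open>\<Omega>\<close> are never used.\<close>

definition policies :: "(real^'d::finite) set \<Rightarrow> (real^'d \<Rightarrow> 'a::topological_space) set" where
  "policies \<Omega> = measurable (lebesgue_on \<Omega>) borel"

definition max_policies ::
  "(real^'d::finite) set \<Rightarrow> (real^'d \<Rightarrow> ('a::topological_space \<Rightarrow>\<^sub>C (real^'d^'d)))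
     \<Rightarrow> (real^'d \<Rightarrow> ('a \<Rightarrow>\<^sub>C (real^'d))) \<Rightarrow> (real^'d \<Rightarrow> ('a \<Rightarrow>\<^sub>C real))
     \<Rightarrow> (real^'d \<Rightarrow> ('a \<Rightarrow>\<^sub>C real)) \<Rightarrow> 'd ae_fun \<Rightarrow> (real^'d \<Rightarrow> 'a) set" where
  "max_policies \<Omega> A b c f v =
     {q \<in> policies \<Omega>. AE x in lebesgue_on \<Omega>.
        q x \<in> Argmax (\<lambda>\<alpha>. ell_op \<Omega> A b c \<alpha> v x - apply_bcontfun (f x) \<alpha>)}"

text \<open>
  Elements of \<open>max_policies\<close> are constrained only almost everywhere, so at any single point \<open>x\<close> the
  value \<open>q x\<close> can be changed freely and the infimum of \<open>dist (p x) (q x)\<close> over all \<open>q\<close>, taken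
  separately at every point, is always zero. As the function is only considered as an
  element of \<open>L\<^sub>\<infinity>(\<Omega>)\<close>, the infimum has to be the one of classes of functions modulo
  equality almost everywhere.
\<close>

definition policy_dist ::
  "(real^'d::finite) set \<Rightarrow> (real^'d \<Rightarrow> 'a::metric_space) \<Rightarrow> (real^'d \<Rightarrow> 'a) set \<Rightarrow> real^'d \<Rightarrow> real" where
  "policy_dist \<Omega> p Q = ess_inf (lebesgue_on \<Omega>) ((\<lambda>q x. dist (p x) (q x)) ` Q)"

definition uniform_policy_convergence ::
  "(real^'d::finite) set \<Rightarrow> (real^'d \<Rightarrow> ('a::metric_space \<Rightarrow>\<^sub>C (real^'d^'d)))
     \<Rightarrow> (real^'d \<Rightarrow> ('a \<Rightarrow>\<^sub>C (real^'d))) \<Rightarrow> (real^'d \<Rightarrow> ('a \<Rightarrow>\<^sub>C real))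
     \<Rightarrow> (real^'d \<Rightarrow> ('a \<Rightarrow>\<^sub>C real)) \<Rightarrow> bool" where
  "uniform_policy_convergence \<Omega> A b c f \<longleftrightarrow>
     (\<forall>vs v qs. (\<forall>j::nat. vs j \<in> H2 \<Omega> \<inter> H10 \<Omega>) \<and> v \<in> H2 \<Omega> \<inter> H10 \<Omega>
        \<and> (\<lambda>j. H2_norm \<Omega> (vs j - v)) \<longlonglongrightarrow> 0
        \<and> (\<forall>j. qs j \<in> max_policies \<Omega> A b c f (vs j))
        \<longrightarrow> (\<lambda>j. Linf_norm \<Omega> (policy_dist \<Omega> (qs j) (max_policies \<Omega> A b c f v))) \<longlonglongrightarrow> 0)"

end

theory Submission
  imports Defs
begin

text \<open>
  Let \<open>q\<close> be a maximising policy for \<open>v + e\<close> and \<open>p\<close> one for \<open>v\<close>. Maximality of \<open>p\<close> at \<open>v\<close>, tested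
  against \<open>q\<close>, and of \<open>q\<close> at \<open>v + e\<close>, tested against \<open>p\<close>, enclose the residual
  \<open>R = F[v + e] - F[v] - L\<^sup>q e\<close> almost everywhere: \<open>(L\<^sup>p - L\<^sup>q) e \<le> R \<le> 0\<close> (\<open>residual_bound\<close>).
  So it suffices that \<open>(L\<^sup>p - L\<^sup>q) e\<close> is small in \<open>L\<^sub>2\<close> compared with the \<open>H\<^sup>2\<close> norm of \<open>e\<close>, where \<open>p\<close>
  may be taken pointwise closest to \<open>q\<close>; by hypothesis the distance of \<open>p\<close> and \<open>q\<close> then tends to \<open>0\<close>
  essentially uniformly as \<open>e\<close> tends to \<open>0\<close>.

  Closeness of \<open>p\<close> and \<open>q\<close> alone does not control the second order part. The modulus of continuity
  of \<open>A(x)\<close> as a function of \<open>\<alpha>\<close> depends on \<open>x\<close>, and second derivatives of a bounded family in \<open>H\<^sup>2\<close>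
  may concentrate exactly where it is bad. But the same concentration makes uniform convergence of
  policies a strong hypothesis: it forces \<open>A(x)\<close> to be independent of \<open>\<alpha>\<close> for almost every \<open>x\<close>
  (\<open>leading_coefficient_constant\<close>), so that the second order part of \<open>L\<^sup>p - L\<^sup>q\<close> vanishes. Indeed, at
  arbitrarily small cost in \<open>H\<^sup>2\<close> one can change the Hessian on a small ball from \<open>k E\<close> to \<open>- k E\<close>, with
  \<open>k\<close> as large as one likes, while values and gradients stay bounded there (\<open>hessian_flip\<close>). Maximisers
  for \<open>k E\<close> almost maximise \<open>A : E\<close>, those for \<open>- k E\<close> almost minimise it; if \<open>A : E\<close> were not constant
  in \<open>\<alpha>\<close>, they would stay apart by a fixed distance on a set of positive measure.

  In the lower order part the multipliers \<open>b\<^sup>p - b\<^sup>q\<close> and \<open>c\<^sup>p - c\<^sup>q\<close> are bounded and tend to \<open>0\<close>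
  almost everywhere. They act on \<open>e\<close> and its gradient, and after division by the \<open>H\<^sup>2\<close> norm of \<open>e\<close> these
  lie in a relatively compact subset of \<open>L\<^sub>2\<close> (\<open>H1_eps_close_subsequence\<close>); therefore the products tend
  to \<open>0\<close> in \<open>L\<^sub>2\<close> (\<open>vanishing_multiplier\<close>). Compactness comes from two estimates: Poincare's inequality on the
  cubes of a fine grid for \<open>e\<close> itself, extended by zero (\<open>cube_inequality\<close>), and Green's formula for
  its gradient (\<open>gradient_interpolation\<close>).

  Two foundations are needed throughout. Weak derivatives are linear because they are unique, by
  the fundamental lemma of the calculus of variations. And maximisers, in particular the one
  closest to a given policy, can be chosen measurably in \<open>x\<close> (\<open>measurable_argmax_selection\<close>); the
  closest one attains the essential infimum in the hypothesis (\<open>policy_dist_closest\<close>).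
\<close>

section \<open>Smooth functions and cut-offs\<close>

subsection \<open>One variable\<close>

text \<open>Smoothness is split into finite orders, defined by recursion, so that each closure property below
  is a plain induction on the order.\<close>

fun ntimes_diff :: "nat \<Rightarrow> (real \<Rightarrow> real) \<Rightarrow> bool" where
  "ntimes_diff 0 g = True"
| "ntimes_diff (Suc n) g = (\<exists>g'. (\<forall>x. (g has_real_derivative g' x) (at x)) \<and> ntimes_diff n g')"

lemma ntimes_diff_SucD: "ntimes_diff (Suc n) g \<Longrightarrow> ntimes_diff n g"
proof (induction n arbitrary: g)
  case (Suc n)
  from Suc.prems obtain g' where g': "\<forall>x. (g has_real_derivative g' x) (at x)" "ntimes_diff (Suc n) g'"
    by (metis ntimes_diff.simps(2))
  with Suc.IH[of g'] show ?case by auto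
qed auto

lemma ntimes_diff_const: "ntimes_diff n (\<lambda>_. c)"
proof (induction n arbitrary: c)
  case (Suc n)
  show ?case using Suc.IH[of 0] by (auto intro!: exI[of _ "\<lambda>_. 0"])
qed auto

lemma ntimes_diff_add:
  "ntimes_diff n f \<Longrightarrow> ntimes_diff n g \<Longrightarrow> ntimes_diff n (\<lambda>x. f x + g x)"
proof (induction n arbitrary: f g)
  case (Suc n)
  then obtain f' g' where *: "\<forall>x. (f has_real_derivative f' x) (at x)" "ntimes_diff n f'"
    "\<forall>x. (g has_real_derivative g' x) (at x)" "ntimes_diff n g'"
    by (metis ntimes_diff.simps(2))
  show ?case unfolding ntimes_diff.simps(2)
    by (rule exI[of _ "\<lambda>x. f' x + g' x"]) (use * Suc.IH in \<open>auto intro: DERIV_add\<close>)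
qed auto

lemma ntimes_diff_mult:
  "ntimes_diff n f \<Longrightarrow> ntimes_diff n g \<Longrightarrow> ntimes_diff n (\<lambda>x. f x * g x)"
proof (induction n arbitrary: f g)
  case (Suc n)
  then obtain f' g' where *: "\<forall>x. (f has_real_derivative f' x) (at x)" "ntimes_diff n f'"
    "\<forall>x. (g has_real_derivative g' x) (at x)" "ntimes_diff n g'"
    by (metis ntimes_diff.simps(2))
  have "ntimes_diff n (\<lambda>x. f' x * g x + g' x * f x)"
    by (intro ntimes_diff_add Suc.IH * Suc.prems[THEN ntimes_diff_SucD])
  moreover have "\<forall>x. ((\<lambda>x. f x * g x) has_real_derivative f' x * g x + g' x * f x) (at x)"
    using * by (auto intro: DERIV_mult)
  ultimately show ?case unfolding ntimes_diff.simps(2) by (intro exI conjI)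
qed auto

lemma ntimes_diff_inverse:
  assumes "\<And>x. f x \<noteq> 0"
  shows "ntimes_diff n f \<Longrightarrow> ntimes_diff n (\<lambda>x. inverse (f x))"
proof (induction n)
  case (Suc n)
  then obtain f' where *: "\<forall>x. (f has_real_derivative f' x) (at x)" "ntimes_diff n f'"
    by (metis ntimes_diff.simps(2))
  have "ntimes_diff n (\<lambda>x. (-1) * (inverse (f x) * (f' x * inverse (f x))))"
    by (intro ntimes_diff_mult ntimes_diff_const Suc.IH * Suc.prems[THEN ntimes_diff_SucD])
  moreover have "\<forall>x. ((\<lambda>x. inverse (f x)) has_real_derivative (-1) * (inverse (f x) * (f' x * inverse (f x)))) (at x)"
    using DERIV_inverse'[of f _ _ UNIV] * assms by (simp add: mult.assoc)
  ultimately show ?case unfolding ntimes_diff.simps(2) by (intro exI conjI)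
qed auto

lemma ntimes_diff_affine:
  "ntimes_diff n f \<Longrightarrow> ntimes_diff n (\<lambda>x. f (a * x + b))"
proof (induction n arbitrary: f)
  case (Suc n)
  then obtain f' where *: "\<forall>x. (f has_real_derivative f' x) (at x)" "ntimes_diff n f'"
    by (metis ntimes_diff.simps(2))
  have "ntimes_diff n (\<lambda>x. f' (a * x + b) * a)"
    by (intro ntimes_diff_mult ntimes_diff_const Suc.IH *)
  moreover have "((\<lambda>x. f (a * x + b)) has_real_derivative f' (a * x + b) * a) (at x)" for x
    by (rule DERIV_chain2[of f]) (use * in \<open>auto intro!: derivative_eq_intros\<close>)
  ultimately show ?case unfolding ntimes_diff.simps(2) by (intro exI conjI) auto
qed auto

lemma ntimes_diff_id: "ntimes_diff n (\<lambda>x. x)"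
  by (cases n) (auto intro!: exI[of _ "\<lambda>_. 1"] ntimes_diff_const)

text \<open>The flat functions \<open>t\<^sup>-\<^sup>k exp (-1/t)\<close>, extended by \<open>0\<close>; their derivatives are again
  combinations of functions of the same family, which is why the family is treated at once.\<close>

definition flat_exp :: "nat \<Rightarrow> real \<Rightarrow> real" where
  "flat_exp k t = (if t > 0 then (1 / t) ^ k * exp (- (1 / t)) else 0)"

lemma flat_exp_deriv:
  "(flat_exp k has_real_derivative flat_exp (k + 2) t + (- real k) * flat_exp (k + 1) t) (at t)"
proof -
  consider "t > 0" | "t < 0" | "t = 0" by linarith
  then show ?thesis
  proof cases
    case 1
    have "((\<lambda>t. (1 / t) ^ k * exp (- (1 / t))) has_real_derivative
        flat_exp (k + 2) t + (- real k) * flat_exp (k + 1) t) (at t)"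
    proof -
      have d: "((\<lambda>t. 1 / t) has_real_derivative (- ((1 / t) ^ 2))) (at t)"
        using 1 by (auto intro!: derivative_eq_intros simp: power2_eq_square)
      have e: "((\<lambda>t. exp (- (1 / t))) has_real_derivative (exp (- (1 / t)) * (1 / t) ^ 2)) (at t)"
        using DERIV_fun_exp[OF DERIV_minus[OF d]] by simp
      have "(1 / t) ^ 2 * (1 / t) ^ (k - Suc 0) = (1 / t) ^ (k + 1)" if "k > 0"
        unfolding power_add[symmetric] using that by simp
      then have "real k * (- ((1 / t) ^ 2) * (1 / t) ^ (k - Suc 0)) * exp (- (1 / t))
          + exp (- (1 / t)) * (1 / t) ^ 2 * (1 / t) ^ k
          = flat_exp (k + 2) t + (- real k) * flat_exp (k + 1) t"
        using 1 by (cases "k = 0") (simp_all add: flat_exp_def power_add power2_eq_square algebra_simps)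
      then show ?thesis using DERIV_mult[OF DERIV_power[OF d] e, of k] by simp
    qed
    then show ?thesis
      by (rule has_field_derivative_transform_within_open[of _ _ _ "{0<..}"])
         (use 1 in \<open>auto simp: flat_exp_def\<close>)
  next
    case 2
    have "((\<lambda>t. 0) has_real_derivative 0) (at t)" by simp
    then have "(flat_exp k has_real_derivative 0) (at t)"
      by (rule has_field_derivative_transform_within_open[of _ _ _ "{..<0}"])
         (use 2 in \<open>auto simp: flat_exp_def\<close>)
    then show ?thesis using 2 by (simp add: flat_exp_def)
  next
    case 3
    have "((\<lambda>x. (flat_exp k (0 + x) - flat_exp k 0) / x) \<longlongrightarrow> 0) (at 0)"
      unfolding filterlim_split_at_real[of _ _ 0] filterlim_at_split
    proof
      show "((\<lambda>x. (flat_exp k (0 + x) - flat_exp k 0) / x) \<longlongrightarrow> 0) (at_left 0)"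
        by (rule tendsto_eventually) (auto simp: eventually_at_filter flat_exp_def)
      have "((\<lambda>x::real. x ^ (Suc k) / exp x) \<longlongrightarrow> 0) at_top"
        by (rule tendsto_power_div_exp_0)
      then have "((\<lambda>x::real. (inverse x) ^ (Suc k) / exp (inverse x)) \<longlongrightarrow> 0) (at_right 0)"
        by (rule filterlim_compose) (rule filterlim_inverse_at_top_right)
      moreover have "eventually (\<lambda>x::real. (inverse x) ^ (Suc k) / exp (inverse x)
          = (flat_exp k (0 + x) - flat_exp k 0) / x) (at_right 0)"
        by (auto simp: eventually_at_filter flat_exp_def field_simps exp_minus)
      ultimately show "((\<lambda>x. (flat_exp k (0 + x) - flat_exp k 0) / x) \<longlongrightarrow> 0) (at_right 0)"
        by (rule Lim_transform_eventually)
    qed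
    then have "(flat_exp k has_real_derivative 0) (at 0)" by (simp add: DERIV_def)
    then show ?thesis using 3 by (simp add: flat_exp_def)
  qed
qed

lemma ntimes_diff_flat_exp: "ntimes_diff n (flat_exp k)"
proof (induction n arbitrary: k)
  case (Suc n)
  have "ntimes_diff n (\<lambda>t. flat_exp (k + 2) t + (- real k) * flat_exp (k + 1) t)"
    by (intro ntimes_diff_add ntimes_diff_mult ntimes_diff_const Suc.IH)
  then show ?case unfolding ntimes_diff.simps(2)
    by (intro exI[of _ "\<lambda>t. flat_exp (k + 2) t + (- real k) * flat_exp (k + 1) t"] conjI allI flat_exp_deriv)
qed auto

text \<open>The denominator never vanishes, as \<open>t\<close> and \<open>1 - t\<close> cannot both be nonpositive.\<close>

definition smooth_step :: "real \<Rightarrow> real" where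
  "smooth_step t = flat_exp 0 t * inverse (flat_exp 0 t + flat_exp 0 (1 - t))"

lemma flat_exp_0_pos: "t > 0 \<Longrightarrow> flat_exp 0 t > 0"
  and flat_exp_0_nonneg: "flat_exp 0 t \<ge> 0"
  and flat_exp_0_zero: "t \<le> 0 \<Longrightarrow> flat_exp 0 t = 0"
  and flat_exp_0_le1: "flat_exp 0 t \<le> 1"
  by (auto simp: flat_exp_def)

lemma ntimes_diff_smooth_step: "ntimes_diff n smooth_step"
proof -
  have "flat_exp 0 t + flat_exp 0 (-1 * t + 1) \<noteq> 0" for t
    using flat_exp_0_pos[of t] flat_exp_0_pos[of "-1 * t + 1"]
      flat_exp_0_nonneg[of t] flat_exp_0_nonneg[of "-1 * t + 1"]
    by (cases "t > 0") auto
  then have "ntimes_diff n (\<lambda>t. flat_exp 0 t * inverse (flat_exp 0 t + flat_exp 0 (-1 * t + 1)))"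
    by (intro ntimes_diff_mult ntimes_diff_flat_exp ntimes_diff_inverse ntimes_diff_add
        ntimes_diff_affine)
  moreover have "smooth_step = (\<lambda>t. flat_exp 0 t * inverse (flat_exp 0 t + flat_exp 0 (-1 * t + 1)))"
    by (auto simp: smooth_step_def algebra_simps)
  ultimately show ?thesis by simp
qed

lemma smooth_step_0: "t \<le> 0 \<Longrightarrow> smooth_step t = 0"
  by (simp add: smooth_step_def flat_exp_0_zero)

lemma smooth_step_1: "t \<ge> 1 \<Longrightarrow> smooth_step t = 1"
  using flat_exp_0_pos[of t] by (simp add: smooth_step_def flat_exp_0_zero)

definition plateau :: "real \<Rightarrow> real" where
  "plateau t = smooth_step (2 + t) * smooth_step (2 - t)"

lemma ntimes_diff_plateau: "ntimes_diff n plateau"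
proof -
  have "ntimes_diff n (\<lambda>t. smooth_step (1 * t + 2) * smooth_step (-1 * t + 2))"
    by (intro ntimes_diff_mult ntimes_diff_affine ntimes_diff_smooth_step)
  moreover have "plateau = (\<lambda>t. smooth_step (1 * t + 2) * smooth_step (-1 * t + 2))"
    by (auto simp: plateau_def algebra_simps)
  ultimately show ?thesis by simp
qed

lemma plateau_1: "\<bar>t\<bar> \<le> 1 \<Longrightarrow> plateau t = 1"
  by (simp add: plateau_def smooth_step_1)

lemma plateau_0: "\<bar>t\<bar> \<ge> 2 \<Longrightarrow> plateau t = 0"
  by (cases "t \<ge> 0") (auto simp: plateau_def smooth_step_0)

subsection \<open>Several variables\<close>

text \<open>Differentiability \<open>n + 1\<close> times, by the same device as in one variable: the smooth functions are the
  intersection of these classes.\<close>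

fun kdiff :: "nat \<Rightarrow> (real^'d::finite \<Rightarrow> real) \<Rightarrow> bool" where
  "kdiff 0 \<phi> = (\<forall>x. \<phi> differentiable (at x))"
| "kdiff (Suc n) \<phi> = ((\<forall>x. \<phi> differentiable (at x)) \<and> (\<forall>i. kdiff n (pderiv_at i \<phi>)))"

lemma kdiff_differentiable: "kdiff n \<phi> \<Longrightarrow> \<phi> differentiable (at x)"
  by (cases n) auto

lemma kdiff_SucD: "kdiff (Suc n) \<phi> \<Longrightarrow> kdiff n \<phi>"
  by (induction n arbitrary: \<phi>) auto

lemma kdiff_iff: "kdiff n \<phi> \<longleftrightarrow> (\<forall>is x. length is \<le> n \<longrightarrow> foldr pderiv_at is \<phi> differentiable (at x))"
proof (induction n arbitrary: \<phi>)
  case (Suc n)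
  show ?case
  proof
    assume L: "kdiff (Suc n) \<phi>"
    show "\<forall>is x. length is \<le> Suc n \<longrightarrow> foldr pderiv_at is \<phi> differentiable (at x)"
    proof (intro allI impI)
      fix "is" :: "'a list" and x assume len: "length is \<le> Suc n"
      show "foldr pderiv_at is \<phi> differentiable (at x)"
      proof (cases "is" rule: rev_cases)
        case Nil then show ?thesis using L by simp
      next
        case (snoc js i)
        then show ?thesis using L Suc.IH[of "pderiv_at i \<phi>"] len by simp
      qed
    qed
  next
    assume R: "\<forall>is x. length is \<le> Suc n \<longrightarrow> foldr pderiv_at is \<phi> differentiable (at x)"
    have "\<phi> differentiable (at x)" for x using R[rule_format, of "[]"] by simp
    moreover have "kdiff n (pderiv_at i \<phi>)" for i
      unfolding Suc.IH
    proof (intro allI impI)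
      fix "is" :: "'a list" and x assume "length is \<le> n"
      then show "foldr pderiv_at is (pderiv_at i \<phi>) differentiable (at x)"
        using R[rule_format, of "is @ [i]" x] by simp
    qed
    ultimately show "kdiff (Suc n) \<phi>" by simp
  qed
qed auto

lemma smooth_fun_iff: "smooth_fun \<phi> \<longleftrightarrow> (\<forall>n. kdiff n \<phi>)"
  unfolding smooth_fun_def kdiff_iff by (meson le_refl)

lemma pderiv_at_eq: "(\<phi> has_derivative D) (at x) \<Longrightarrow> pderiv_at i \<phi> x = D (axis i 1)"
  unfolding pderiv_at_def using frechet_derivative_at by metis

lemma pderiv_at_mult:
  assumes "\<And>x. \<phi> differentiable (at x)" "\<And>x. \<psi> differentiable (at x)"
  shows "pderiv_at i (\<lambda>x. \<phi> x * \<psi> x) = (\<lambda>x. \<phi> x * pderiv_at i \<psi> x + pderiv_at i \<phi> x * \<psi> x)"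
proof
  fix x
  have "(\<phi> has_derivative frechet_derivative \<phi> (at x)) (at x)" "(\<psi> has_derivative frechet_derivative \<psi> (at x)) (at x)"
    using assms frechet_derivative_works by blast+
  from has_derivative_mult[OF this] show "pderiv_at i (\<lambda>x. \<phi> x * \<psi> x) x = \<phi> x * pderiv_at i \<psi> x + pderiv_at i \<phi> x * \<psi> x"
    by (subst pderiv_at_eq) (auto simp: pderiv_at_def)
qed

lemma pderiv_at_add:
  assumes "\<And>x. \<phi> differentiable (at x)" "\<And>x. \<psi> differentiable (at x)"
  shows "pderiv_at i (\<lambda>x. \<phi> x + \<psi> x) = (\<lambda>x. pderiv_at i \<phi> x + pderiv_at i \<psi> x)"
proof
  fix x
  have "(\<phi> has_derivative frechet_derivative \<phi> (at x)) (at x)" "(\<psi> has_derivative frechet_derivative \<psi> (at x)) (at x)"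
    using assms frechet_derivative_works by blast+
  from has_derivative_add[OF this] show "pderiv_at i (\<lambda>x. \<phi> x + \<psi> x) x = pderiv_at i \<phi> x + pderiv_at i \<psi> x"
    by (subst pderiv_at_eq) (auto simp: pderiv_at_def)
qed

lemma pderiv_at_const: "pderiv_at i (\<lambda>x. c) = (\<lambda>x. 0)"
  using pderiv_at_eq[OF has_derivative_const] by fastforce

lemma pderiv_at_component:
  assumes "\<And>t. (g has_real_derivative g' t) (at t)"
  shows "(\<lambda>x. g ((x::real^'d::finite) $ j)) differentiable (at x)"
    "pderiv_at i (\<lambda>x::real^'d. g (x $ j)) = (\<lambda>x. (if i = j then 1 else 0) * g' (x $ j))"
proof -
  have *: "((\<lambda>x::real^'d. g (x $ j)) has_derivative (\<lambda>h. g' (x $ j) * (h $ j))) (at x)" for x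
  proof -
    have "((\<lambda>x::real^'d. x $ j) has_derivative (\<lambda>h. h $ j)) (at x)"
      by (rule bounded_linear.has_derivative[OF bounded_linear_vec_nth]) simp
    moreover have "(g has_derivative (\<lambda>h. g' (x $ j) * h)) (at (x $ j))"
      using assms has_field_derivative_def by blast
    ultimately show ?thesis by (rule has_derivative_compose)
  qed
  show "(\<lambda>x. g ((x::real^'d) $ j)) differentiable (at x)" using * differentiable_def by blast
  show "pderiv_at i (\<lambda>x::real^'d. g (x $ j)) = (\<lambda>x. (if i = j then 1 else 0) * g' (x $ j))"
    using pderiv_at_eq[OF *] by (auto simp: axis_def fun_eq_iff)
qed

lemma kdiff_const: "kdiff n (\<lambda>x. c)"
  by (induction n arbitrary: c) (auto simp: pderiv_at_const)

lemma kdiff_add: "kdiff n \<phi> \<Longrightarrow> kdiff n \<psi> \<Longrightarrow> kdiff n (\<lambda>x. \<phi> x + \<psi> x)"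
  by (induction n arbitrary: \<phi> \<psi>) (auto simp: pderiv_at_add differentiable_add)

lemma kdiff_mult: "kdiff n \<phi> \<Longrightarrow> kdiff n \<psi> \<Longrightarrow> kdiff n (\<lambda>x. \<phi> x * \<psi> x)"
proof (induction n arbitrary: \<phi> \<psi>)
  case (Suc n)
  note k = Suc.prems[THEN kdiff_SucD]
  have "kdiff n (pderiv_at i \<phi>)" "kdiff n (pderiv_at i \<psi>)" for i using Suc.prems by auto
  then have "kdiff n (\<lambda>x. \<phi> x * pderiv_at i \<psi> x + pderiv_at i \<phi> x * \<psi> x)" for i
    by (intro kdiff_add Suc.IH k)
  then show ?case using Suc.prems by (auto simp: pderiv_at_mult differentiable_mult)
qed auto

lemma kdiff_component: "ntimes_diff (Suc n) g \<Longrightarrow> kdiff n (\<lambda>x. g (x $ j))"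
proof (induction n arbitrary: g)
  case 0
  then show ?case using pderiv_at_component(1) by auto
next
  case (Suc n)
  then obtain g' where *: "\<And>x. (g has_real_derivative g' x) (at x)" "ntimes_diff (Suc n) g'"
    by (metis ntimes_diff.simps(2))
  have "kdiff n (\<lambda>x::real^'a. (if i = j then 1 else 0) * g' (x $ j))" for i
    by (intro kdiff_mult kdiff_const Suc.IH *)
  then show ?case
    by (simp add: pderiv_at_component(1)[OF *(1)] pderiv_at_component(2)[OF *(1)] del: if_split)
qed

lemma smooth_fun_const: "smooth_fun (\<lambda>x. c)"
  and smooth_fun_add: "smooth_fun \<phi> \<Longrightarrow> smooth_fun \<psi> \<Longrightarrow> smooth_fun (\<lambda>x. \<phi> x + \<psi> x)"
  and smooth_fun_mult: "smooth_fun \<phi> \<Longrightarrow> smooth_fun \<psi> \<Longrightarrow> smooth_fun (\<lambda>x. \<phi> x * \<psi> x)"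
  and smooth_fun_component: "(\<And>n. ntimes_diff n g) \<Longrightarrow> smooth_fun (\<lambda>x. g (x $ j))"
  unfolding smooth_fun_iff by (auto intro: kdiff_const kdiff_add kdiff_mult kdiff_component)

lemma smooth_fun_prod: "finite I \<Longrightarrow> (\<And>i. i \<in> I \<Longrightarrow> smooth_fun (\<phi> i)) \<Longrightarrow> smooth_fun (\<lambda>x. \<Prod>i\<in>I. \<phi> i x)"
  by (induction I rule: finite_induct) (auto intro: smooth_fun_const smooth_fun_mult)

lemma smooth_fun_pderiv: "smooth_fun \<phi> \<Longrightarrow> smooth_fun (pderiv_at i \<phi>)"
  unfolding smooth_fun_iff by (metis kdiff.simps(2))

lemma smooth_fun_differentiable: "smooth_fun \<phi> \<Longrightarrow> \<phi> differentiable (at x)"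
  unfolding smooth_fun_iff using kdiff_differentiable by blast

lemma smooth_fun_continuous: "smooth_fun \<phi> \<Longrightarrow> continuous_on S \<phi>"
  by (meson smooth_fun_differentiable differentiable_imp_continuous_within continuous_at_imp_continuous_on)

subsection \<open>Test functions\<close>

lemma test_funs_smooth: "\<phi> \<in> test_funs \<Omega> \<Longrightarrow> smooth_fun \<phi>" by (simp add: test_funs_def)

lemma test_funsI:
  assumes "smooth_fun \<phi>" "compact K" "K \<subseteq> \<Omega>" "\<And>x. x \<notin> K \<Longrightarrow> \<phi> x = 0"
  shows "\<phi> \<in> test_funs \<Omega>"
proof -
  have "closure {x. \<phi> x \<noteq> 0} \<subseteq> K"
    using assms by (intro closure_minimal) (auto intro: compact_imp_closed)
  moreover have "compact (closure {x. \<phi> x \<noteq> 0})"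
    using calculation assms(2) by (metis closed_closure compact_Int_closed inf.absorb_iff2)
  ultimately show ?thesis using assms unfolding test_funs_def by blast
qed

text \<open>Partial derivatives are local; this is how the derivatives of cut-off functions are computed where
  the cut-off is constant.\<close>

lemma pderiv_at_local:
  assumes "open U" "x \<in> U" "\<And>y. y \<in> U \<Longrightarrow> \<phi> y = \<psi> y" "\<psi> differentiable (at x)"
  shows "pderiv_at i \<phi> x = pderiv_at i \<psi> x"
proof -
  have "(\<psi> has_derivative frechet_derivative \<psi> (at x)) (at x)"
    using assms frechet_derivative_works by blast
  then have "(\<phi> has_derivative frechet_derivative \<psi> (at x)) (at x)"
    by (rule has_derivative_transform_within_open[OF _ assms(1,2)]) (use assms in auto)
  from pderiv_at_eq[OF this] show ?thesis by (simp add: pderiv_at_def)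
qed

lemma pderiv_at_outside_support:
  assumes "x \<notin> closure {x. \<phi> x \<noteq> 0}" shows "pderiv_at i \<phi> x = 0"
proof -
  have "pderiv_at i \<phi> x = pderiv_at i (\<lambda>_. 0) x"
    by (rule pderiv_at_local[of "- closure {x. \<phi> x \<noteq> 0}"])
       (use assms closure_subset[of "{x. \<phi> x \<noteq> 0}"] in auto)
  then show ?thesis by (simp add: pderiv_at_const)
qed

lemma test_funs_pderiv: "\<phi> \<in> test_funs \<Omega> \<Longrightarrow> pderiv_at i \<phi> \<in> test_funs \<Omega>"
  by (rule test_funsI[of _ "closure {x. \<phi> x \<noteq> 0}"])
     (simp_all add: test_funs_def smooth_fun_pderiv pderiv_at_outside_support)

lemma test_funs_outside: "\<phi> \<in> test_funs \<Omega> \<Longrightarrow> x \<notin> \<Omega> \<Longrightarrow> \<phi> x = 0"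
  unfolding test_funs_def using closure_subset[of "{x. \<phi> x \<noteq> 0}"] by blast

lemma test_funs_compact:
  assumes "\<phi> \<in> test_funs \<Omega>"
  obtains K where "compact K" "K \<subseteq> \<Omega>" "\<And>x. x \<notin> K \<Longrightarrow> \<phi> x = 0" "\<And>x i. x \<notin> K \<Longrightarrow> pderiv_at i \<phi> x = 0"
proof (rule that)
  show "compact (closure {x. \<phi> x \<noteq> 0})" "closure {x. \<phi> x \<noteq> 0} \<subseteq> \<Omega>"
    using assms by (auto simp: test_funs_def)
  show "\<phi> x = 0" if "x \<notin> closure {x. \<phi> x \<noteq> 0}" for x
    using that closure_subset[of "{x. \<phi> x \<noteq> 0}"] by auto
qed (rule pderiv_at_outside_support)

lemma test_funs_add: "\<phi> \<in> test_funs \<Omega> \<Longrightarrow> \<psi> \<in> test_funs \<Omega> \<Longrightarrow> (\<lambda>x. \<phi> x + \<psi> x) \<in> test_funs \<Omega>"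
proof -
  assume a: "\<phi> \<in> test_funs \<Omega>" "\<psi> \<in> test_funs \<Omega>"
  obtain K where K: "compact K" "K \<subseteq> \<Omega>" "\<And>x. x \<notin> K \<Longrightarrow> \<phi> x = 0" using test_funs_compact[OF a(1)] by metis 
  obtain L where L: "compact L" "L \<subseteq> \<Omega>" "\<And>x. x \<notin> L \<Longrightarrow> \<psi> x = 0" using test_funs_compact[OF a(2)] by metis
  show ?thesis
    by (rule test_funsI[of _ "K \<union> L"]) (use K L a in \<open>auto intro: smooth_fun_add test_funs_smooth\<close>)
qed

lemma test_funs_scale: "\<phi> \<in> test_funs \<Omega> \<Longrightarrow> (\<lambda>x. c * \<phi> x) \<in> test_funs \<Omega>"
proof -
  assume a: "\<phi> \<in> test_funs \<Omega>"
  obtain K where K: "compact K" "K \<subseteq> \<Omega>" "\<And>x. x \<notin> K \<Longrightarrow> \<phi> x = 0" using test_funs_compact[OF a] by metis 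
  show ?thesis
    by (rule test_funsI[of _ K]) (use K a in \<open>auto intro: smooth_fun_mult smooth_fun_const test_funs_smooth\<close>)
qed

lemma pderiv_at_scale: "(\<And>x. \<phi> differentiable (at x)) \<Longrightarrow> pderiv_at i (\<lambda>x. c * \<phi> x) = (\<lambda>x. c * pderiv_at i \<phi> x)"
  by (subst pderiv_at_mult) (auto simp: pderiv_at_const)

lemma test_funs_bounded:
  assumes "\<phi> \<in> test_funs \<Omega>" obtains C where "C \<ge> 0" "\<And>x. \<bar>\<phi> x\<bar> \<le> C"
proof -
  obtain K where K: "compact K" "K \<subseteq> \<Omega>" "\<And>x. x \<notin> K \<Longrightarrow> \<phi> x = 0" using test_funs_compact[OF assms] by metis
  have "compact (\<phi> ` K)"
    using K assms by (intro compact_continuous_image smooth_fun_continuous test_funs_smooth)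
  then obtain B where B: "\<And>x. x \<in> K \<Longrightarrow> \<bar>\<phi> x\<bar> \<le> B" using compact_imp_bounded bounded_iff by (metis image_eqI real_norm_def)
  have "\<bar>\<phi> x\<bar> \<le> max B 0" for x using B[of x] K(3)[of x] by (cases "x \<in> K") auto
  then show ?thesis using that[of "max B 0"] by auto
qed

lemma test_funs_borel: "\<phi> \<in> test_funs \<Omega> \<Longrightarrow> \<phi> \<in> borel_measurable borel"
  by (intro borel_measurable_continuous_onI smooth_fun_continuous test_funs_smooth)

section \<open>Difference quotients of test functions\<close>

lemma test_funs_mono: "\<phi> \<in> test_funs \<Omega> \<Longrightarrow> \<Omega> \<subseteq> \<Omega>' \<Longrightarrow> \<phi> \<in> test_funs \<Omega>'"
  by (auto simp: test_funs_def)

lemma directional_derivative: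
  fixes F :: "real^'d::finite \<Rightarrow> real"
  assumes "\<And>x. F differentiable (at x)"
  shows "((\<lambda>s. F (x + s *\<^sub>R z)) has_real_derivative (\<Sum>i\<in>UNIV. z $ i * pderiv_at i F (x + s *\<^sub>R z))) (at s)"
proof -
  let ?D = "frechet_derivative F (at (x + s *\<^sub>R z))"
  have D: "(F has_derivative ?D) (at (x + s *\<^sub>R z))"
    using assms frechet_derivative_works by blast
  interpret D: bounded_linear ?D using D has_derivative_bounded_linear by blast
  have "((\<lambda>s. x + s *\<^sub>R z) has_derivative (\<lambda>h. h *\<^sub>R z)) (at s)"
    by (auto intro!: derivative_eq_intros)
  then have "((\<lambda>s. F (x + s *\<^sub>R z)) has_derivative (\<lambda>h. ?D (h *\<^sub>R z))) (at s)"
    using D by (rule has_derivative_compose)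
  moreover have "?D (h *\<^sub>R z) = (\<Sum>i\<in>UNIV. z $ i * pderiv_at i F (x + s *\<^sub>R z)) * h" for h
  proof -
    have "?D z = ?D (\<Sum>i\<in>UNIV. (z $ i) *\<^sub>R axis i 1)"
      by (simp add: basis_expansion scalar_mult_eq_scaleR[symmetric])
    also have "\<dots> = (\<Sum>i\<in>UNIV. z $ i * pderiv_at i F (x + s *\<^sub>R z))"
      by (simp add: D.sum D.scaleR pderiv_at_def)
    finally show ?thesis by (simp add: D.scaleR)
  qed
  ultimately have "((\<lambda>s. F (x + s *\<^sub>R z)) has_derivative
      (\<lambda>h. (\<Sum>i\<in>UNIV. z $ i * pderiv_at i F (x + s *\<^sub>R z)) * h)) (at s)" by simp
  then show ?thesis unfolding has_field_derivative_def .
qed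

text \<open>What dominated convergence needs when a derivative of a test function is replaced by difference
  quotients: a bound by a fixed integrable function and pointwise convergence.\<close>

lemma test_funs_difference_quotient:
  fixes F :: "real^'d::finite \<Rightarrow> real"
  assumes F: "F \<in> test_funs UNIV"
  obtains C R where "\<And>x t. 0 < t \<Longrightarrow> t \<le> 1 \<Longrightarrow> \<bar>(F (x + t *\<^sub>R z) - F x) / t\<bar> \<le> C * indicator (cball 0 R) x"
    "\<And>x. (\<lambda>n. (F (x + (1 / real (Suc n)) *\<^sub>R z) - F x) / (1 / real (Suc n))) \<longlonglongrightarrow> (\<Sum>i\<in>UNIV. z $ i * pderiv_at i F x)"
proof -
  have diff: "\<And>x. F differentiable (at x)" using F smooth_fun_differentiable test_funs_smooth by blast
  note dd = directional_derivative[OF diff]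
  have "\<forall>i. \<exists>C\<ge>0. \<forall>x. \<bar>pderiv_at i F x\<bar> \<le> C" using test_funs_bounded[OF test_funs_pderiv[OF F]] by metis
  then obtain C where C: "\<And>i. C i \<ge> 0" "\<And>i x. \<bar>pderiv_at i F x\<bar> \<le> C i" by metis
  obtain K where K: "compact K" "\<And>x. x \<notin> K \<Longrightarrow> F x = 0" using test_funs_compact[OF F] by metis
  obtain R where R: "\<And>x. x \<in> K \<Longrightarrow> norm x \<le> R" using K(1) compact_imp_bounded bounded_iff by metis
  let ?C = "\<Sum>i\<in>UNIV. \<bar>z $ i\<bar> * C i"
  have 1: "\<bar>(F (x + t *\<^sub>R z) - F x) / t\<bar> \<le> ?C * indicator (cball 0 (R + norm z)) x" if t: "0 < t" "t \<le> 1" for x t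
  proof (cases "norm x \<le> R + norm z")
    case True
    obtain s where s: "F (x + t *\<^sub>R z) - F (x + 0 *\<^sub>R z) = (t - 0) * (\<Sum>i\<in>UNIV. z $ i * pderiv_at i F (x + s *\<^sub>R z))"
      using MVT2[OF t(1), of "\<lambda>s. F (x + s *\<^sub>R z)" "\<lambda>s. \<Sum>i\<in>UNIV. z $ i * pderiv_at i F (x + s *\<^sub>R z)"] dd by blast
    have "\<bar>\<Sum>i\<in>UNIV. z $ i * pderiv_at i F (x + s *\<^sub>R z)\<bar> \<le> ?C"
      by (rule order_trans[OF sum_abs]) (auto intro!: sum_mono mult_left_mono C simp: abs_mult)
    with s t True show ?thesis by simp
  next
    case False
    have "norm (x + t *\<^sub>R z) \<ge> norm x - norm (t *\<^sub>R z)" by (metis norm_diff_ineq)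
    moreover have "norm (t *\<^sub>R z) \<le> norm z" using t by (simp add: mult_left_le_one_le)
    ultimately have "\<not> norm (x + t *\<^sub>R z) \<le> R" "\<not> norm x \<le> R" using False norm_ge_zero[of z] by linarith+
    then have "F (x + t *\<^sub>R z) = 0" "F x = 0" using R K(2) by blast+
    then show ?thesis using False by simp
  qed
  have 2: "(\<lambda>n. (F (x + (1 / real (Suc n)) *\<^sub>R z) - F x) / (1 / real (Suc n))) \<longlonglongrightarrow> (\<Sum>i\<in>UNIV. z $ i * pderiv_at i F x)" for x
  proof -
    have "((\<lambda>h. (F (x + h *\<^sub>R z) - F x) / h) \<longlongrightarrow> (\<Sum>i\<in>UNIV. z $ i * pderiv_at i F x)) (at 0)"
      using dd[of x z 0] by (simp add: DERIV_def)
    moreover have "filterlim (\<lambda>n. 1 / real (Suc n)) (at 0) sequentially"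
      using LIMSEQ_inverse_real_of_nat by (auto simp: filterlim_at inverse_eq_divide)
    ultimately show ?thesis by (rule filterlim_compose)
  qed
  from 1 2 show ?thesis by (rule that)
qed


lemma lborel_integral_translate:
  fixes g :: "real^'d::finite \<Rightarrow> real"
  assumes [measurable]: "g \<in> borel_measurable borel"
  shows "(LINT x|lborel. g (x + z)) = (LINT x|lborel. g x)"
proof -
  have "(LINT x|lborel. g x) = (LINT x|distr lborel borel ((+) z). g x)" by (simp add: lborel_distr_plus)
  also have "\<dots> = (LINT x|lborel. g (z + x))" by (rule integral_distr) auto
  finally show ?thesis by (simp add: add.commute)
qed

lemma lborel_integrable_translate:
  fixes g :: "real^'d::finite \<Rightarrow> real"
  assumes "integrable lborel g"
  shows "integrable lborel (\<lambda>x. g (x + z))"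
proof -
  have [measurable]: "g \<in> borel_measurable borel" using assms by auto
  have "integrable (distr lborel borel ((+) z)) g" using assms by (simp add: lborel_distr_plus)
  then show ?thesis by (subst (asm) integrable_distr_eq) (auto simp: add.commute)
qed

lemma test_funs_integrable: 
  fixes \<phi> :: "real^'d::finite \<Rightarrow> real"
  assumes "\<phi> \<in> test_funs \<Omega>" shows "integrable lborel \<phi>"
proof -
  obtain K where K: "compact K" "K \<subseteq> \<Omega>" "\<And>x. x \<notin> K \<Longrightarrow> \<phi> x = 0" using test_funs_compact[OF assms] by metis
  have "integrable lborel (\<lambda>x. indicator K x *\<^sub>R \<phi> x)"
    using K(1) smooth_fun_continuous[OF test_funs_smooth[OF assms]] by (rule borel_integrable_compact)
  moreover have "(\<lambda>x. indicator K x *\<^sub>R \<phi> x) = \<phi>" using K(3) by (auto simp: indicator_def fun_eq_iff)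
  ultimately show ?thesis by simp
qed

lemma test_funs_mult: "\<phi> \<in> test_funs \<Omega> \<Longrightarrow> smooth_fun \<psi> \<Longrightarrow> (\<lambda>x. \<phi> x * \<psi> x) \<in> test_funs \<Omega>"
proof -
  assume a: "\<phi> \<in> test_funs \<Omega>" "smooth_fun \<psi>"
  obtain K where K: "compact K" "K \<subseteq> \<Omega>" "\<And>x. x \<notin> K \<Longrightarrow> \<phi> x = 0" using test_funs_compact[OF a(1)] by metis
  show ?thesis
    by (rule test_funsI[of _ K]) (use K a in \<open>auto intro: smooth_fun_mult test_funs_smooth\<close>)
qed

text \<open>All difference quotients have integral \<open>0\<close> by translation invariance, hence so has their limit.\<close>

lemma integral_pderiv_test_fun:
  fixes F :: "real^'d::finite \<Rightarrow> real"
  assumes F: "F \<in> test_funs \<Omega>"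
  shows "(LINT x|lborel. pderiv_at i F x) = 0"
proof -
  have F: "F \<in> test_funs UNIV" using F test_funs_mono by blast
  note [measurable] = test_funs_borel[OF F]
  obtain C R where CR: "\<And>x t. 0 < t \<Longrightarrow> t \<le> 1 \<Longrightarrow> \<bar>(F (x + t *\<^sub>R axis i 1) - F x) / t\<bar> \<le> C * indicator (cball 0 R) x"
    "\<And>x. (\<lambda>n. (F (x + (1 / real (Suc n)) *\<^sub>R axis i 1) - F x) / (1 / real (Suc n))) \<longlonglongrightarrow> (\<Sum>j\<in>UNIV. axis i 1 $ j * pderiv_at j F x)"
    using test_funs_difference_quotient[OF F, of "axis i 1"] by metis
  have eq: "(\<Sum>j\<in>UNIV. (axis i 1::real^'d) $ j * pderiv_at j F x) = pderiv_at i F x" for x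
    by (simp add: axis_def if_distrib[of "\<lambda>c. c * _"] cong: if_cong)
  let ?G = "\<lambda>n x. (F (x + (1 / real (Suc n)) *\<^sub>R axis i 1) - F x) / (1 / real (Suc n))"
  note pm = test_funs_borel[OF test_funs_pderiv[OF F], of i]
  have "(\<lambda>n. LINT x|lborel. ?G n x) \<longlonglongrightarrow> (LINT x|lborel. pderiv_at i F x)"
  proof (rule integral_dominated_convergence[where w = "\<lambda>x. C * indicator (cball 0 R) x"])
    show "integrable lborel (\<lambda>x. C * indicator (cball 0 R) x :: real)"
      by (intro integrable_mult_right integrable_real_indicator emeasure_lborel_cball_finite) auto
    show "AE x in lborel. (\<lambda>n. ?G n x) \<longlonglongrightarrow> pderiv_at i F x" using CR(2) eq by simp
    show "AE x in lborel. norm (?G n x) \<le> C * indicator (cball 0 R) x" for n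
      using CR(1)[of "1 / real (Suc n)"] by auto
  qed (use pm in auto)
  moreover have "(LINT x|lborel. ?G n x) = 0" for n
    using lborel_integral_translate[of F "(1 / real (Suc n)) *\<^sub>R axis i 1"] test_funs_integrable[OF F]
      lborel_integrable_translate[OF test_funs_integrable[OF F], of "(1 / real (Suc n)) *\<^sub>R axis i 1"]
    by (simp add: Bochner_Integration.integral_diff)
  ultimately show ?thesis by (simp add: LIMSEQ_const_iff)
qed

lemma integration_by_parts_test_funs:
  fixes \<phi> \<psi> :: "real^'d::finite \<Rightarrow> real"
  assumes "\<phi> \<in> test_funs \<Omega>" "\<psi> \<in> test_funs \<Omega>"
  shows "(LINT x|lborel. \<phi> x * pderiv_at i \<psi> x) = - (LINT x|lborel. pderiv_at i \<phi> x * \<psi> x)"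
proof -
  note s = assms[THEN test_funs_smooth]
  have "(LINT x|lborel. \<phi> x * pderiv_at i \<psi> x + pderiv_at i \<phi> x * \<psi> x) = 0"
    using integral_pderiv_test_fun[OF test_funs_mult[OF assms(1) s(2)], of i]
    by (simp add: pderiv_at_mult smooth_fun_differentiable s)
  moreover have "integrable lborel (\<lambda>x. \<phi> x * pderiv_at i \<psi> x)" "integrable lborel (\<lambda>x. pderiv_at i \<phi> x * \<psi> x)"
    by (rule test_funs_integrable[of _ \<Omega>], intro test_funs_mult test_funs_pderiv smooth_fun_pderiv assms s)+
  ultimately show ?thesis by simp
qed

text \<open>The \<open>L\<^sub>2\<close> distance of a function to its translate, controlled by the gradient. Applied to the translations
  within one cube, it yields Poincare's inequality below.\<close>

lemma translation_estimate:
  fixes F :: "real^'d::finite \<Rightarrow> real"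
  assumes F: "F \<in> test_funs \<Omega>"
  shows "(LINT x|lborel. (F (x + z) - F x)\<^sup>2) \<le> (norm z)\<^sup>2 * (LINT x|lborel. (\<Sum>i\<in>UNIV. (pderiv_at i F x)\<^sup>2))"
proof -
  have F: "F \<in> test_funs UNIV" using F test_funs_mono by blast
  note [measurable] = test_funs_borel[OF F] test_funs_borel[OF test_funs_pderiv[OF F]]
  obtain C R where CR: "\<And>x t. 0 < t \<Longrightarrow> t \<le> 1 \<Longrightarrow> \<bar>(F (x + t *\<^sub>R z) - F x) / t\<bar> \<le> C * indicator (cball 0 R) x"
    "\<And>x. (\<lambda>n. (F (x + (1 / real (Suc n)) *\<^sub>R z) - F x) / (1 / real (Suc n))) \<longlonglongrightarrow> (\<Sum>j\<in>UNIV. z $ j * pderiv_at j F x)"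
    using test_funs_difference_quotient[OF F, of z] by metis
  let ?G = "\<lambda>n x. (F (x + (1 / real (Suc n)) *\<^sub>R z) - F x) / (1 / real (Suc n))"
  have bd: "(?G n x)\<^sup>2 \<le> C\<^sup>2 * indicator (cball 0 R) x" for n x
  proof -
    have "\<bar>?G n x\<bar> \<le> C * indicator (cball 0 R) x" using CR(1)[of "1 / real (Suc n)"] by auto
    then have "\<bar>?G n x\<bar>^2 \<le> (C * indicator (cball 0 R) x)^2" by (rule power_mono) simp
    then show ?thesis by (cases "norm x \<le> R") (simp_all add: power_mult_distrib)
  qed
  then have bd': "norm ((?G n x)\<^sup>2) \<le> C\<^sup>2 * indicator (cball 0 R) x" for n x
    by (simp only: real_norm_def abs_power2)
  have ind: "integrable lborel (\<lambda>x. C\<^sup>2 * indicator (cball 0 R) x :: real)"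
    by (intro integrable_mult_right integrable_real_indicator emeasure_lborel_cball_finite) auto
  have int: "integrable lborel (\<lambda>x. (?G n x)\<^sup>2)" for n
  proof (rule Bochner_Integration.integrable_bound[OF ind])
    show "AE x in lborel. norm ((?G n x)\<^sup>2) \<le> norm (C\<^sup>2 * indicator (cball 0 R) x :: real)"
      using bd' by (intro AE_I2) (metis abs_ge_self order_trans real_norm_def)
  qed measurable
  have lim: "(\<lambda>n. LINT x|lborel. (?G n x)\<^sup>2) \<longlonglongrightarrow> (LINT x|lborel. (\<Sum>j\<in>UNIV. z $ j * pderiv_at j F x)\<^sup>2)"
  proof (rule integral_dominated_convergence[where w = "\<lambda>x. C\<^sup>2 * indicator (cball 0 R) x"])
    show "AE x in lborel. (\<lambda>n. (?G n x)\<^sup>2) \<longlonglongrightarrow> (\<Sum>j\<in>UNIV. z $ j * pderiv_at j F x)\<^sup>2"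
      by (rule AE_I2, rule tendsto_power, rule CR(2))
    show "AE x in lborel. norm ((?G n x)\<^sup>2) \<le> C\<^sup>2 * indicator (cball 0 R) x" for n
      by (rule AE_I2, rule bd')
  qed (use ind in auto)
  \<comment> \<open>\<open>F (x + z) - F x\<close> is the sum of the increments over \<open>n + 1\<close> equal steps, and all these
    increments have the same \<open>L\<^sub>2\<close> norm.\<close>
  have step: "(LINT x|lborel. (F (x + z) - F x)\<^sup>2) \<le> (LINT x|lborel. (?G n x)\<^sup>2)" for n
  proof -
    define N where "N = Suc n"
    define t where "t = 1 / real N"
    have N: "real N * t = 1" "N > 0" by (auto simp: N_def t_def)
    let ?d = "\<lambda>x. F (x + t *\<^sub>R z) - F x"
    have dG: "?G n x = real N * ?d x" for x by (simp add: t_def N_def)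
    have id: "integrable lborel (\<lambda>x. (?d x)\<^sup>2)"
    proof -
      have "t\<^sup>2 * (real N * y)\<^sup>2 = y\<^sup>2" for y
      proof -
        have "t\<^sup>2 * (real N * y)\<^sup>2 = (real N * t)\<^sup>2 * y\<^sup>2" by (simp add: power_mult_distrib)
        then show ?thesis using N by simp
      qed
      then show ?thesis
        using integrable_mult_right[OF int[of n], of "t\<^sup>2"] unfolding dG by simp
    qed
    have pt: "(F (x + z) - F x)\<^sup>2 \<le> real N * (\<Sum>k<N. (?d (x + (real k * t) *\<^sub>R z))\<^sup>2)" for x
    proof -
      have "(\<Sum>k<m. ?d (x + (real k * t) *\<^sub>R z)) = F (x + (real m * t) *\<^sub>R z) - F x" for m
        by (induction m) (auto simp: algebra_simps)
      from this[of N] have "F (x + z) - F x = (\<Sum>k<N. ?d (x + (real k * t) *\<^sub>R z))" using N by simp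
      also have "\<dots>\<^sup>2 \<le> real N * (\<Sum>k<N. (?d (x + (real k * t) *\<^sub>R z))\<^sup>2)"
        using sum_squared_le_sum_of_squares[of "\<lambda>k. ?d (x + (real k * t) *\<^sub>R z)" "{..<N}"] by (simp add: mult.commute)
      finally show ?thesis .
    qed
    have ik: "integrable lborel (\<lambda>x. (?d (x + (real k * t) *\<^sub>R z))\<^sup>2)" for k
      using lborel_integrable_translate[OF id] .
    have "(LINT x|lborel. (F (x + z) - F x)\<^sup>2) \<le> (LINT x|lborel. real N * (\<Sum>k<N. (?d (x + (real k * t) *\<^sub>R z))\<^sup>2))"
      by (rule integral_mono'[OF _ pt]) (use ik in \<open>auto intro!: sum_nonneg mult_nonneg_nonneg\<close>)
    also have "\<dots> = real N * (\<Sum>k<N. LINT x|lborel. (?d (x + (real k * t) *\<^sub>R z))\<^sup>2)"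
      using ik by (simp add: Bochner_Integration.integral_sum)
    also have "(\<Sum>k<N. LINT x|lborel. (?d (x + (real k * t) *\<^sub>R z))\<^sup>2) = real N * (LINT x|lborel. (?d x)\<^sup>2)"
      by (subst lborel_integral_translate[where g = "\<lambda>x. (?d x)\<^sup>2"]) auto
    also have "real N * (real N * (LINT x|lborel. (?d x)\<^sup>2)) = (LINT x|lborel. (?G n x)\<^sup>2)"
      unfolding dG by (simp add: power_mult_distrib power2_eq_square[of "real N"])
    finally show ?thesis .
  qed
  have "(LINT x|lborel. (F (x + z) - F x)\<^sup>2) \<le> (LINT x|lborel. (\<Sum>j\<in>UNIV. z $ j * pderiv_at j F x)\<^sup>2)"
    by (rule LIMSEQ_le_const[OF lim]) (use step in blast)
  also have "\<dots> \<le> (LINT x|lborel. (norm z)\<^sup>2 * (\<Sum>i\<in>UNIV. (pderiv_at i F x)\<^sup>2))"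
  proof (rule integral_mono')
    have "(\<lambda>x. pderiv_at i F x * pderiv_at i F x) \<in> test_funs UNIV" for i
      by (intro test_funs_mult test_funs_pderiv smooth_fun_pderiv F test_funs_smooth[OF F])
    then show "integrable lborel (\<lambda>x. (norm z)\<^sup>2 * (\<Sum>i\<in>UNIV. (pderiv_at i F x)\<^sup>2))"
      unfolding power2_eq_square by (intro integrable_mult_right Bochner_Integration.integrable_sum test_funs_integrable)
    show "(\<Sum>j\<in>UNIV. z $ j * pderiv_at j F x)\<^sup>2 \<le> (norm z)\<^sup>2 * (\<Sum>i\<in>UNIV. (pderiv_at i F x)\<^sup>2)" for x
      using Cauchy_Schwarz_ineq_sum[of "\<lambda>j. z $ j" "\<lambda>j. pderiv_at j F x" UNIV]
      by (simp add: norm_vec_def L2_set_def sum_nonneg)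
  qed (auto intro!: mult_nonneg_nonneg sum_nonneg)
  finally show ?thesis by simp
qed

section \<open>The fundamental lemma of the calculus of variations\<close>

lemma lebesgue_on_integral:
  fixes g :: "real^'d::finite \<Rightarrow> real"
  assumes "\<Omega> \<in> sets lebesgue" "g \<in> borel_measurable borel" "\<And>x. x \<notin> \<Omega> \<Longrightarrow> g x = 0"
  shows "(LINT x|lebesgue_on \<Omega>. g x) = (LINT x|lborel. g x)"
proof -
  have "(\<lambda>x. indicat_real \<Omega> x *\<^sub>R g x) = g" using assms(3) by (auto simp: indicator_def fun_eq_iff)
  then show ?thesis using assms by (subst integral_restrict_space) (auto simp: integral_completion)
qed

text \<open>As \<open>exp (- 1 / (n t))\<close> tends to \<open>1\<close> for every \<open>t > 0\<close>, rescaling the flat functions at the faces of the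
  box gives the approximation.\<close>

lemma box_indicator_limit:
  fixes a b :: "real^'d::finite"
  assumes "cbox a b \<subseteq> \<Omega>"
  obtains \<xi> where "\<And>n::nat. \<xi> n \<in> test_funs \<Omega>" "\<And>n x. \<bar>\<xi> n x\<bar> \<le> 1" "\<And>x. (\<lambda>n. \<xi> n x) \<longlonglongrightarrow> indicator (box a b) x"
proof
  define \<beta> where "\<beta> n i t = flat_exp 0 (real (Suc n) * t + - (real (Suc n) * a $ i)) * flat_exp 0 (- real (Suc n) * t + real (Suc n) * b $ i)"
    for n :: nat and i :: 'd and t
  have \<beta>_eq: "\<beta> n i t = flat_exp 0 (real (Suc n) * (t - a $ i)) * flat_exp 0 (real (Suc n) * (b $ i - t))" for n i t
    unfolding \<beta>_def by (simp add: algebra_simps)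
  define \<xi> where "\<xi> n x = (\<Prod>i\<in>UNIV. \<beta> n i (x $ i))" for n and x :: "real^'d"
  have sm: "smooth_fun (\<xi> n)" for n
    unfolding \<xi>_def \<beta>_def
    by (intro smooth_fun_prod smooth_fun_component ntimes_diff_mult ntimes_diff_affine ntimes_diff_flat_exp) auto
  have b1: "0 \<le> \<beta> n i t" "\<beta> n i t \<le> 1" for n i t
    unfolding \<beta>_def by (auto intro!: mult_le_one mult_nonneg_nonneg flat_exp_0_nonneg flat_exp_0_le1)
  have out: "\<xi> n x = 0" if x: "x \<notin> box a b" for n x
  proof -
    obtain i where "\<not> (a $ i < x $ i \<and> x $ i < b $ i)" using x by (auto simp: mem_box_cart)
    then have "real (Suc n) * (x $ i - a $ i) \<le> 0 \<or> real (Suc n) * (b $ i - x $ i) \<le> 0"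
      using mult_nonneg_nonpos[of "real (Suc n)" "x $ i - a $ i"] mult_nonneg_nonpos[of "real (Suc n)" "b $ i - x $ i"]
      by linarith
    then have "\<beta> n i (x $ i) = 0" unfolding \<beta>_eq using flat_exp_0_zero by auto
    then show ?thesis unfolding \<xi>_def by (intro prod_zero) auto
  qed
  show "\<xi> n \<in> test_funs \<Omega>" for n
    by (rule test_funsI[OF sm compact_cbox assms]) (use out box_subset_cbox in blast)
  show "\<bar>\<xi> n x\<bar> \<le> 1" for n x
    unfolding \<xi>_def using b1 by (auto simp: abs_of_nonneg prod_nonneg intro!: prod_le_1)
  show "(\<lambda>n. \<xi> n x) \<longlonglongrightarrow> indicator (box a b) x" for x
  proof (cases "x \<in> box a b")
    case False
    then show ?thesis using out by simp
  next
    case True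
    have lim: "(\<lambda>n. flat_exp 0 (real (Suc n) * s)) \<longlonglongrightarrow> 1" if "s > 0" for s
    proof -
      have "(\<lambda>n. exp (- (1 / s) * inverse (real (Suc n)))) \<longlonglongrightarrow> exp (- (1 / s) * 0)"
        by (intro tendsto_intros LIMSEQ_inverse_real_of_nat)
      moreover have "flat_exp 0 (real (Suc n) * s) = exp (- (1 / s) * inverse (real (Suc n)))" for n
      proof -
        have "real (Suc n) * s > 0" using that by (intro mult_pos_pos) auto
        then show ?thesis unfolding flat_exp_def by (simp add: divide_simps)
      qed
      ultimately show ?thesis by simp
    qed
    have "(\<lambda>n. \<beta> n i (x $ i)) \<longlonglongrightarrow> 1 * 1" for i
    proof -
      have "x $ i - a $ i > 0" "b $ i - x $ i > 0" using True by (auto simp: mem_box_cart)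
      then show ?thesis unfolding \<beta>_eq by (intro tendsto_mult lim)
    qed
    then have "(\<lambda>n. \<xi> n x) \<longlonglongrightarrow> (\<Prod>i\<in>(UNIV::'d set). 1)"
      unfolding \<xi>_def by (intro tendsto_prod) simp
    then show ?thesis using True by simp
  qed
qed

text \<open>Boxes are stable under intersection and generate the Borel sets, so by Dynkin's theorem all
  integrals over Borel subsets of \<open>box a b\<close> vanish, in particular those over the sets where \<open>g\<close> is
  positive and where it is negative.\<close>

lemma AE_zero_if_box_integrals_zero:
  fixes g :: "real^'d::finite \<Rightarrow> real"
  assumes g: "integrable lborel g"
    and zero: "\<And>c d. box c d \<subseteq> box a b \<Longrightarrow> (LINT x:box c d|lborel. g x) = 0"
  shows "AE x in lborel. x \<in> box a b \<longrightarrow> g x = 0"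
proof -
  let ?Q = "box a b"
  let ?P = "\<lambda>A. (LINT x:A \<inter> ?Q|lborel. g x) = 0"
  have gm[measurable]: "g \<in> borel_measurable borel" using g by auto
  have si: "set_integrable lborel A g" if "A \<in> sets borel" for A
    using g that unfolding set_integrable_def by (intro integrable_mult_indicator) auto
  have all: "?P A" if A: "A \<in> sets borel" for A
  proof -
    let ?G = "range (\<lambda>(a, b). box a b :: (real^'d) set)"
    have sb: "sigma_sets UNIV ?G = sets borel"
      unfolding borel_eq_box by (rule sets_measure_of[symmetric]) auto
    have stab: "Int_stable ?G" unfolding Int_stable_def by (auto simp: box_Int_box)
    show ?thesis
    proof (rule sigma_sets_induct_disjoint[of ?G UNIV A ?P])
      show "A \<in> sigma_sets UNIV ?G" using A sb by simp
    next
      fix B assume "B \<in> ?G"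
      moreover have "?Q \<in> ?G" by auto
      ultimately have "B \<inter> ?Q \<in> ?G" by (rule Int_stableD[OF stab])
      then obtain e h where "B \<inter> ?Q = box e h" by auto
      moreover have "B \<inter> ?Q \<subseteq> ?Q" by blast
      ultimately show "?P B" using zero[of e h] by simp
    next
      show "?P {}" by (simp add: set_lebesgue_integral_def)
    next
      fix B assume B: "B \<in> sigma_sets UNIV ?G" "?P B"
      then have Bm: "B \<in> sets borel" using sb by simp
      have "(LINT x:?Q|lborel. g x) = (LINT x:((UNIV - B) \<inter> ?Q) \<union> (B \<inter> ?Q)|lborel. g x)"
        by (rule arg_cong[of _ _ "\<lambda>A. LINT x:A|lborel. g x"]) auto
      also have "\<dots> = (LINT x:(UNIV - B) \<inter> ?Q|lborel. g x) + (LINT x:B \<inter> ?Q|lborel. g x)"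
        by (rule set_integral_Un) (use Bm in \<open>auto intro!: si\<close>)
      finally show "?P (UNIV - B)" using zero[of a b] B(2) by simp
    next
      fix F :: "nat \<Rightarrow> _" assume F: "disjoint_family F" "range F \<subseteq> sigma_sets UNIV ?G" "\<And>i. ?P (F i)"
      then have Fm: "F i \<in> sets borel" for i using sb by auto
      have "(LINT x:(\<Union>i. F i \<inter> ?Q)|lborel. g x) = (\<Sum>i. LINT x:F i \<inter> ?Q|lborel. g x)"
        by (rule lebesgue_integral_countable_add) (use F(1) Fm in \<open>auto simp: disjoint_family_on_def intro!: si\<close>)
      moreover have "(\<Union>i. F i) \<inter> ?Q = (\<Union>i. F i \<inter> ?Q)" by blast
      ultimately show "?P (\<Union>i. F i)" by (simp only: F(3) suminf_zero)
    qed (use stab in auto)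
  qed
  have half: "AE x in lborel. x \<in> ?Q \<longrightarrow> s * g x \<le> 0" if s: "s = 1 \<or> s = -1" for s :: real
  proof -
    let ?A = "{x. s * g x > 0}"
    have Am: "?A \<in> sets borel" by measurable
    have "(LINT x|lborel. s * (indicator (?A \<inter> ?Q) x * g x)) = 0"
      using all[OF Am] by (simp add: set_lebesgue_integral_def)
    moreover have "integrable lborel (\<lambda>x. s * (indicator (?A \<inter> ?Q) x * g x))"
      using si[of "?A \<inter> ?Q"] Am unfolding set_integrable_def by (intro integrable_mult_right) simp
    moreover have "s * (indicator (?A \<inter> ?Q) x * g x) \<ge> 0" for x by (auto simp: indicator_def)
    ultimately have "AE x in lborel. s * (indicator (?A \<inter> ?Q) x * g x) = 0"
      by (subst (asm) integral_nonneg_eq_0_iff_AE) auto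
    then show ?thesis by (rule eventually_mono) (auto simp: indicator_def not_less split: if_splits)
  qed
  show ?thesis using half[of 1] half[of "-1"] by (auto elim: eventually_elim2)
qed

text \<open>Indicators of boxes are bounded limits of test functions, which reduces the claim to the vanishing
  of all integrals over boxes. The function \<open>g\<close> in the proof is a Borel representative of \<open>w\<close> extended
  by zero.\<close>

theorem fundamental_lemma:
  fixes w :: "real^'d::finite \<Rightarrow> real"
  assumes \<Omega>: "open \<Omega>" and w: "integrable (lebesgue_on \<Omega>) w"
    and zero: "\<And>\<phi>. \<phi> \<in> test_funs \<Omega> \<Longrightarrow> (LINT x|lebesgue_on \<Omega>. w x * \<phi> x) = 0"
  shows "AE x in lebesgue_on \<Omega>. w x = 0"
proof -
  have \<Omega>s: "\<Omega> \<in> sets lebesgue" using \<Omega> by auto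
  define W where "W x = (if x \<in> \<Omega> then w x else 0)" for x
  have W: "integrable lebesgue W"
    using w \<Omega>s unfolding W_def by (simp add: Lebesgue_Measure.integrable_restrict_UNIV)
  obtain g where g[measurable]: "g \<in> borel_measurable borel" and gW: "AE x in lborel. W x = g x"
    using completion_ex_borel_measurable_real[of W lborel] borel_measurable_integrable[OF W] by auto
  have gW': "AE x in lebesgue. W x = g x" using gW by (rule AE_completion)
  have gi: "integrable lborel g"
  proof -
    have "integrable lebesgue g"
      by (rule iffD1[OF integrable_cong_AE W]) (use gW' W g in \<open>auto intro: measurable_completion\<close>)
    then show ?thesis using g by (subst (asm) integrable_completion) auto
  qed
  have box: "(LINT x:box a b|lborel. g x) = 0" if ab: "cbox a b \<subseteq> \<Omega>" for a b
  proof -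
    obtain \<xi> where \<xi>: "\<And>n::nat. \<xi> n \<in> test_funs \<Omega>" "\<And>n x. \<bar>\<xi> n x\<bar> \<le> 1" "\<And>x. (\<lambda>n. \<xi> n x) \<longlonglongrightarrow> indicator (box a b) x"
      using box_indicator_limit[OF ab] by blast
    note [measurable] = test_funs_borel[OF \<xi>(1)]
    have "(\<lambda>n. LINT x|lborel. g x * \<xi> n x) \<longlonglongrightarrow> (LINT x|lborel. g x * indicator (box a b) x)"
    proof (rule integral_dominated_convergence[where w = "\<lambda>x. \<bar>g x\<bar>"])
      show "AE x in lborel. (\<lambda>n. g x * \<xi> n x) \<longlonglongrightarrow> g x * indicator (box a b) x"
        by (intro AE_I2 tendsto_mult \<xi> tendsto_const)
      show "AE x in lborel. norm (g x * \<xi> n x) \<le> \<bar>g x\<bar>" for n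
        using \<xi>(2) by (intro AE_I2) (simp add: abs_mult mult_left_le)
    qed (use gi in auto)
    moreover have "(LINT x|lborel. g x * \<xi> n x) = 0" for n
    proof -
      have "(LINT x|lborel. g x * \<xi> n x) = (LINT x|lebesgue. g x * \<xi> n x)"
        by (subst integral_completion) auto
      also have "\<dots> = (LINT x|lebesgue. indicator \<Omega> x *\<^sub>R (w x * \<xi> n x))"
      proof (rule integral_cong_AE)
        show "(\<lambda>x. indicat_real \<Omega> x *\<^sub>R (w x * \<xi> n x)) \<in> borel_measurable lebesgue"
        proof -
          have "(\<lambda>x. W x * \<xi> n x) \<in> borel_measurable lebesgue"
            using borel_measurable_integrable[OF W] test_funs_borel[OF \<xi>(1)]
            by (intro borel_measurable_times) (auto intro: measurable_completion)
          then show ?thesis by (rule measurable_cong[THEN iffD1, rotated]) (auto simp: W_def)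
        qed
        show "AE x in lebesgue. g x * \<xi> n x = indicat_real \<Omega> x *\<^sub>R (w x * \<xi> n x)"
        proof (rule eventually_mono[OF gW'])
          fix x assume "W x = g x"
          then show "g x * \<xi> n x = indicat_real \<Omega> x *\<^sub>R (w x * \<xi> n x)"
            using test_funs_outside[OF \<xi>(1), of x] by (cases "x \<in> \<Omega>") (auto simp: W_def)
        qed
      qed (auto intro: measurable_completion)
      also have "\<dots> = 0"
        using zero[OF \<xi>(1)] \<Omega>s by (subst (asm) integral_restrict_space) auto
      finally show ?thesis .
    qed
    ultimately show ?thesis by (simp add: LIMSEQ_const_iff set_lebesgue_integral_def mult.commute)
  qed
  have "AE x in lborel. x \<in> box a b \<longrightarrow> g x = 0" if "box a b \<subseteq> \<Omega>" "cbox a b \<subseteq> \<Omega>" for a b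
  proof (rule AE_zero_if_box_integrals_zero[OF gi])
    fix c d :: "real^'d" assume cd: "box c d \<subseteq> box a b"
    show "(LINT x:box c d|lborel. g x) = 0"
    proof (cases "box c d = {}")
      case True then show ?thesis by (simp add: set_lebesgue_integral_def)
    next
      case False
      then have "cbox c d \<subseteq> cbox a b" using closure_mono[OF cd] closure_box[OF False] 
        by (metis cd closure_box subset_empty)
      then show ?thesis using box that by blast
    qed
  qed
  have "AE x in lborel. x \<in> \<Omega> \<longrightarrow> g x = 0"
  proof -
    have "\<exists>\<D>. countable \<D> \<and> \<D> \<subseteq> Pow \<Omega> \<and> (\<forall>X\<in>\<D>. \<exists>a b. X = cbox a b) \<and> \<Union>\<D> = \<Omega>"
      using open_countable_Union_open_cbox[OF \<Omega>] by metis
    then obtain \<D> where \<D>: "countable \<D>" "\<D> \<subseteq> Pow \<Omega>" "\<And>X. X \<in> \<D> \<Longrightarrow> \<exists>a b. X = cbox a b" "\<Union>\<D> = \<Omega>" by blast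
    have "AE x in lborel. \<forall>X\<in>\<D>. x \<in> X \<longrightarrow> g x = 0"
      unfolding AE_ball_countable[OF \<D>(1)]
    proof
      fix X assume X: "X \<in> \<D>"
      then obtain a b where ab: "X = cbox a b" using \<D> by blast
      have "X \<subseteq> \<Omega>" using X \<D> by blast
      then have "AE x in lborel. x \<in> box a b \<longrightarrow> g x = 0"
        using \<open>\<And>b a. \<lbrakk>box a b \<subseteq> \<Omega>; cbox a b \<subseteq> \<Omega>\<rbrakk> \<Longrightarrow> AE x in lborel. x \<in> box a b \<longrightarrow> g x = 0\<close> ab box_subset_cbox by blast
      moreover have "AE x in lborel. x \<notin> cbox a b - box a b"
        using negligible_frontier_interval[of a b]
        by (intro AE_not_in) (auto simp: negligible_iff_null_sets null_sets_completion_iff)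
      ultimately show "AE x in lborel. x \<in> X \<longrightarrow> g x = 0"
        by (rule eventually_elim2) (auto simp: ab)
    qed
    then show ?thesis by (rule eventually_mono) (use \<D>(4) in blast)
  qed
  then have "AE x in lebesgue. x \<in> \<Omega> \<longrightarrow> g x = 0" by (rule AE_completion)
  with gW' have "AE x in lebesgue. x \<in> \<Omega> \<longrightarrow> w x = 0"
    by (rule eventually_elim2) (auto simp: W_def)
  then show ?thesis using \<Omega>s by (simp add: AE_restrict_space_iff)
qed

section \<open>Square integrable functions and weak derivatives\<close>

subsection \<open>Representatives\<close>

abbreviation (input) "rep \<equiv> rep_ae_fun"

lemma rep_ae_fun_measurable: "rep u \<in> borel_measurable lebesgue"
  using Quotient_rep_reflp[OF Quotient_ae_fun, of u] by (simp add: ae_rel_def)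

lemma rep_abs_ae_fun: "f \<in> borel_measurable lebesgue \<Longrightarrow> AE x in lebesgue. rep (abs_ae_fun f) x = f x"
  using Quotient_rep_abs[OF Quotient_ae_fun, of f] by (simp add: ae_rel_def)

lemma abs_rep_ae_fun: "abs_ae_fun (rep u) = u"
  by (rule Quotient_abs_rep[OF Quotient_ae_fun])

lemma ae_fun_eqI: "(AE x in lebesgue. rep u x = rep v x) \<Longrightarrow> u = v"
  using Quotient_rel_rep[OF Quotient_ae_fun, of u v] rep_ae_fun_measurable by (auto simp: ae_rel_def)

lemma ae_rel_rep: "ae_rel (rep u) (rep u)"
  by (simp add: ae_rel_def rep_ae_fun_measurable)

lemma rep_ae_fun_add: "AE x in lebesgue. rep (u + v) x = rep u x + rep v x"
proof -
  have "u + v = abs_ae_fun (\<lambda>x. rep u x + rep v x)"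
    using plus_ae_fun.abs_eq[OF ae_rel_rep ae_rel_rep, of u v] by (simp add: abs_rep_ae_fun)
  then show ?thesis by (metis rep_abs_ae_fun borel_measurable_add rep_ae_fun_measurable)
qed

lemma rep_ae_fun_scale: "AE x in lebesgue. rep (a *\<^sub>R u) x = a * rep u x"
proof -
  have "a *\<^sub>R u = abs_ae_fun (\<lambda>x. a * rep u x)"
    using scaleR_ae_fun.abs_eq[OF ae_rel_rep, of a u] by (simp add: abs_rep_ae_fun)
  moreover have "(\<lambda>x. a * rep u x) \<in> borel_measurable lebesgue"
    by (intro borel_measurable_times borel_measurable_const rep_ae_fun_measurable)
  ultimately show ?thesis by (simp add: rep_abs_ae_fun)
qed

subsection \<open>Square integrability\<close>

definition sqint :: "'x measure \<Rightarrow> ('x \<Rightarrow> real) \<Rightarrow> bool" where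
  "sqint M g \<longleftrightarrow> g \<in> borel_measurable M \<and> integrable M (\<lambda>x. (g x)\<^sup>2)"

lemma sqint_integrable_square: "sqint M g \<Longrightarrow> integrable M (\<lambda>x. (g x)\<^sup>2)"
  by (simp add: sqint_def)

lemma sqint_mult_integrable:
  assumes "sqint M f" "sqint M g" shows "integrable M (\<lambda>x. f x * g x)"
proof (rule Bochner_Integration.integrable_bound[of _ "\<lambda>x. (f x)\<^sup>2 + (g x)\<^sup>2"])
  show "integrable M (\<lambda>x. (f x)\<^sup>2 + (g x)\<^sup>2)" using assms by (auto simp: sqint_def)
  show "AE x in M. norm (f x * g x) \<le> norm ((f x)\<^sup>2 + (g x)\<^sup>2)"
  proof (rule AE_I2)
    fix x
    have "2 * \<bar>f x\<bar> * \<bar>g x\<bar> \<le> (f x)\<^sup>2 + (g x)\<^sup>2" using sum_squares_bound[of "\<bar>f x\<bar>" "\<bar>g x\<bar>"] by simp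
    moreover have "0 \<le> \<bar>f x\<bar> * \<bar>g x\<bar>" by simp
    ultimately have "\<bar>f x\<bar> * \<bar>g x\<bar> \<le> (f x)\<^sup>2 + (g x)\<^sup>2" by linarith
    then show "norm (f x * g x) \<le> norm ((f x)\<^sup>2 + (g x)\<^sup>2)" by (simp add: abs_mult)
  qed
qed (use assms in \<open>auto simp: sqint_def\<close>)

lemma sqint_add: "sqint M f \<Longrightarrow> sqint M g \<Longrightarrow> sqint M (\<lambda>x. f x + g x)"
  using sqint_mult_integrable[of M f g] by (auto simp: sqint_def power2_sum mult.assoc)

lemma sqint_scale: "sqint M f \<Longrightarrow> sqint M (\<lambda>x. a * f x)"
  by (auto simp: sqint_def power_mult_distrib)

lemma sqint_bound:
  assumes "sqint M g" "f \<in> borel_measurable M" "AE x in M. \<bar>f x\<bar> \<le> \<bar>g x\<bar>"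
  shows "sqint M f"
  unfolding sqint_def
proof
  show "integrable M (\<lambda>x. (f x)\<^sup>2)"
    by (rule Bochner_Integration.integrable_bound[OF sqint_integrable_square[OF assms(1)]])
       (use assms in \<open>auto elim!: eventually_mono intro: power2_mono simp: abs_le_square_iff\<close>)
qed (rule assms)

lemma sqint_cong_AE:
  assumes "sqint M g" "f \<in> borel_measurable M" "AE x in M. f x = g x"
  shows "sqint M f"
  by (rule sqint_bound[OF assms(1,2)]) (use assms(3) in \<open>auto elim!: eventually_mono\<close>)

lemma (in finite_measure) sqint_const: "sqint M (\<lambda>x. c)"
  by (simp add: sqint_def)

text \<open>The quadratic form \<open>\<integral> (s f + t g)\<^sup>2\<close> in \<open>(s, t)\<close> is nonnegative; the inequality says that its discriminant has
  the right sign.\<close>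

lemma Cauchy_Schwarz_integral:
  assumes "sqint M f" "sqint M g"
  shows "\<bar>LINT x|M. f x * g x\<bar> \<le> sqrt (LINT x|M. (f x)\<^sup>2) * sqrt (LINT x|M. (g x)\<^sup>2)"
proof -
  let ?a = "LINT x|M. (f x)\<^sup>2" and ?b = "LINT x|M. (g x)\<^sup>2" and ?c = "LINT x|M. f x * g x"
  note i = sqint_mult_integrable[OF assms] assms[THEN sqint_integrable_square]
  have q: "0 \<le> ?a * s\<^sup>2 + 2 * ?c * s * t + ?b * t\<^sup>2" for s t
  proof -
    have "0 \<le> (LINT x|M. (s * f x + t * g x)\<^sup>2)" by simp
    also have "(\<lambda>x. (s * f x + t * g x)\<^sup>2) = (\<lambda>x. s\<^sup>2 * (f x)\<^sup>2 + (2 * s * t) * (f x * g x) + t\<^sup>2 * (g x)\<^sup>2)"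
      by (auto simp: power2_eq_square algebra_simps)
    also have "(LINT x|M. s\<^sup>2 * (f x)\<^sup>2 + (2 * s * t) * (f x * g x) + t\<^sup>2 * (g x)\<^sup>2) = s\<^sup>2 * ?a + (2 * s * t) * ?c + t\<^sup>2 * ?b"
      using i by simp
    finally show ?thesis by (simp add: algebra_simps)
  qed
  have "?c\<^sup>2 \<le> ?a * ?b"
  proof (cases "?b = 0")
    case True
    have "?c = 0"
    proof (rule ccontr)
      assume "?c \<noteq> 0"
      have "0 \<le> ?a + 2 * ?c * (- (?a + 1) / (2 * ?c))" using q[of 1 "- (?a + 1) / (2 * ?c)"] True by simp
      then show False using \<open>?c \<noteq> 0\<close> by simp
    qed
    then show ?thesis using True by simp
  next
    case False
    have "?b \<ge> 0" by simp
    with False have b: "?b > 0" by linarith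
    have "0 \<le> ?a * ?b\<^sup>2 + 2 * ?c * ?b * (- ?c) + ?b * (- ?c)\<^sup>2" by (rule q)
    also have "\<dots> = ?b * (?a * ?b - ?c\<^sup>2)" by (simp add: power2_eq_square algebra_simps)
    finally show ?thesis using b by (simp add: zero_le_mult_iff)
  qed
  then have "sqrt (?c\<^sup>2) \<le> sqrt (?a * ?b)" by (rule real_sqrt_le_mono)
  then show ?thesis by (simp add: real_sqrt_mult)
qed

text \<open>The abbreviations in this locale stand for the class of a function on \<open>\<Omega>\<close>, weak partial derivatives,
  gradient and Hessian, and the norms of \<open>L\<^sub>2\<close>, \<open>H\<^sup>1\<close> and \<open>H\<^sup>2\<close>.\<close>

locale bounded_domain =
  fixes \<Omega> :: "(real^'d::finite) set"
  assumes open_domain: "open \<Omega>" and bounded_domain: "bounded \<Omega>"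
begin

abbreviation "M \<equiv> lebesgue_on \<Omega>"
abbreviation "cls \<equiv> class_on \<Omega>"
abbreviation "wpd \<equiv> weak_pderiv \<Omega>"
abbreviation "grad \<equiv> weak_grad \<Omega>"
abbreviation "hess \<equiv> weak_hessian \<Omega>"
abbreviation "nL2 \<equiv> L2_norm \<Omega>"
abbreviation "nH1 \<equiv> H1_norm \<Omega>"
abbreviation "nH2 \<equiv> H2_norm \<Omega>"

lemma domain_sets: "\<Omega> \<in> sets lebesgue" using open_domain by auto

lemma finite_measure_domain: "finite_measure M"
  using open_domain bounded_domain by (intro finite_measure_lebesgue_on) (auto intro: bounded_set_imp_lmeasurable)

sublocale finite_measure M by (rule finite_measure_domain)

lemma AE_domain: "(AE x in M. P x) \<longleftrightarrow> (AE x in lebesgue. x \<in> \<Omega> \<longrightarrow> P x)"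
  using domain_sets by (simp add: AE_restrict_space_iff)

lemma AE_domainI: "(AE x in lebesgue. P x) \<Longrightarrow> (AE x in M. P x)"
  unfolding AE_domain by (auto elim: eventually_mono)

lemma rep_measurable[measurable]: "rep u \<in> borel_measurable M"
  using rep_ae_fun_measurable by (rule measurable_restrict_space1)

lemma rep_add: "AE x in M. rep (u + v) x = rep u x + rep v x"
  and rep_scale: "AE x in M. rep (a *\<^sub>R u) x = a * rep u x"
  by (rule AE_domainI rep_ae_fun_add rep_ae_fun_scale)+

lemma rep_diff: "AE x in M. rep (u - v) x = rep u x - rep v x"
proof -
  from rep_add[of u "(-1) *\<^sub>R v"] rep_scale[of "-1" v] show ?thesis
    by eventually_elim simp
qed

lemma L2_sqint: "u \<in> L2 \<Omega> \<Longrightarrow> sqint M (rep u)"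
  by (simp add: L2_def sqint_def)

lemma L2I: "(AE x in lebesgue. x \<notin> \<Omega> \<longrightarrow> rep u x = 0) \<Longrightarrow> sqint M (rep u) \<Longrightarrow> u \<in> L2 \<Omega>"
  by (simp add: L2_def sqint_def)

lemma L2_eqI:
  assumes "u \<in> L2 \<Omega>" "v \<in> L2 \<Omega>" "AE x in M. rep u x = rep v x"
  shows "u = v"
proof (rule ae_fun_eqI)
  have "AE x in lebesgue. x \<notin> \<Omega> \<longrightarrow> rep u x = 0" "AE x in lebesgue. x \<notin> \<Omega> \<longrightarrow> rep v x = 0"
    using assms by (auto simp: L2_def)
  with assms(3)[unfolded AE_domain] show "AE x in lebesgue. rep u x = rep v x"
    by eventually_elim auto
qed

lemma L2_add: assumes "u \<in> L2 \<Omega>" "v \<in> L2 \<Omega>" shows "u + v \<in> L2 \<Omega>"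
proof (rule L2I)
  have "AE x in lebesgue. x \<notin> \<Omega> \<longrightarrow> rep u x = 0" "AE x in lebesgue. x \<notin> \<Omega> \<longrightarrow> rep v x = 0"
    using assms by (auto simp: L2_def)
  with rep_ae_fun_add[of u v] show "AE x in lebesgue. x \<notin> \<Omega> \<longrightarrow> rep (u + v) x = 0"
    by eventually_elim auto
  show "sqint M (rep (u + v))"
    by (rule sqint_cong_AE[OF sqint_add[OF L2_sqint[OF assms(1)] L2_sqint[OF assms(2)]] rep_measurable rep_add])
qed

lemma L2_scale: assumes "u \<in> L2 \<Omega>" shows "a *\<^sub>R u \<in> L2 \<Omega>"
proof (rule L2I)
  have "AE x in lebesgue. x \<notin> \<Omega> \<longrightarrow> rep u x = 0"
    using assms by (auto simp: L2_def)
  with rep_ae_fun_scale[of a u] show "AE x in lebesgue. x \<notin> \<Omega> \<longrightarrow> rep (a *\<^sub>R u) x = 0"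
    by eventually_elim auto
  show "sqint M (rep (a *\<^sub>R u))"
    by (rule sqint_cong_AE[OF sqint_scale[OF L2_sqint[OF assms(1)]] rep_measurable rep_scale])
qed

lemma L2_diff: "u \<in> L2 \<Omega> \<Longrightarrow> v \<in> L2 \<Omega> \<Longrightarrow> u - v \<in> L2 \<Omega>"
  using L2_add[OF _ L2_scale[of v "-1"], of u] by simp

lemma class_on_rep:
  assumes "g \<in> borel_measurable M"
  shows "AE x in M. rep (cls g) x = g x"
    "AE x in lebesgue. x \<notin> \<Omega> \<longrightarrow> rep (cls g) x = 0"
proof -
  have "(\<lambda>x. if x \<in> \<Omega> then g x else 0) \<in> borel_measurable lebesgue"
    using assms domain_sets by (simp add: borel_measurable_if)
  from rep_abs_ae_fun[OF this] have *: "AE x in lebesgue. rep (cls g) x = (if x \<in> \<Omega> then g x else 0)"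
    by (simp add: class_on_def)
  then show "AE x in M. rep (cls g) x = g x"
    unfolding AE_domain by (auto elim: eventually_mono)
  show "AE x in lebesgue. x \<notin> \<Omega> \<longrightarrow> rep (cls g) x = 0"
    using * by (auto elim: eventually_mono)
qed

lemma class_on_L2: "sqint M g \<Longrightarrow> cls g \<in> L2 \<Omega>"
  by (rule L2I[OF class_on_rep(2) sqint_cong_AE[OF _ rep_measurable class_on_rep(1)]]) (auto simp: sqint_def)

lemma L2_norm_sq: "(nL2 u)\<^sup>2 = (LINT x|M. (rep u x)\<^sup>2)"
  by (simp add: L2_norm_def)

lemma L2_norm_nonneg: "nL2 u \<ge> 0" by (simp add: L2_norm_def)

lemma L2_norm_cong:
  assumes "f \<in> borel_measurable M" "AE x in M. rep u x = f x"
  shows "nL2 u = sqrt (LINT x|M. (f x)\<^sup>2)"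
  unfolding L2_norm_def
  by (rule arg_cong[of _ _ sqrt], rule integral_cong_AE) (use assms in \<open>auto elim!: eventually_mono\<close>)

lemma L2_norm_scale: "nL2 (a *\<^sub>R u) = \<bar>a\<bar> * nL2 u"
  by (subst L2_norm_cong[OF _ rep_scale]) (auto simp: power_mult_distrib L2_norm_def real_sqrt_mult)

text \<open>For the norms of \<open>L\<^sub>2\<close>, \<open>H\<^sup>1\<close> and \<open>H\<^sup>2\<close> the triangle inequality enters only up to a constant factor; this
  squared form passes to sums over derivatives termwise.\<close>

lemma L2_norm_add_sq:
  assumes "u \<in> L2 \<Omega>" "v \<in> L2 \<Omega>"
  shows "(nL2 (u + v))\<^sup>2 \<le> 2 * (nL2 u)\<^sup>2 + 2 * (nL2 v)\<^sup>2"
proof -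
  note s = assms[THEN L2_sqint]
  have "(nL2 (u + v))\<^sup>2 = (LINT x|M. (rep u x + rep v x)\<^sup>2)"
    by (subst L2_norm_cong[OF _ rep_add]) (auto simp: )
  also have "\<dots> \<le> (LINT x|M. 2 * (rep u x)\<^sup>2 + 2 * (rep v x)\<^sup>2)"
  proof (rule integral_mono)
    show "(rep u x + rep v x)\<^sup>2 \<le> 2 * (rep u x)\<^sup>2 + 2 * (rep v x)\<^sup>2" for x
      using sum_squares_bound[of "rep u x" "rep v x"] by (simp add: power2_sum)
  qed (use s sqint_add[OF s] in \<open>auto simp: sqint_def\<close>)
  also have "\<dots> = 2 * (nL2 u)\<^sup>2 + 2 * (nL2 v)\<^sup>2"
    using s by (simp add: L2_norm_sq sqint_def)
  finally show ?thesis .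
qed

subsection \<open>Weak derivatives\<close>

lemma test_measurable: "\<phi> \<in> test_funs \<Omega> \<Longrightarrow> \<phi> \<in> borel_measurable M"
  by (rule measurable_restrict_space1, rule measurable_completion) (simp add: test_funs_borel)

lemma test_sqint: "\<phi> \<in> test_funs \<Omega> \<Longrightarrow> sqint M \<phi>"
proof -
  assume a: "\<phi> \<in> test_funs \<Omega>"
  then obtain C where "\<And>x. \<bar>\<phi> x\<bar> \<le> C" using test_funs_bounded by metis
  then have "AE x in M. \<bar>\<phi> x\<bar> \<le> \<bar>C\<bar>" by (meson AE_I2 abs_ge_self order_trans)
  then show ?thesis by (rule sqint_bound[OF sqint_const test_measurable[OF a]])
qed

lemma integrable_test_mult: "u \<in> L2 \<Omega> \<Longrightarrow> \<phi> \<in> test_funs \<Omega> \<Longrightarrow> integrable M (\<lambda>x. rep u x * \<phi> x)"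
  by (intro sqint_mult_integrable L2_sqint test_sqint)

text \<open>The difference of two weak derivatives is orthogonal to all test functions. Uniqueness turns
  linearity of the defining relation into linearity of \<open>weak_pderiv\<close>.\<close>

lemma weak_pderiv_unique:
  assumes "g \<in> L2 \<Omega>" "h \<in> L2 \<Omega>" "is_weak_pderiv \<Omega> i u g" "is_weak_pderiv \<Omega> i u h"
  shows "g = h"
proof (rule L2_eqI[OF assms(1,2)])
  have "AE x in M. rep g x - rep h x = 0"
  proof (rule fundamental_lemma[OF open_domain])
    have "integrable M (rep g)" "integrable M (rep h)"
      using sqint_mult_integrable[OF L2_sqint[OF assms(1)] sqint_const[of 1]]
        sqint_mult_integrable[OF L2_sqint[OF assms(2)] sqint_const[of 1]] by auto
    then show "integrable M (\<lambda>x. rep g x - rep h x)" by simp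
    fix \<phi> assume \<phi>: "\<phi> \<in> test_funs \<Omega>"
    have "(LINT x|M. rep g x * \<phi> x) = (LINT x|M. rep h x * \<phi> x)"
      using assms(3,4) \<phi> unfolding is_weak_pderiv_def by fastforce
    then show "(LINT x|M. (rep g x - rep h x) * \<phi> x) = 0"
      using integrable_test_mult[OF assms(1) \<phi>] integrable_test_mult[OF assms(2) \<phi>]
      by (simp add: left_diff_distrib)
  qed
  then show "AE x in M. rep g x = rep h x" by simp
qed

lemma weak_pderivI: "g \<in> L2 \<Omega> \<Longrightarrow> is_weak_pderiv \<Omega> i u g \<Longrightarrow> wpd i u = g"
  unfolding weak_pderiv_def using weak_pderiv_unique by (intro the_equality) auto

lemma H1_L2: "u \<in> H1 \<Omega> \<Longrightarrow> u \<in> L2 \<Omega>" by (simp add: H1_def)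

lemma H1_weak_pderiv:
  assumes "u \<in> H1 \<Omega>"
  shows "wpd i u \<in> L2 \<Omega>" "is_weak_pderiv \<Omega> i u (wpd i u)"
proof -
  obtain g where "g \<in> L2 \<Omega>" "is_weak_pderiv \<Omega> i u g" using assms unfolding H1_def by blast
  then show "wpd i u \<in> L2 \<Omega>" "is_weak_pderiv \<Omega> i u (wpd i u)"
    using weak_pderivI by simp_all
qed

lemma is_weak_pderiv_add:
  assumes "u \<in> L2 \<Omega>" "v \<in> L2 \<Omega>" "g \<in> L2 \<Omega>" "h \<in> L2 \<Omega>" "is_weak_pderiv \<Omega> i u g" "is_weak_pderiv \<Omega> i v h"
  shows "is_weak_pderiv \<Omega> i (u + v) (g + h)"
  unfolding is_weak_pderiv_def
proof
  fix \<phi> assume \<phi>: "\<phi> \<in> test_funs \<Omega>"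
  note d\<phi> = test_funs_pderiv[OF \<phi>, of i]
  have *: "(LINT x|M. rep (w + w') x * \<psi> x) = (LINT x|M. rep w x * \<psi> x) + (LINT x|M. rep w' x * \<psi> x)"
    if "w \<in> L2 \<Omega>" "w' \<in> L2 \<Omega>" "\<psi> \<in> test_funs \<Omega>" for w w' \<psi>
  proof -
    note [measurable] = test_measurable[OF that(3)]
    have "(LINT x|M. rep (w + w') x * \<psi> x) = (LINT x|M. rep w x * \<psi> x + rep w' x * \<psi> x)"
      by (rule integral_cong_AE) (use rep_add[of w w'] in \<open>auto elim!: eventually_mono simp: distrib_right\<close>)
    then show ?thesis using that by (simp add: integrable_test_mult)
  qed
  show "(LINT x|M. rep (u + v) x * pderiv_at i \<phi> x) = - (LINT x|M. rep (g + h) x * \<phi> x)"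
    using assms(5,6) \<phi> by (simp add: *[OF assms(1,2) d\<phi>] *[OF assms(3,4) \<phi>] is_weak_pderiv_def)
qed

lemma is_weak_pderiv_scale:
  assumes "is_weak_pderiv \<Omega> i u g"
  shows "is_weak_pderiv \<Omega> i (a *\<^sub>R u) (a *\<^sub>R g)"
  unfolding is_weak_pderiv_def
proof
  fix \<phi> assume \<phi>: "\<phi> \<in> test_funs \<Omega>"
  note d\<phi> = test_funs_pderiv[OF \<phi>, of i]
  have *: "(LINT x|M. rep (a *\<^sub>R w) x * \<psi> x) = a * (LINT x|M. rep w x * \<psi> x)"
    if "\<psi> \<in> test_funs \<Omega>" for w \<psi>
  proof -
    note [measurable] = test_measurable[OF that(1)]
    have "(LINT x|M. rep (a *\<^sub>R w) x * \<psi> x) = (LINT x|M. a * (rep w x * \<psi> x))"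
      by (rule integral_cong_AE) (use rep_scale[of a w] in \<open>auto elim!: eventually_mono\<close>)
    then show ?thesis by simp
  qed
  show "(LINT x|M. rep (a *\<^sub>R u) x * pderiv_at i \<phi> x) = - (LINT x|M. rep (a *\<^sub>R g) x * \<phi> x)"
    using assms \<phi> by (simp add: *[OF d\<phi>] *[OF \<phi>] is_weak_pderiv_def)
qed

lemma H1_add:
  assumes "u \<in> H1 \<Omega>" "v \<in> H1 \<Omega>"
  shows "u + v \<in> H1 \<Omega>" "wpd i (u + v) = wpd i u + wpd i v"
proof -
  note w = H1_weak_pderiv[OF assms(1)] H1_weak_pderiv[OF assms(2)]
  have g: "wpd i u + wpd i v \<in> L2 \<Omega>"
      "is_weak_pderiv \<Omega> i (u + v) (wpd i u + wpd i v)" for i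
    by (intro L2_add w is_weak_pderiv_add H1_L2 assms)+
  show "u + v \<in> H1 \<Omega>" unfolding H1_def using g assms by (auto intro: L2_add H1_L2)
  show "wpd i (u + v) = wpd i u + wpd i v"
    by (rule weak_pderivI) (rule g)+
qed

lemma H1_scale:
  assumes "u \<in> H1 \<Omega>"
  shows "a *\<^sub>R u \<in> H1 \<Omega>" "wpd i (a *\<^sub>R u) = a *\<^sub>R wpd i u"
proof -
  note w = H1_weak_pderiv[OF assms]
  have g: "a *\<^sub>R wpd i u \<in> L2 \<Omega>"
      "is_weak_pderiv \<Omega> i (a *\<^sub>R u) (a *\<^sub>R wpd i u)" for i
    using w by (auto intro!: L2_scale is_weak_pderiv_scale)
  show "a *\<^sub>R u \<in> H1 \<Omega>" unfolding H1_def using g assms by (auto intro: L2_scale H1_L2)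
  show "wpd i (a *\<^sub>R u) = a *\<^sub>R wpd i u"
    by (rule weak_pderivI) (rule g)+
qed

lemma H1_diff:
  assumes "u \<in> H1 \<Omega>" "v \<in> H1 \<Omega>"
  shows "u - v \<in> H1 \<Omega>" "wpd i (u - v) = wpd i u - wpd i v"
  using H1_add[OF assms(1) H1_scale(1)[OF assms(2), of "-1"]] H1_scale(2)[OF assms(2), of _ "-1"] by simp_all

lemma H2_H1: "u \<in> H2 \<Omega> \<Longrightarrow> u \<in> H1 \<Omega>" "u \<in> H2 \<Omega> \<Longrightarrow> wpd i u \<in> H1 \<Omega>"
  by (auto simp: H2_def)

lemma H2_add: "u \<in> H2 \<Omega> \<Longrightarrow> v \<in> H2 \<Omega> \<Longrightarrow> u + v \<in> H2 \<Omega>"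
  by (auto simp: H2_def H1_add)

lemma H2_scale: "u \<in> H2 \<Omega> \<Longrightarrow> a *\<^sub>R u \<in> H2 \<Omega>"
  by (auto simp: H2_def H1_scale)

lemma class_on_add:
  assumes "f \<in> borel_measurable M" "g \<in> borel_measurable M"
  shows "cls (\<lambda>x. f x + g x) = cls f + cls g"
proof (rule ae_fun_eqI)
  have m: "(\<lambda>x. f x + g x) \<in> borel_measurable M" using assms by auto
  from rep_ae_fun_add[of "cls f" "cls g"] class_on_rep[OF m, unfolded AE_domain]
    class_on_rep[OF assms(1), unfolded AE_domain] class_on_rep[OF assms(2), unfolded AE_domain]
  show "AE x in lebesgue. rep (cls (\<lambda>x. f x + g x)) x = rep (cls f + cls g) x"
    by eventually_elim auto
qed

lemma class_on_scale:
  assumes "f \<in> borel_measurable M"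
  shows "cls (\<lambda>x. a * f x) = a *\<^sub>R cls f"
proof (rule ae_fun_eqI)
  have m: "(\<lambda>x. a * f x) \<in> borel_measurable M" using assms by auto
  from rep_ae_fun_scale[of a "cls f"] class_on_rep[OF m, unfolded AE_domain]
    class_on_rep[OF assms(1), unfolded AE_domain]
  show "AE x in lebesgue. rep (cls (\<lambda>x. a * f x)) x = rep (a *\<^sub>R cls f) x"
    by eventually_elim auto
qed

lemma class_on_cong_AE:
  assumes "f \<in> borel_measurable M" "g \<in> borel_measurable M" "AE x in M. f x = g x"
  shows "cls f = cls g"
proof (rule ae_fun_eqI)
  from class_on_rep[OF assms(1), unfolded AE_domain] class_on_rep[OF assms(2), unfolded AE_domain] assms(3)[unfolded AE_domain]
  show "AE x in lebesgue. rep (cls f) x = rep (cls g) x"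
    by eventually_elim auto
qed

text \<open>Classical derivatives of test functions are weak derivatives, by integration by parts.\<close>

lemma test_weak_pderiv:
  assumes \<phi>: "\<phi> \<in> test_funs \<Omega>"
  shows "cls \<phi> \<in> H1 \<Omega>" "wpd i (cls \<phi>) = cls (pderiv_at i \<phi>)"
proof -
  have L: "cls \<psi> \<in> L2 \<Omega>" if "\<psi> \<in> test_funs \<Omega>" for \<psi> using that by (intro class_on_L2 test_sqint)
  have w: "is_weak_pderiv \<Omega> i (cls \<phi>) (cls (pderiv_at i \<phi>))" for i
    unfolding is_weak_pderiv_def
  proof
    fix \<psi> assume \<psi>: "\<psi> \<in> test_funs \<Omega>"
    have *: "(LINT x|M. rep (cls f) x * g x) = (LINT x|lborel. f x * g x)"
      if f: "f \<in> test_funs \<Omega>" and g: "g \<in> test_funs \<Omega>" for f g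
    proof -
      note [measurable] = test_measurable[OF f] test_measurable[OF g]
      have "(LINT x|M. rep (cls f) x * g x) = (LINT x|M. f x * g x)"
        by (rule integral_cong_AE) (use class_on_rep(1)[OF test_measurable[OF f]] in \<open>auto elim!: eventually_mono\<close>)
      also have "\<dots> = (LINT x|lborel. f x * g x)"
        by (rule lebesgue_on_integral) (use domain_sets test_funs_borel[OF f] test_funs_borel[OF g] test_funs_outside[OF f] in auto)
      finally show ?thesis .
    qed
    show "(LINT x|M. rep (cls \<phi>) x * pderiv_at i \<psi> x) = - (LINT x|M. rep (cls (pderiv_at i \<phi>)) x * \<psi> x)"
      by (simp add: * \<phi> \<psi> test_funs_pderiv integration_by_parts_test_funs[OF \<phi> \<psi>])
  qed
  show "cls \<phi> \<in> H1 \<Omega>" unfolding H1_def using w L \<phi> test_funs_pderiv by blast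
  show "wpd i (cls \<phi>) = cls (pderiv_at i \<phi>)"
    by (rule weak_pderivI[OF L[OF test_funs_pderiv[OF \<phi>]] w])
qed

lemma H1_norm_sq: "(nH1 u)\<^sup>2 = (nL2 u)\<^sup>2 + (\<Sum>i\<in>UNIV. (nL2 (wpd i u))\<^sup>2)"
  by (simp add: H1_norm_def sum_nonneg add_nonneg_nonneg)

lemma H1_norm_nonneg: "nH1 u \<ge> 0" by (simp add: H1_norm_def sum_nonneg)

lemma H1_norm_scale: "u \<in> H1 \<Omega> \<Longrightarrow> nH1 (a *\<^sub>R u) = \<bar>a\<bar> * nH1 u"
proof -
  assume "u \<in> H1 \<Omega>"
  then have "(nH1 (a *\<^sub>R u))\<^sup>2 = (\<bar>a\<bar> * nH1 u)\<^sup>2"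
    by (simp add: H1_norm_sq H1_scale L2_norm_scale power_mult_distrib sum_distrib_left distrib_left)
  then show ?thesis by (rule power2_eq_imp_eq) (auto simp: H1_norm_nonneg)
qed

lemma H1_norm_add_sq:
  assumes "u \<in> H1 \<Omega>" "v \<in> H1 \<Omega>"
  shows "(nH1 (u + v))\<^sup>2 \<le> 2 * (nH1 u)\<^sup>2 + 2 * (nH1 v)\<^sup>2"
proof -
  have "(\<Sum>i\<in>UNIV. (nL2 (wpd i u + wpd i v))\<^sup>2)
      \<le> (\<Sum>i\<in>UNIV. 2 * (nL2 (wpd i u))\<^sup>2 + 2 * (nL2 (wpd i v))\<^sup>2)"
    by (intro sum_mono L2_norm_add_sq H1_weak_pderiv assms)
  then show ?thesis using L2_norm_add_sq[OF H1_L2[OF assms(1)] H1_L2[OF assms(2)]]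
    by (simp add: H1_norm_sq H1_add(2)[OF assms] sum.distrib sum_distrib_left)
qed

lemma H10_H1: "u \<in> H10 \<Omega> \<Longrightarrow> u \<in> H1 \<Omega>" by (simp add: H10_def)

lemma H10_approx:
  assumes "u \<in> H10 \<Omega>" "\<epsilon> > 0"
  obtains \<phi> where "\<phi> \<in> test_funs \<Omega>" "nH1 (u - cls \<phi>) < \<epsilon>"
  using assms unfolding H10_def by (auto simp: scaleR_minus_left)

lemma H10I:
  assumes "u \<in> H1 \<Omega>" "\<And>\<epsilon>. \<epsilon> > 0 \<Longrightarrow> \<exists>\<phi>\<in>test_funs \<Omega>. nH1 (u - cls \<phi>) < \<epsilon>"
  shows "u \<in> H10 \<Omega>"
  using assms unfolding H10_def by simp

lemma H10_add:
  assumes "u \<in> H10 \<Omega>" "v \<in> H10 \<Omega>"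
  shows "u + v \<in> H10 \<Omega>"
proof (rule H10I)
  show "u + v \<in> H1 \<Omega>" using assms H10_H1 H1_add by blast
  fix \<epsilon> :: real assume \<epsilon>: "\<epsilon> > 0"
  obtain \<phi> where \<phi>: "\<phi> \<in> test_funs \<Omega>" "nH1 (u - cls \<phi>) < \<epsilon> / 2"
    using H10_approx[OF assms(1)] \<epsilon> by (metis half_gt_zero)
  obtain \<psi> where \<psi>: "\<psi> \<in> test_funs \<Omega>" "nH1 (v - cls \<psi>) < \<epsilon> / 2"
    using H10_approx[OF assms(2)] \<epsilon> by (metis half_gt_zero)
  let ?a = "u - cls \<phi>" and ?b = "v - cls \<psi>"
  have eq: "u + v - cls (\<lambda>x. \<phi> x + \<psi> x) = ?a + ?b"
    by (simp add: class_on_add test_measurable \<phi> \<psi>)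
  have "?a \<in> H1 \<Omega>" "?b \<in> H1 \<Omega>"
    by (intro H1_diff(1) test_weak_pderiv(1) assms[THEN H10_H1] \<phi> \<psi>)+
  from H1_norm_add_sq[OF this]
  have "(nH1 (?a + ?b))\<^sup>2 \<le> 2 * (nH1 ?a)\<^sup>2 + 2 * (nH1 ?b)\<^sup>2" .
  also have "\<dots> < 2 * (\<epsilon> / 2)\<^sup>2 + 2 * (\<epsilon> / 2)\<^sup>2"
    using \<phi>(2) \<psi>(2) H1_norm_nonneg by (intro add_strict_mono mult_strict_left_mono power_strict_mono) auto
  also have "\<dots> = \<epsilon>\<^sup>2" by (simp add: power2_eq_square)
  finally have "nH1 (?a + ?b) < \<epsilon>" using \<epsilon> power_less_imp_less_base by (metis less_imp_le)
  then show "\<exists>\<phi>\<in>test_funs \<Omega>. nH1 (u + v - cls \<phi>) < \<epsilon>"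
    using eq test_funs_add[OF \<phi>(1) \<psi>(1)] by (metis (lifting))
qed

lemma H10_scale:
  assumes "u \<in> H10 \<Omega>"
  shows "a *\<^sub>R u \<in> H10 \<Omega>"
proof (rule H10I)
  show "a *\<^sub>R u \<in> H1 \<Omega>" using assms H10_H1 H1_scale by blast
  fix \<epsilon> :: real assume \<epsilon>: "\<epsilon> > 0"
  obtain \<phi> where \<phi>: "\<phi> \<in> test_funs \<Omega>" "nH1 (u - cls \<phi>) < \<epsilon> / (\<bar>a\<bar> + 1)"
    using H10_approx[OF assms(1), of "\<epsilon> / (\<bar>a\<bar> + 1)"] \<epsilon> by (auto intro: divide_pos_pos)
  have h: "u - cls \<phi> \<in> H1 \<Omega>"
    by (intro H1_diff(1) test_weak_pderiv(1) \<phi> H10_H1 assms)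
  have "a *\<^sub>R u - cls (\<lambda>x. a * \<phi> x) = a *\<^sub>R (u - cls \<phi>)"
    by (simp add: class_on_scale test_measurable \<phi> scaleR_right_diff_distrib)
  then have "nH1 (a *\<^sub>R u - cls (\<lambda>x. a * \<phi> x)) = \<bar>a\<bar> * nH1 (u - cls \<phi>)"
    using H1_norm_scale[OF h] by metis
  also have "\<dots> \<le> \<bar>a\<bar> * (\<epsilon> / (\<bar>a\<bar> + 1))" using \<phi>(2) by (intro mult_left_mono) auto
  also have "\<dots> < \<epsilon>" using \<epsilon> by (simp add: field_simps)
  finally show "\<exists>\<phi>\<in>test_funs \<Omega>. nH1 (a *\<^sub>R u - cls \<phi>) < \<epsilon>"
    using test_funs_scale[OF \<phi>(1)] by blast
qed

lemma test_H10:
  assumes "\<phi> \<in> test_funs \<Omega>" shows "cls \<phi> \<in> H10 \<Omega>"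
proof (rule H10I)
  show "cls \<phi> \<in> H1 \<Omega>" by (rule test_weak_pderiv(1)[OF assms])
  fix \<epsilon> :: real assume "\<epsilon> > 0"
  have "nH1 (0 *\<^sub>R cls \<phi>) = 0" using H1_norm_scale[OF test_weak_pderiv(1)[OF assms], of 0] by simp
  then show "\<exists>\<psi>\<in>test_funs \<Omega>. nH1 (cls \<phi> - cls \<psi>) < \<epsilon>"
    using assms \<open>\<epsilon> > 0\<close> by (intro bexI[of _ \<phi>]) auto
qed

lemma test_H2:
  assumes "\<phi> \<in> test_funs \<Omega>" shows "cls \<phi> \<in> H2 \<Omega>"
  using assms by (auto simp: H2_def test_weak_pderiv intro: test_weak_pderiv test_funs_pderiv)

abbreviation "X \<equiv> H2 \<Omega> \<inter> H10 \<Omega>"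

lemma X_add: "u \<in> X \<Longrightarrow> v \<in> X \<Longrightarrow> u + v \<in> X"
  and X_scale: "u \<in> X \<Longrightarrow> a *\<^sub>R u \<in> X"
  and test_X: "\<phi> \<in> test_funs \<Omega> \<Longrightarrow> cls \<phi> \<in> X"
  by (auto intro: H2_add H10_add H2_scale H10_scale test_H2 test_H10)

lemma X_diff: "u \<in> X \<Longrightarrow> v \<in> X \<Longrightarrow> u - v \<in> X"
  using X_add[OF _ X_scale[of v "-1"], of u] by simp

lemma H2_norm_sq: "(nH2 u)\<^sup>2 = (nL2 u)\<^sup>2 + (\<Sum>i\<in>UNIV. (nL2 (wpd i u))\<^sup>2)
     + (\<Sum>i\<in>UNIV. \<Sum>j\<in>UNIV. (nL2 (wpd i (wpd j u)))\<^sup>2)"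
  by (simp add: H2_norm_def sum_nonneg add_nonneg_nonneg)

lemma H2_norm_nonneg: "nH2 u \<ge> 0" by (simp add: H2_norm_def sum_nonneg)

lemma H2_norm_scale: "u \<in> H2 \<Omega> \<Longrightarrow> nH2 (a *\<^sub>R u) = \<bar>a\<bar> * nH2 u"
proof -
  assume "u \<in> H2 \<Omega>"
  then have "(nH2 (a *\<^sub>R u))\<^sup>2 = (\<bar>a\<bar> * nH2 u)\<^sup>2"
    by (simp add: H2_norm_sq H1_scale H2_H1 L2_norm_scale power_mult_distrib sum_distrib_left distrib_left)
  then show ?thesis by (rule power2_eq_imp_eq) (auto simp: H2_norm_nonneg)
qed

lemma H2_norm_add_sq:
  assumes "u \<in> H2 \<Omega>" "v \<in> H2 \<Omega>"
  shows "(nH2 (u + v))\<^sup>2 \<le> 2 * (nH2 u)\<^sup>2 + 2 * (nH2 v)\<^sup>2"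
proof -
  note h = H2_H1[OF assms(1)] H2_H1[OF assms(2)]
  have "(\<Sum>i\<in>UNIV. (nL2 (wpd i u + wpd i v))\<^sup>2)
      \<le> (\<Sum>i\<in>UNIV. 2 * (nL2 (wpd i u))\<^sup>2 + 2 * (nL2 (wpd i v))\<^sup>2)"
    by (intro sum_mono L2_norm_add_sq H1_weak_pderiv h)
  moreover have "(\<Sum>i\<in>UNIV. \<Sum>j\<in>UNIV. (nL2 (wpd i (wpd j u) + wpd i (wpd j v)))\<^sup>2)
      \<le> (\<Sum>i\<in>UNIV. \<Sum>j\<in>UNIV. 2 * (nL2 (wpd i (wpd j u)))\<^sup>2 + 2 * (nL2 (wpd i (wpd j v)))\<^sup>2)"
    by (intro sum_mono L2_norm_add_sq H1_weak_pderiv h)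
  ultimately show ?thesis using L2_norm_add_sq[OF H1_L2[OF h(1)] H1_L2[OF h(3)]]
    by (simp add: H2_norm_sq H1_add(2) h sum.distrib sum_distrib_left)
qed

lemma L2_norm_le_H2:
  "nL2 u \<le> nH2 u"
  "nL2 (wpd i u) \<le> nH2 u"
  "nL2 (wpd i (wpd j u)) \<le> nH2 u"
proof -
  let ?g = "\<lambda>i. (nL2 (wpd i u))\<^sup>2"
  let ?h = "\<lambda>i j. (nL2 (wpd i (wpd j u)))\<^sup>2"
  have "?g i \<le> (\<Sum>i\<in>UNIV. ?g i)" by (rule member_le_sum) auto
  moreover have "?h i j \<le> (\<Sum>j\<in>UNIV. ?h i j)" by (rule member_le_sum) auto
  moreover have "(\<Sum>j\<in>UNIV. ?h i j) \<le> (\<Sum>i\<in>UNIV. \<Sum>j\<in>UNIV. ?h i j)"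
    by (rule member_le_sum[where f = "\<lambda>i. \<Sum>j\<in>UNIV. ?h i j"]) (auto intro: sum_nonneg)
  moreover have "(\<Sum>i\<in>UNIV. ?g i) \<ge> 0" "(\<Sum>i\<in>UNIV. \<Sum>j\<in>UNIV. ?h i j) \<ge> 0" "(nL2 u)\<^sup>2 \<ge> 0"
    by (auto intro!: sum_nonneg)
  ultimately have "(nL2 u)\<^sup>2 \<le> (nH2 u)\<^sup>2" "?g i \<le> (nH2 u)\<^sup>2" "?h i j \<le> (nH2 u)\<^sup>2"
    unfolding H2_norm_sq by linarith+
  then show "nL2 u \<le> nH2 u" "nL2 (wpd i u) \<le> nH2 u"
    "nL2 (wpd i (wpd j u)) \<le> nH2 u"
    using power2_le_imp_le H2_norm_nonneg by blast+
qed

end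

section \<open>Compactness\<close>

subsection \<open>Poincare's inequality on a grid of cubes\<close>

text \<open>The grid of cubes of side \<open>h\<close> is indexed by integer vectors. Cubes are half open, so that they form a
  partition.\<close>

definition cube_index :: "real \<Rightarrow> real^'d \<Rightarrow> int^'d::finite" where
  "cube_index h x = (\<chi> i. \<lfloor>x $ i / h\<rfloor>)"

definition cube :: "real \<Rightarrow> int^'d \<Rightarrow> (real^'d::finite) set" where
  "cube h k = {x. cube_index h x = k}"

lemma mem_cube: "h > 0 \<Longrightarrow> x \<in> cube h k \<longleftrightarrow> (\<forall>i. real_of_int (k $ i) * h \<le> x $ i \<and> x $ i < (real_of_int (k $ i) + 1) * h)"
  by (simp add: cube_def cube_index_def vec_eq_iff floor_eq_iff field_simps)

lemma cube_borel[measurable]: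
  fixes k :: "int^'d::finite"
  assumes "h > 0"
  shows "cube h k \<in> sets borel"
proof -
  have "cube h k = (\<Inter>i\<in>UNIV. {x. real_of_int (k $ i) * h \<le> x $ i} \<inter> {x. x $ i < (real_of_int (k $ i) + 1) * h})"
    using assms by (auto simp: mem_cube)
  also have "\<dots> \<in> sets borel"
  proof (rule sets.finite_INT)
    fix i
    have "{x::real^'d. real_of_int (k $ i) * h \<le> x $ i} \<in> sets borel"
      using borel_closed[OF closed_halfspace_component_ge_cart[of "real_of_int (k $ i) * h" i]] by simp
    moreover have "{x::real^'d. x $ i < (real_of_int (k $ i) + 1) * h} \<in> sets borel"
      using borel_open[OF open_halfspace_component_lt_cart[of i "(real_of_int (k $ i) + 1) * h"]] by simp
    ultimately show "{x::real^'d. real_of_int (k $ i) * h \<le> x $ i} \<inter> {x. x $ i < (real_of_int (k $ i) + 1) * h} \<in> sets borel"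
      by (rule sets.Int)
  qed auto
  finally show ?thesis .
qed

lemma emeasure_cube:
  fixes k :: "int^'d::finite"
  assumes "h > 0"
  shows "emeasure lborel (cube h k) = ennreal (h ^ CARD('d))"
proof -
  define l :: "real^'d" where "l = (\<chi> i. real_of_int (k $ i) * h)"
  define u :: "real^'d" where "u = (\<chi> i. (real_of_int (k $ i) + 1) * h)"
  have ul: "(u - l) \<bullet> b = h" "l \<bullet> b \<le> u \<bullet> b" if "b \<in> Basis" for b
    using that assms by (auto simp: l_def u_def Basis_vec_def inner_axis algebra_simps)
  have p: "(\<Prod>b\<in>Basis. (u - l) \<bullet> b) = h ^ CARD('d)" by (simp add: ul)
  have e: "emeasure lborel (box l u) = ennreal (h ^ CARD('d))" "emeasure lborel (cbox l u) = ennreal (h ^ CARD('d))"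
    using emeasure_lborel_box[OF ul(2)] emeasure_lborel_cbox[OF ul(2)] p by auto
  have "box l u \<subseteq> cube h k" using assms by (auto simp: mem_cube mem_box_cart l_def u_def less_imp_le)
  moreover have "cube h k \<subseteq> cbox l u" using assms by (auto simp: mem_cube mem_box_cart l_def u_def less_imp_le)
  ultimately show ?thesis
    using emeasure_mono[of "box l u" "cube h k" lborel] emeasure_mono[of "cube h k" "cbox l u" lborel] e assms
    by (intro antisym) auto
qed

lemma cube_diff:
  assumes "h > 0" "x \<in> cube h k" "y \<in> cube h k"
  shows "\<bar>(y - x) $ i\<bar> \<le> h"
proof -
  have "real_of_int (k $ i) * h \<le> x $ i" "x $ i < (real_of_int (k $ i) + 1) * h"
    "real_of_int (k $ i) * h \<le> y $ i" "y $ i < (real_of_int (k $ i) + 1) * h"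
    using assms by (auto simp: mem_cube)
  then show ?thesis by (simp add: algebra_simps abs_le_iff)
qed

lemma finite_cube_index:
  fixes S :: "(real^'d::finite) set"
  assumes "bounded S" "h > 0"
  shows "finite (cube_index h ` S)"
proof -
  obtain B where B: "\<And>x. x \<in> S \<Longrightarrow> norm x \<le> B" using assms(1) bounded_iff by metis
  have sub: "cube_index h ` S \<subseteq> {k. \<forall>i. k $ i \<in> {\<lfloor>- B / h\<rfloor>..\<lfloor>B / h\<rfloor>}}"
  proof safe
    fix x i assume "x \<in> S"
    then have "\<bar>x $ i\<bar> \<le> B" using B component_le_norm_cart[of x i] by fastforce
    then have "- B \<le> x $ i" "x $ i \<le> B" by auto
    then have "- B / h \<le> x $ i / h" "x $ i / h \<le> B / h" using assms(2) divide_right_mono less_imp_le by blast+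
    then show "cube_index h x $ i \<in> {\<lfloor>- B / h\<rfloor>..\<lfloor>B / h\<rfloor>}"
      by (simp add: cube_index_def floor_mono)
  qed
  have "finite {k::int^'d. \<forall>i. k $ i \<in> {\<lfloor>- B / h\<rfloor>..\<lfloor>B / h\<rfloor>}}"
  proof -
    let ?J = "{\<lfloor>- B / h\<rfloor>..\<lfloor>B / h\<rfloor>}"
    have "{k::int^'d. \<forall>i. k $ i \<in> ?J} \<subseteq> vec_lambda ` (UNIV \<rightarrow>\<^sub>E ?J)"
    proof
      fix k :: "int^'d" assume "k \<in> {k. \<forall>i. k $ i \<in> ?J}"
      then have "k = vec_lambda (($) k)" "($) k \<in> UNIV \<rightarrow>\<^sub>E ?J" by auto
      then show "k \<in> vec_lambda ` (UNIV \<rightarrow>\<^sub>E ?J)" by blast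
    qed
    then show ?thesis by (rule finite_subset) (intro finite_imageI finite_PiE; simp)
  qed
  with sub show ?thesis by (rule finite_subset)
qed

text \<open>Poincare's inequality on the cubes of a grid, summed over all cubes. On one cube \<open>Q\<close> the quantity
  \<open>\<bar>Q\<bar> \<integral>\<^sub>Q F\<^sup>2 - (\<integral>\<^sub>Q F)\<^sup>2\<close> is half the double integral of \<open>(F x - F y)\<^sup>2\<close>; as \<open>y - x\<close> is
  small for \<open>x, y \<in> Q\<close>, the sum of all double integrals is controlled by the translation estimate.\<close>

lemma cube_inequality_test_fun:
  fixes F :: "real^'d::finite \<Rightarrow> real"
  assumes F: "F \<in> test_funs \<Omega>" and h: "h > 0" and I: "finite I" "cube_index h ` \<Omega> \<subseteq> I"
  shows "(LINT x|lborel. (F x)\<^sup>2) \<le> 2 ^ CARD('d) * real CARD('d) * h\<^sup>2 * (LINT x|lborel. (\<Sum>i\<in>UNIV. (pderiv_at i F x)\<^sup>2))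
     + (\<Sum>k\<in>I. (LINT x|lborel. indicator (cube h k) x * F x)\<^sup>2) / h ^ CARD('d)"
proof -
  let ?G = "LINT x|lborel. (\<Sum>i\<in>UNIV. (pderiv_at i F x)\<^sup>2)"
  define a where "a = h ^ CARD('d)"
  have a: "a > 0" using h by (simp add: a_def)
  note [measurable] = test_funs_borel[OF F] cube_borel[OF h]
  note s = test_funs_smooth[OF F]
  have iF: "integrable lborel F" by (rule test_funs_integrable[OF F])
  have iF2: "integrable lborel (\<lambda>x. (F x)\<^sup>2)"
    unfolding power2_eq_square by (rule test_funs_integrable[OF test_funs_mult[OF F s]])
  define b where "b k = (LINT x|lborel. indicator (cube h k) x * F x)" for k
  define c where "c k = (LINT x|lborel. indicator (cube h k) x * (F x)\<^sup>2)" for k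
  have i1: "integrable lborel (\<lambda>x. indicator (cube h k) x * F x)" "integrable lborel (\<lambda>x. indicator (cube h k) x * (F x)\<^sup>2)" for k
    using integrable_mult_indicator[OF _ iF, of "cube h k"] integrable_mult_indicator[OF _ iF2, of "cube h k"] by auto
  have fin: "emeasure lborel (cube h k) < \<infinity>" for k :: "int^'d" by (simp add: emeasure_cube[OF h])
  have i0: "integrable lborel (\<lambda>x. indicator (cube h k) x :: real)" for k :: "int^'d"
    by (rule integrable_real_indicator) (use fin in auto)
  have m: "(LINT x|lborel. indicator (cube h k) x) = a" for k :: "int^'d"
    using emeasure_cube[OF h, of k] h by (simp add: measure_def a_def)
  let ?D = "\<lambda>x y. ennreal ((F x - F y)\<^sup>2)"
  let ?N = "\<lambda>k. \<integral>\<^sup>+x. \<integral>\<^sup>+y. indicator (cube h k) x * indicator (cube h k) y * ?D x y \<partial>lborel \<partial>lborel"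
  have hb: "has_bochner_integral lborel (\<lambda>x. indicator (cube h k) x) a"
    "has_bochner_integral lborel (\<lambda>x. indicator (cube h k) x * F x) (b k)"
    "has_bochner_integral lborel (\<lambda>x. indicator (cube h k) x * (F x)\<^sup>2) (c k)" for k
    using i0 i1 m by (auto simp: has_bochner_integral_iff b_def c_def)
  have inner: "has_bochner_integral lborel (\<lambda>y. indicator (cube h k) y * (F x - F y)\<^sup>2) (a * (F x)\<^sup>2 - 2 * b k * F x + c k)" for x k
  proof -
    have "has_bochner_integral lborel (\<lambda>y. (F x)\<^sup>2 * indicator (cube h k) y - 2 * F x * (indicator (cube h k) y * F y) + indicator (cube h k) y * (F y)\<^sup>2)
        ((F x)\<^sup>2 * a - 2 * F x * b k + c k)"
      by (intro has_bochner_integral_add has_bochner_integral_diff has_bochner_integral_mult_right hb)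
    then show ?thesis
      by (rule has_bochner_integral_cong[THEN iffD1, rotated -1]) (auto simp: power2_diff algebra_simps)
  qed
  have nn: "0 \<le> a * (F x)\<^sup>2 - 2 * b k * F x + c k" for x k
  proof -
    have "0 \<le> (LINT y|lborel. indicator (cube h k) y * (F x - F y)\<^sup>2)" by simp
    then show ?thesis unfolding has_bochner_integral_integral_eq[OF inner[of k x]] .
  qed
  have outer: "has_bochner_integral lborel (\<lambda>x. indicator (cube h k) x * (a * (F x)\<^sup>2 - 2 * b k * F x + c k)) (2 * (a * c k - (b k)\<^sup>2))" for k
  proof -
    have "has_bochner_integral lborel (\<lambda>x. a * (indicator (cube h k) x * (F x)\<^sup>2) - 2 * b k * (indicator (cube h k) x * F x) + c k * indicator (cube h k) x)
        (a * c k - 2 * b k * b k + c k * a)"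
      by (intro has_bochner_integral_add has_bochner_integral_diff has_bochner_integral_mult_right hb)
    then show ?thesis
      by (rule has_bochner_integral_cong[THEN iffD1, rotated -1]) (auto simp: power2_eq_square algebra_simps)
  qed
  have nnN: "0 \<le> a * c k - (b k)\<^sup>2" for k
  proof -
    have "0 \<le> (LINT x|lborel. indicator (cube h k) x * (a * (F x)\<^sup>2 - 2 * b k * F x + c k))"
      by (intro integral_nonneg_AE AE_I2 mult_nonneg_nonneg nn) auto
    then show ?thesis unfolding has_bochner_integral_integral_eq[OF outer[of k]] by simp
  qed
  have N: "?N k = ennreal (2 * (a * c k - (b k)\<^sup>2))" for k
  proof -
    have "(\<integral>\<^sup>+y. indicator (cube h k) y * ?D x y \<partial>lborel) = ennreal (a * (F x)\<^sup>2 - 2 * b k * F x + c k)" for x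
    proof -
      have "(\<integral>\<^sup>+y. indicator (cube h k) y * ?D x y \<partial>lborel) = (\<integral>\<^sup>+y. ennreal (indicator (cube h k) y * (F x - F y)\<^sup>2) \<partial>lborel)"
        by (intro nn_integral_cong) (auto simp: indicator_def)
      also have "\<dots> = ennreal (a * (F x)\<^sup>2 - 2 * b k * F x + c k)"
        using nn_integral_eq_integral[of lborel "\<lambda>y. indicator (cube h k) y * (F x - F y)\<^sup>2"] inner[of k x]
        by (simp add: has_bochner_integral_iff)
      finally show ?thesis .
    qed
    note in_eq = this
    have "?N k = (\<integral>\<^sup>+x. indicator (cube h k) x * (\<integral>\<^sup>+y. indicator (cube h k) y * ?D x y \<partial>lborel) \<partial>lborel)"
      by (intro nn_integral_cong) (simp add: mult.assoc nn_integral_cmult)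
    also have "\<dots> = (\<integral>\<^sup>+x. ennreal (indicator (cube h k) x * (a * (F x)\<^sup>2 - 2 * b k * F x + c k)) \<partial>lborel)"
      unfolding in_eq by (intro nn_integral_cong) (auto simp: indicator_def)
    also have "\<dots> = ennreal (2 * (a * c k - (b k)\<^sup>2))"
      using nn_integral_eq_integral[of lborel "\<lambda>x. indicator (cube h k) x * (a * (F x)\<^sup>2 - 2 * b k * F x + c k)"] outer[of k] nn[of _ k]
      by (simp add: has_bochner_integral_iff)
    finally show ?thesis .
  qed
  let ?B = "cbox (\<chi> i. - h) (\<chi> i. h) :: (real^'d) set"
  let ?K = "real CARD('d) * h\<^sup>2 * ?G"
  have G0: "?G \<ge> 0" by (intro integral_nonneg_AE AE_I2 sum_nonneg) auto
  have sumN: "(\<Sum>k\<in>I. ?N k) \<le> ennreal ((2 * h) ^ CARD('d) * ?K)"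
  proof -
    have "(\<Sum>k\<in>I. ?N k) = (\<integral>\<^sup>+x. \<integral>\<^sup>+y. (\<Sum>k\<in>I. indicator (cube h k) x * indicator (cube h k) y * ?D x y) \<partial>lborel \<partial>lborel)"
      by (simp add: nn_integral_sum)
    also have "\<dots> \<le> (\<integral>\<^sup>+x. \<integral>\<^sup>+y. indicator ?B (y - x) * ?D x y \<partial>lborel \<partial>lborel)"
    proof (intro nn_integral_mono)
      fix x y :: "real^'d"
      show "(\<Sum>k\<in>I. indicator (cube h k) x * indicator (cube h k) y * ?D x y) \<le> indicator ?B (y - x) * ?D x y"
      proof (cases "cube_index h x = cube_index h y")
        case True
        have "(\<Sum>k\<in>I. indicator (cube h k) x * indicator (cube h k) y * ?D x y) = (\<Sum>k\<in>I. if k = cube_index h x then ?D x y else 0)"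
          using True by (intro sum.cong) (auto simp: cube_def)
        also have "\<dots> \<le> ?D x y" using I by simp
        also have "\<dots> = indicator ?B (y - x) * ?D x y"
        proof -
          have "\<bar>(y - x) $ i\<bar> \<le> h" for i
            using cube_diff[OF h, of x "cube_index h x" y] True by (auto simp: cube_def)
          then have "y - x \<in> ?B" unfolding mem_box_cart by (auto simp: abs_le_iff minus_le_iff simp del: vector_minus_component)
          then show "?D x y = indicator ?B (y - x) * ?D x y" by simp
        qed
        finally show ?thesis .
      next
        case False
        then have "(\<Sum>k\<in>I. indicator (cube h k) x * indicator (cube h k) y * ?D x y) = 0"
          by (intro sum.neutral) (auto simp: cube_def indicator_def)
        then show ?thesis by simp
      qed
    qed
    also have "\<dots> = (\<integral>\<^sup>+x. \<integral>\<^sup>+z. indicator ?B z * ?D x (x + z) \<partial>lborel \<partial>lborel)"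
    proof (rule nn_integral_cong)
      fix x :: "real^'d"
      have "(\<integral>\<^sup>+y. indicator ?B (y - x) * ?D x y \<partial>lborel) = (\<integral>\<^sup>+y. indicator ?B (y - x) * ?D x y \<partial>distr lborel borel ((+) x))"
        by (simp add: lborel_distr_plus)
      also have "\<dots> = (\<integral>\<^sup>+z. indicator ?B (x + z - x) * ?D x (x + z) \<partial>lborel)"
        by (rule nn_integral_distr) auto
      finally show "(\<integral>\<^sup>+y. indicator ?B (y - x) * ?D x y \<partial>lborel) = (\<integral>\<^sup>+z. indicator ?B z * ?D x (x + z) \<partial>lborel)" by simp
    qed
    also have "\<dots> = (\<integral>\<^sup>+z. \<integral>\<^sup>+x. indicator ?B z * ?D x (x + z) \<partial>lborel \<partial>lborel)"
      by (rule lborel_pair.Fubini') measurable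
    also have "\<dots> \<le> (\<integral>\<^sup>+z. ennreal ?K * indicator ?B z \<partial>lborel)"
    proof (intro nn_integral_mono)
      fix z :: "real^'d"
      show "(\<integral>\<^sup>+x. indicator ?B z * ?D x (x + z) \<partial>lborel) \<le> ennreal ?K * indicator ?B z"
      proof (cases "z \<in> ?B")
        case True
        have "(norm z)\<^sup>2 = (\<Sum>i\<in>UNIV. (z $ i)\<^sup>2)" by (simp add: norm_vec_def L2_set_def sum_nonneg)
        also have "\<dots> \<le> (\<Sum>i\<in>(UNIV::'d set). h\<^sup>2)"
        proof (intro sum_mono)
          fix i
          have "\<bar>z $ i\<bar> \<le> \<bar>h\<bar>" using True h by (auto simp: mem_box_cart abs_le_iff minus_le_iff)
          then show "(z $ i)\<^sup>2 \<le> h\<^sup>2" by (simp add: abs_le_square_iff)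
        qed
        finally have z: "(norm z)\<^sup>2 \<le> real CARD('d) * h\<^sup>2" by simp
        have it: "integrable lborel (\<lambda>x. (F (x + z) - F x)\<^sup>2)"
        proof -
          have "sqint lborel (\<lambda>x. F (x + z))" "sqint lborel (\<lambda>x. - 1 * F x)"
            using lborel_integrable_translate[OF iF2, of z] iF2 by (auto simp: sqint_def)
          from sqint_add[OF this] show ?thesis by (simp add: sqint_def)
        qed
        have "(\<integral>\<^sup>+x. indicator ?B z * ?D x (x + z) \<partial>lborel) = (\<integral>\<^sup>+x. ennreal ((F (x + z) - F x)\<^sup>2) \<partial>lborel)"
          using True by (simp add: power2_commute)
        also have "\<dots> = ennreal (LINT x|lborel. (F (x + z) - F x)\<^sup>2)"
          by (rule nn_integral_eq_integral[OF it]) simp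
        also have "\<dots> \<le> ennreal ?K"
          using translation_estimate[OF F, of z] mult_right_mono[OF z G0] by (intro ennreal_leI) linarith
        finally show ?thesis using True by simp
      qed simp
    qed
    also have "\<dots> = ennreal ?K * emeasure lborel ?B" by (subst nn_integral_cmult_indicator) auto
    also have "emeasure lborel ?B = ennreal ((2 * h) ^ CARD('d))"
    proof -
      have "((\<chi> i. h) - (\<chi> i. - h) :: real^'d) \<bullet> b = 2 * h" if "b \<in> Basis" for b
        using that by (auto simp: Basis_vec_def inner_axis)
      then have "(\<Prod>b\<in>Basis. ((\<chi> i. h) - (\<chi> i. - h) :: real^'d) \<bullet> b) = (2 * h) ^ CARD('d)" by simp
      then show ?thesis
        using h by (subst emeasure_lborel_cbox) (auto simp: Basis_vec_def inner_axis)
    qed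
    finally show ?thesis using h G0 by (simp add: ennreal_mult[symmetric] mult.commute)
  qed
  have "ennreal (\<Sum>k\<in>I. 2 * (a * c k - (b k)\<^sup>2)) \<le> ennreal ((2 * h) ^ CARD('d) * ?K)"
    using sumN unfolding N using nnN by (subst sum_ennreal[symmetric]) auto
  then have main: "(\<Sum>k\<in>I. 2 * (a * c k - (b k)\<^sup>2)) \<le> (2 * h) ^ CARD('d) * ?K"
    using h G0 by (subst (asm) ennreal_le_iff) auto
  have total: "(LINT x|lborel. (F x)\<^sup>2) = (\<Sum>k\<in>I. c k)"
  proof -
    have "(F x)\<^sup>2 = (\<Sum>k\<in>I. indicator (cube h k) x * (F x)\<^sup>2)" for x
    proof (cases "F x = 0")
      case False
      then have "cube_index h x \<in> I" using I test_funs_outside[OF F] by blast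
      then have "(\<Sum>k\<in>I. indicator (cube h k) x * (F x)\<^sup>2) = (\<Sum>k\<in>I. if k = cube_index h x then (F x)\<^sup>2 else 0)"
        by (intro sum.cong) (auto simp: cube_def)
      then show ?thesis using I \<open>cube_index h x \<in> I\<close> by simp
    qed simp
    then have "(LINT x|lborel. (F x)\<^sup>2) = (LINT x|lborel. (\<Sum>k\<in>I. indicator (cube h k) x * (F x)\<^sup>2))" by simp
    also have "\<dots> = (\<Sum>k\<in>I. c k)" unfolding c_def by (rule Bochner_Integration.integral_sum) (rule i1)
    finally show ?thesis .
  qed
  have "2 * (a * (\<Sum>k\<in>I. c k)) = (\<Sum>k\<in>I. 2 * (a * c k - (b k)\<^sup>2)) + 2 * (\<Sum>k\<in>I. (b k)\<^sup>2)"
    by (simp add: sum_subtractf sum_distrib_left right_diff_distrib)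
  also have "\<dots> \<le> (2 * h) ^ CARD('d) * ?K + 2 * (\<Sum>k\<in>I. (b k)\<^sup>2)" using main by simp
  also have "(2 * h) ^ CARD('d) * ?K = a * (2 ^ CARD('d) * ?K)" by (simp add: a_def power_mult_distrib)
  also have "\<dots> \<le> 2 * (a * (2 ^ CARD('d) * ?K))" using a G0 h by simp
  finally have "a * (\<Sum>k\<in>I. c k) \<le> a * (2 ^ CARD('d) * ?K) + (\<Sum>k\<in>I. (b k)\<^sup>2)" by simp
  then have "(\<Sum>k\<in>I. c k) \<le> 2 ^ CARD('d) * ?K + (\<Sum>k\<in>I. (b k)\<^sup>2) / a"
    using a by (simp add: field_simps)
  then show ?thesis by (simp add: total b_def a_def mult.assoc)
qed

subsection \<open>Limits of test functions and Rellich's theorem\<close>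

text \<open>Finitely many bounded sequences, here the averages over the cubes that meet the domain, converge
  simultaneously along one subsequence.\<close>

lemma finite_family_convergent_subsequence:
  fixes a :: "'k \<Rightarrow> nat \<Rightarrow> real"
  assumes "finite I" "\<And>k. k \<in> I \<Longrightarrow> bounded (range (a k))"
  shows "\<exists>r::nat \<Rightarrow> nat. strict_mono r \<and> (\<forall>k\<in>I. convergent (a k \<circ> r))"
  using assms
proof (induction I rule: finite_induct)
  case empty
  then show ?case by (auto intro: exI[of _ id] simp: strict_mono_def)
next
  case (insert k I)
  then obtain r :: "nat \<Rightarrow> nat" where r: "strict_mono r" "\<forall>k\<in>I. convergent (a k \<circ> r)" by blast
  have "bounded (range (a k \<circ> r))"
    using insert.prems[of k] by (rule bounded_subset) auto
  then obtain l s where s: "strict_mono s" "((a k \<circ> r) \<circ> s) \<longlonglongrightarrow> l"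
    using bounded_imp_convergent_subsequence by blast
  have "convergent (a k' \<circ> (r \<circ> s))" if k': "k' \<in> insert k I" for k'
  proof (cases "k' = k")
    case True
    then show ?thesis using s by (auto simp: convergent_def o_assoc)
  next
    case False
    then have "convergent (a k' \<circ> r)" using r(2) k' by auto
    then have "convergent ((a k' \<circ> r) \<circ> s)" using s(1) by (rule convergent_subseq_convergent)
    then show ?thesis by (simp add: o_assoc)
  qed
  then show ?case using strict_mono_o[OF r(1) s(1)] by blast
qed

context bounded_domain
begin

text \<open>Strong convergence in \<open>L\<^sub>2\<close> allows passing to the limit in inner products and norms. This transfers
  identities and inequalities from test functions to \<open>H\<^sup>1\<^sub>0\<close>.\<close>

lemma L2_inner_limit:
  assumes u: "u \<in> L2 \<Omega>" and w: "\<And>n::nat. w n \<in> L2 \<Omega>" and g: "sqint M g"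
    and lim: "(\<lambda>n. nL2 (u - w n)) \<longlonglongrightarrow> 0"
  shows "(\<lambda>n. LINT x|M. g x * rep (w n) x) \<longlonglongrightarrow> (LINT x|M. g x * rep u x)"
proof -
  let ?d = "\<lambda>n. LINT x|M. g x * rep (u - w n) x"
  have d: "u - w n \<in> L2 \<Omega>" for n by (intro L2_diff u w)
  have gm[measurable]: "g \<in> borel_measurable M" using g by (simp add: sqint_def)
  have eq: "?d n = (LINT x|M. g x * rep u x) - (LINT x|M. g x * rep (w n) x)" for n
  proof -
    have "AE x in M. g x * rep (u - w n) x = g x * rep u x - g x * rep (w n) x"
      using rep_diff[of u "w n"]
      by eventually_elim (simp add: right_diff_distrib)
    then have "?d n = (LINT x|M. g x * rep u x - g x * rep (w n) x)"
      by (intro integral_cong_AE) auto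
    then show ?thesis
      using sqint_mult_integrable[OF g L2_sqint[OF u]] sqint_mult_integrable[OF g L2_sqint[OF w]] by simp
  qed
  have "?d \<longlonglongrightarrow> 0"
  proof (rule Lim_null_comparison)
    show "\<forall>\<^sub>F n in sequentially. norm (?d n) \<le> sqrt (LINT x|M. (g x)\<^sup>2) * nL2 (u - w n)"
      using Cauchy_Schwarz_integral[OF g L2_sqint[OF d]] by (intro always_eventually) (simp add: L2_norm_def)
    show "(\<lambda>n. sqrt (LINT x|M. (g x)\<^sup>2) * nL2 (u - w n)) \<longlonglongrightarrow> 0"
      using tendsto_mult_left[OF lim, of "sqrt (LINT x|M. (g x)\<^sup>2)"] by simp
  qed
  then have "(\<lambda>n. (LINT x|M. g x * rep u x) - ?d n) \<longlonglongrightarrow> (LINT x|M. g x * rep u x) - 0"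
    by (intro tendsto_intros)
  then show ?thesis unfolding eq by simp
qed

lemma L2_norm_limit:
  assumes u: "u \<in> L2 \<Omega>" and w: "\<And>n::nat. w n \<in> L2 \<Omega>"
    and lim: "(\<lambda>n. nL2 (u - w n)) \<longlonglongrightarrow> 0"
  shows "(\<lambda>n. (nL2 (w n))\<^sup>2) \<longlonglongrightarrow> (nL2 u)\<^sup>2"
proof -
  have eq: "(nL2 (w n))\<^sup>2 = (nL2 (u - w n))\<^sup>2 - (nL2 u)\<^sup>2 + 2 * (LINT x|M. rep u x * rep (w n) x)" for n
  proof -
    have "AE x in M. (rep (u - w n) x)\<^sup>2 = (rep u x)\<^sup>2 - 2 * (rep u x * rep (w n) x) + (rep (w n) x)\<^sup>2"
      using rep_diff[of u "w n"]
      by eventually_elim (simp add: power2_diff)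
    then have "(nL2 (u - w n))\<^sup>2 = (LINT x|M. (rep u x)\<^sup>2 - 2 * (rep u x * rep (w n) x) + (rep (w n) x)\<^sup>2)"
      unfolding L2_norm_sq by (intro integral_cong_AE) auto
    then show ?thesis
      using L2_sqint[OF u] L2_sqint[OF w, of n] sqint_mult_integrable[OF L2_sqint[OF u] L2_sqint[OF w], of n]
      by (simp add: sqint_def L2_norm_sq)
  qed
  have "(\<lambda>n. (nL2 (u - w n))\<^sup>2 - (nL2 u)\<^sup>2 + 2 * (LINT x|M. rep u x * rep (w n) x))
    \<longlonglongrightarrow> 0\<^sup>2 - (nL2 u)\<^sup>2 + 2 * (LINT x|M. rep u x * rep u x)"
    by (intro tendsto_intros lim L2_inner_limit[OF u w L2_sqint[OF u]])
  moreover have "(LINT x|M. rep u x * rep u x) = (nL2 u)\<^sup>2"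
    unfolding L2_norm_sq by (simp add: power2_eq_square)
  ultimately show ?thesis unfolding eq by simp
qed

lemma H10_sequence:
  assumes "u \<in> H10 \<Omega>"
  obtains \<phi> where "\<And>n::nat. \<phi> n \<in> test_funs \<Omega>"
    "(\<lambda>n. nL2 (u - cls (\<phi> n))) \<longlonglongrightarrow> 0"
    "\<And>i. (\<lambda>n. nL2 (wpd i u - cls (pderiv_at i (\<phi> n)))) \<longlonglongrightarrow> 0"
proof -
  have "\<forall>n::nat. \<exists>\<phi>. \<phi> \<in> test_funs \<Omega> \<and> nH1 (u - cls \<phi>) < inverse (real (Suc n))"
    using H10_approx[OF assms] by (metis inverse_positive_iff_positive of_nat_0_less_iff zero_less_Suc)
  then obtain \<phi> where \<phi>: "\<And>n. \<phi> n \<in> test_funs \<Omega>" "\<And>n. nH1 (u - cls (\<phi> n)) < inverse (real (Suc n))"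
    by metis
  have b: "nL2 v \<le> nH1 v" "nL2 (wpd i v) \<le> nH1 v" for v i
  proof -
    have "(nL2 (wpd i v))\<^sup>2 \<le> (\<Sum>i\<in>UNIV. (nL2 (wpd i v))\<^sup>2)"
      by (rule member_le_sum) auto
    moreover have "0 \<le> (\<Sum>i\<in>UNIV. (nL2 (wpd i v))\<^sup>2)" by (rule sum_nonneg) auto
    ultimately have "(nL2 v)\<^sup>2 \<le> (nH1 v)\<^sup>2" "(nL2 (wpd i v))\<^sup>2 \<le> (nH1 v)\<^sup>2"
      unfolding H1_norm_sq using zero_le_power2[of "nL2 v"] by linarith+
    then show "nL2 v \<le> nH1 v" "nL2 (wpd i v) \<le> nH1 v"
      using power2_le_imp_le H1_norm_nonneg by blast+
  qed
  have lim: "f \<longlonglongrightarrow> 0" if "\<And>n. 0 \<le> f n" "\<And>n. f n \<le> nH1 (u - cls (\<phi> n))" for f :: "nat \<Rightarrow> real"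
  proof (rule Lim_null_comparison[OF _ LIMSEQ_inverse_real_of_nat])
    have "norm (f n) \<le> inverse (real (Suc n))" for n
      using that[of n] \<phi>(2)[of n] by simp
    then show "\<forall>\<^sub>F n in sequentially. norm (f n) \<le> inverse (real (Suc n))" by simp
  qed
  have wp: "wpd i (u - cls (\<phi> n)) = wpd i u - cls (pderiv_at i (\<phi> n))" for i n
    using assms \<phi>(1)[of n] by (simp add: H1_diff(2) test_weak_pderiv H10_H1)
  show ?thesis
  proof (rule that[OF \<phi>(1)])
    show "(\<lambda>n. nL2 (u - cls (\<phi> n))) \<longlonglongrightarrow> 0"
      by (rule lim[OF L2_norm_nonneg b(1)])
    show "(\<lambda>n. nL2 (wpd i u - cls (pderiv_at i (\<phi> n)))) \<longlonglongrightarrow> 0" for i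
      unfolding wp[symmetric] by (rule lim[OF L2_norm_nonneg b(2)])
  qed
qed

lemma class_on_integral:
  assumes "\<phi> \<in> test_funs \<Omega>" "g \<in> borel_measurable borel"
  shows "(LINT x|M. g x * rep (cls \<phi>) x) = (LINT x|lborel. g x * \<phi> x)"
    "(nL2 (cls \<phi>))\<^sup>2 = (LINT x|lborel. (\<phi> x)\<^sup>2)"
proof -
  note [measurable] = test_measurable[OF assms(1)] test_funs_borel[OF assms(1)]
  have gm[measurable]: "g \<in> borel_measurable M"
    by (rule measurable_restrict_space1, rule measurable_completion) (simp add: assms(2))
  have "(LINT x|M. g x * rep (cls \<phi>) x) = (LINT x|M. g x * \<phi> x)"
    by (rule integral_cong_AE) (use class_on_rep(1)[OF test_measurable[OF assms(1)]] in \<open>auto elim!: eventually_mono\<close>)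
  also have "\<dots> = (LINT x|lborel. g x * \<phi> x)"
    by (rule lebesgue_on_integral) (use domain_sets assms test_funs_outside[OF assms(1)] in auto)
  finally show "(LINT x|M. g x * rep (cls \<phi>) x) = (LINT x|lborel. g x * \<phi> x)" .
  have "(nL2 (cls \<phi>))\<^sup>2 = (LINT x|M. (\<phi> x)\<^sup>2)"
    unfolding L2_norm_sq by (rule integral_cong_AE) (use class_on_rep(1)[OF test_measurable[OF assms(1)]] in \<open>auto elim!: eventually_mono\<close>)
  also have "\<dots> = (LINT x|lborel. (\<phi> x)\<^sup>2)"
    by (rule lebesgue_on_integral) (use domain_sets assms test_funs_outside[OF assms(1)] in auto)
  finally show "(nL2 (cls \<phi>))\<^sup>2 = (LINT x|lborel. (\<phi> x)\<^sup>2)" .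
qed

lemma cube_sqint: "h > 0 \<Longrightarrow> sqint M (indicator (cube h k))"
proof -
  assume h: "h > 0"
  have "(indicator (cube h k) :: _ \<Rightarrow> real) \<in> borel_measurable M"
    by (rule measurable_restrict_space1, rule measurable_completion) (simp, rule borel_measurable_indicator, rule cube_borel[OF h])
  then show ?thesis by (rule sqint_bound[OF sqint_const[of 1]]) (auto simp: indicator_def)
qed

text \<open>The inequality for test functions is stable under limits in \<open>H\<^sup>1\<close>. It bounds \<open>u\<close> by a small multiple of its
  gradient and finitely many integrals, which is what makes bounded sets totally bounded in \<open>L\<^sub>2\<close>.\<close>

lemma cube_inequality:
  assumes u: "u \<in> H10 \<Omega>" and h: "h > 0"
  shows "(nL2 u)\<^sup>2 \<le> 2 ^ CARD('d) * real CARD('d) * h\<^sup>2 * (\<Sum>i\<in>UNIV. (nL2 (wpd i u))\<^sup>2)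
     + (\<Sum>k\<in>cube_index h ` \<Omega>. (LINT x|M. indicator (cube h k) x * rep u x)\<^sup>2) / h ^ CARD('d)"
proof -
  obtain \<phi> where \<phi>: "\<And>n::nat. \<phi> n \<in> test_funs \<Omega>"
    "(\<lambda>n. nL2 (u - cls (\<phi> n))) \<longlonglongrightarrow> 0"
    "\<And>i. (\<lambda>n. nL2 (wpd i u - cls (pderiv_at i (\<phi> n)))) \<longlonglongrightarrow> 0"
    using H10_sequence[OF u] by blast
  note L = class_on_L2[OF test_sqint]
  have uL: "u \<in> L2 \<Omega>" "\<And>i. wpd i u \<in> L2 \<Omega>" using u H10_H1 H1_L2 H1_weak_pderiv by blast+
  let ?I = "cube_index h ` \<Omega>"
  have fin: "finite ?I" by (rule finite_cube_index[OF bounded_domain h])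
  have ineq: "(nL2 (cls (\<phi> n)))\<^sup>2 \<le> 2 ^ CARD('d) * real CARD('d) * h\<^sup>2 * (\<Sum>i\<in>UNIV. (nL2 (cls (pderiv_at i (\<phi> n))))\<^sup>2)
     + (\<Sum>k\<in>?I. (LINT x|M. indicator (cube h k) x * rep (cls (\<phi> n)) x)\<^sup>2) / h ^ CARD('d)" for n
  proof -
    have ind: "indicat_real (cube h k) \<in> borel_measurable borel" for k by (rule borel_measurable_indicator) (simp add: cube_borel[OF h])
    have "integrable lborel (\<lambda>x. (pderiv_at i (\<phi> n) x)\<^sup>2)" for i
      unfolding power2_eq_square
      by (rule test_funs_integrable[of _ \<Omega>], intro test_funs_mult test_funs_pderiv smooth_fun_pderiv \<phi> test_funs_smooth[OF \<phi>(1)])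
    then show ?thesis
      using cube_inequality_test_fun[OF \<phi>(1)[of n] h fin order_refl]
      by (simp add: class_on_integral(1)[OF \<phi>(1) ind] class_on_integral(2)[OF test_funs_pderiv[OF \<phi>(1)] borel_measurable_const[of 0]]
          class_on_integral(2)[OF \<phi>(1) borel_measurable_const[of 0]])
  qed
  have l1: "(\<lambda>n. (nL2 (cls (\<phi> n)))\<^sup>2) \<longlonglongrightarrow> (nL2 u)\<^sup>2"
    by (rule L2_norm_limit[OF uL(1) L[OF \<phi>(1)] \<phi>(2)])
  have l2: "(\<lambda>n. 2 ^ CARD('d) * real CARD('d) * h\<^sup>2 * (\<Sum>i\<in>UNIV. (nL2 (cls (pderiv_at i (\<phi> n))))\<^sup>2)
     + (\<Sum>k\<in>?I. (LINT x|M. indicator (cube h k) x * rep (cls (\<phi> n)) x)\<^sup>2) / h ^ CARD('d))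
    \<longlonglongrightarrow> 2 ^ CARD('d) * real CARD('d) * h\<^sup>2 * (\<Sum>i\<in>UNIV. (nL2 (wpd i u))\<^sup>2)
     + (\<Sum>k\<in>?I. (LINT x|M. indicator (cube h k) x * rep u x)\<^sup>2) / h ^ CARD('d)"
    using h
    by (intro tendsto_add tendsto_mult tendsto_const tendsto_sum tendsto_divide tendsto_power
        L2_norm_limit[OF uL(2) L[OF test_funs_pderiv[OF \<phi>(1)]] \<phi>(3)]
        L2_inner_limit[OF uL(1) L[OF \<phi>(1)] cube_sqint[OF h] \<phi>(2)]) auto
  show ?thesis by (rule LIMSEQ_le[OF l1 l2]) (use ineq in blast)
qed

text \<open>Green's formula \<open>\<integral> \<bar>\<partial>\<^sub>i u\<bar>\<^sup>2 = - \<integral> u \<partial>\<^sub>i\<partial>\<^sub>i u\<close>: the boundary term vanishes as \<open>u\<close> is a limit of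
  test functions. It bounds first derivatives by \<open>u\<close> and second derivatives, so that
  compactness in \<open>L\<^sub>2\<close> gives compactness in \<open>H\<^sup>1\<close> without any extension over the boundary.\<close>

lemma gradient_interpolation:
  assumes u: "u \<in> X"
  shows "(nL2 (wpd i u))\<^sup>2 \<le> nL2 u * nH2 u"
proof -
  have u': "u \<in> H10 \<Omega>" "u \<in> H2 \<Omega>" using u by auto
  obtain \<phi> where \<phi>: "\<And>n::nat. \<phi> n \<in> test_funs \<Omega>"
    "(\<lambda>n. nL2 (u - cls (\<phi> n))) \<longlonglongrightarrow> 0"
    "\<And>i. (\<lambda>n. nL2 (wpd i u - cls (pderiv_at i (\<phi> n)))) \<longlonglongrightarrow> 0"
    using H10_sequence[OF u'(1)] by blast
  note L = class_on_L2[OF test_sqint]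
  let ?g = "wpd i u" and ?h = "wpd i (wpd i u)"
  have g: "u \<in> L2 \<Omega>" "?g \<in> L2 \<Omega>" "?g \<in> H1 \<Omega>" using H2_H1[OF u'(2)] H1_L2 by blast+
  have hL: "?h \<in> L2 \<Omega>" "is_weak_pderiv \<Omega> i ?g ?h" using H1_weak_pderiv[OF g(3)] by auto
  have eq: "(LINT x|M. rep ?g x * rep (cls (pderiv_at i (\<phi> n))) x) = - (LINT x|M. rep ?h x * rep (cls (\<phi> n)) x)" for n
  proof -
    have *: "(LINT x|M. rep v x * rep (cls \<psi>) x) = (LINT x|M. rep v x * \<psi> x)" if "\<psi> \<in> test_funs \<Omega>" for v \<psi>
    proof -
      note [measurable] = test_measurable[OF that]
      show ?thesis
        by (rule integral_cong_AE) (use class_on_rep(1)[OF test_measurable[OF that]] in \<open>auto elim!: eventually_mono\<close>)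
    qed
    show ?thesis using hL(2) \<phi>(1) by (simp add: * test_funs_pderiv is_weak_pderiv_def)
  qed
  have "(\<lambda>n. LINT x|M. rep ?g x * rep (cls (pderiv_at i (\<phi> n))) x) \<longlonglongrightarrow> (LINT x|M. rep ?g x * rep ?g x)"
    by (rule L2_inner_limit[OF g(2) L[OF test_funs_pderiv[OF \<phi>(1)]] L2_sqint[OF g(2)] \<phi>(3)])
  moreover have "(\<lambda>n. - (LINT x|M. rep ?h x * rep (cls (\<phi> n)) x)) \<longlonglongrightarrow> - (LINT x|M. rep ?h x * rep u x)"
    by (intro tendsto_minus L2_inner_limit[OF g(1) L[OF \<phi>(1)] L2_sqint[OF hL(1)] \<phi>(2)])
  ultimately have "(LINT x|M. rep ?g x * rep ?g x) = - (LINT x|M. rep ?h x * rep u x)"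
    unfolding eq by (rule LIMSEQ_unique)
  then have "(nL2 ?g)\<^sup>2 = - (LINT x|M. rep ?h x * rep u x)"
    unfolding L2_norm_sq by (simp add: power2_eq_square)
  also have "\<dots> \<le> nL2 ?h * nL2 u"
    using Cauchy_Schwarz_integral[OF L2_sqint[OF hL(1)] L2_sqint[OF g(1)]] by (simp add: L2_norm_def)
  also have "\<dots> \<le> nH2 u * nL2 u"
    by (intro mult_right_mono L2_norm_le_H2 L2_norm_nonneg)
  finally show ?thesis by (simp add: mult.commute)
qed

text \<open>The form of Rellich's theorem that is needed: from a bounded sequence in \<open>H\<^sup>2 \<inter> H\<^sup>1\<^sub>0\<close> one can
  extract a subsequence whose members are \<open>\<epsilon>\<close>-close to each other in \<open>H\<^sup>1\<close>.\<close>

lemma H1_eps_close_subsequence: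
  assumes w: "\<And>n::nat. w n \<in> X" and w1: "\<And>n. nH2 (w n) \<le> 1" and \<epsilon>: "\<epsilon> > 0"
  obtains r :: "nat \<Rightarrow> nat" and n0 :: nat where "strict_mono r"
    "\<And>n. n \<ge> n0 \<Longrightarrow> (nL2 (w (r n) - w (r n0)))\<^sup>2 + (\<Sum>i\<in>UNIV. (nL2 (wpd i (w (r n) - w (r n0))))\<^sup>2) < \<epsilon>"
proof -
  define D where "D = real CARD('d)"
  have D: "D \<ge> 1" by (simp add: D_def Suc_le_eq)
  \<comment> \<open>\<open>\<delta>\<close> will bound the \<open>L\<^sub>2\<close> norm of the differences, whose \<open>H\<^sup>2\<close> norms are at most \<open>2\<close>; by
    Green's formula the squared gradients are then at most \<open>2 D \<delta>\<close>.\<close>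
  define \<delta> where "\<delta> = min 1 (\<epsilon> / (1 + 2 * D) / 2)"
  have \<delta>: "\<delta> > 0" "\<delta> \<le> 1" "\<delta> * (1 + 2 * D) < \<epsilon>"
  proof -
    show "\<delta> > 0" "\<delta> \<le> 1" using \<epsilon> D by (auto simp: \<delta>_def)
    have "\<delta> * (1 + 2 * D) \<le> \<epsilon> / (1 + 2 * D) / 2 * (1 + 2 * D)" using D by (intro mult_right_mono) (auto simp: \<delta>_def)
    also have "\<dots> < \<epsilon>" using D \<epsilon> by (simp add: field_simps add_pos_nonneg)
    finally show "\<delta> * (1 + 2 * D) < \<epsilon>" .
  qed
  define C where "C = 2 ^ CARD('d) * D * (4 * D)"
  have C: "C > 0" using D by (simp add: C_def)
  \<comment> \<open>The grid is so fine that the gradient term of the cube inequality is at most \<open>\<delta>\<^sup>2 / 2\<close>.\<close>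
  define h where "h = sqrt (\<delta>\<^sup>2 / (2 * C))"
  have h: "h > 0" "C * h\<^sup>2 = \<delta>\<^sup>2 / 2" using C \<delta> by (auto simp: h_def)
  let ?I = "cube_index h ` \<Omega>"
  have fin: "finite ?I" by (rule finite_cube_index[OF bounded_domain h(1)])
  define a where "a k n = (LINT x|M. indicator (cube h k) x * rep (w n) x)" for k n
  have wL: "w n \<in> L2 \<Omega>" for n using w[of n] H10_H1 H1_L2 by blast
  have "bounded (range (a k))" for k
  proof -
    have "norm (a k n) \<le> sqrt (LINT x|M. (indicator (cube h k) x)\<^sup>2) * 1" for n
    proof -
      have "\<bar>a k n\<bar> \<le> sqrt (LINT x|M. (indicator (cube h k) x)\<^sup>2) * nL2 (w n)"
        unfolding a_def using Cauchy_Schwarz_integral[OF cube_sqint[OF h(1)] L2_sqint[OF wL]] by (simp add: L2_norm_def)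
      also have "\<dots> \<le> sqrt (LINT x|M. (indicator (cube h k) x)\<^sup>2) * 1"
        using L2_norm_le_H2(1)[of "w n"] w1[of n] by (intro mult_left_mono) auto
      finally show ?thesis by simp
    qed
    then show ?thesis by (auto simp: bounded_iff)
  qed
  then obtain r :: "nat \<Rightarrow> nat" where r: "strict_mono r" "\<And>k. k \<in> ?I \<Longrightarrow> convergent (a k \<circ> r)"
    using finite_family_convergent_subsequence[OF fin, of a] by blast
  define c where "c = 1 + real (card ?I)"
  have c: "c > 0" "real (card ?I) < c" by (auto simp: c_def)
  define \<eta> where "\<eta> = \<delta>\<^sup>2 / 2 * h ^ CARD('d) / c"
  have \<eta>: "\<eta> > 0" using \<delta> h c by (simp add: \<eta>_def)
  have "\<forall>k\<in>?I. \<exists>N. \<forall>m\<ge>N. \<forall>n\<ge>N. (a k (r m) - a k (r n))\<^sup>2 < \<eta>"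
  proof
    fix k assume "k \<in> ?I"
    then have "Cauchy (a k \<circ> r)" using r(2) by (simp add: Cauchy_convergent_iff)
    then obtain N where N: "\<And>m n. m \<ge> N \<Longrightarrow> n \<ge> N \<Longrightarrow> norm (a k (r m) - a k (r n)) < sqrt \<eta>"
      using \<eta> unfolding Cauchy_iff o_def by (metis real_sqrt_gt_0_iff)
    have "(a k (r m) - a k (r n))\<^sup>2 < \<eta>" if "m \<ge> N" "n \<ge> N" for m n
    proof -
      have "\<bar>a k (r m) - a k (r n)\<bar>\<^sup>2 < (sqrt \<eta>)\<^sup>2" using N[OF that] by (intro power_strict_mono) auto
      then show ?thesis using \<eta> by simp
    qed
    then show "\<exists>N. \<forall>m\<ge>N. \<forall>n\<ge>N. (a k (r m) - a k (r n))\<^sup>2 < \<eta>" by blast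
  qed
  then obtain N where N: "\<And>k m n. k \<in> ?I \<Longrightarrow> m \<ge> N k \<Longrightarrow> n \<ge> N k \<Longrightarrow> (a k (r m) - a k (r n))\<^sup>2 < \<eta>" by metis
  define n0 where "n0 = Max (insert 0 (N ` ?I))"
  have n0: "N k \<le> n0" if "k \<in> ?I" for k using that fin by (auto simp: n0_def intro!: Max_ge)
  show ?thesis
  proof (rule that[OF r(1), of n0])
    fix n assume n: "n \<ge> n0"
    let ?u = "w (r n) - w (r n0)"
    have u: "?u \<in> X" by (intro X_diff w)
    have H2: "(nH2 ?u)\<^sup>2 \<le> 4"
    proof -
      have w2: "w m \<in> H2 \<Omega>" for m using w by auto
      have 1: "(nH2 (w m))\<^sup>2 \<le> 1" for m using w1[of m] H2_norm_nonneg by (intro power_le_one)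
      have 2: "(nH2 ((-1) *\<^sub>R w m))\<^sup>2 = (nH2 (w m))\<^sup>2" for m
        unfolding H2_norm_scale[OF w2] by simp
      have "(nH2 (w (r n) + (-1) *\<^sub>R w (r n0)))\<^sup>2 \<le> 4"
        using H2_norm_add_sq[OF w2 H2_scale[OF w2], of "r n" "-1" "r n0"] 1[of "r n"] 1[of "r n0"]
        unfolding 2 by linarith
      then show ?thesis by simp
    qed
    then have "(nH2 ?u)\<^sup>2 \<le> 2\<^sup>2" by simp
    then have H2': "nH2 ?u \<le> 2" by (rule power2_le_imp_le) simp
    have au: "(LINT x|M. indicator (cube h k) x * rep ?u x) = a k (r n) - a k (r n0)" for k
    proof -
      have [measurable]: "indicat_real (cube h k) \<in> borel_measurable M" using cube_sqint[OF h(1)] by (simp add: sqint_def)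
      have "(LINT x|M. indicator (cube h k) x * rep ?u x) = (LINT x|M. indicator (cube h k) x * rep (w (r n)) x - indicator (cube h k) x * rep (w (r n0)) x)"
      proof (rule integral_cong_AE)
        show "AE x in M. indicator (cube h k) x * rep ?u x = indicator (cube h k) x * rep (w (r n)) x - indicator (cube h k) x * rep (w (r n0)) x"
          using rep_diff[of "w (r n)" "w (r n0)"]
          by eventually_elim (simp add: right_diff_distrib)
      qed auto
      then show ?thesis unfolding a_def
        using sqint_mult_integrable[OF cube_sqint[OF h(1)] L2_sqint[OF wL]] by simp
    qed
    have g: "(\<Sum>i\<in>UNIV. (nL2 (wpd i ?u))\<^sup>2) \<le> D * (nL2 ?u * nH2 ?u)"
      using sum_bounded_above[of UNIV "\<lambda>i. (nL2 (wpd i ?u))\<^sup>2", OF gradient_interpolation[OF u]]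
      by (simp add: D_def)
    have g4: "(\<Sum>i\<in>UNIV. (nL2 (wpd i ?u))\<^sup>2) \<le> 4 * D"
    proof -
      have "(nL2 (wpd i ?u))\<^sup>2 \<le> 4" for i
        using power_mono[OF L2_norm_le_H2(2)[of i ?u] L2_norm_nonneg, of 2] H2 by linarith
      then show ?thesis using sum_bounded_above[of UNIV "\<lambda>i. (nL2 (wpd i ?u))\<^sup>2" 4] by (simp add: D_def)
    qed
    have "(nL2 ?u)\<^sup>2 \<le> 2 ^ CARD('d) * D * h\<^sup>2 * (4 * D) + (\<Sum>k\<in>?I. (a k (r n) - a k (r n0))\<^sup>2) / h ^ CARD('d)"
    proof -
      have "2 ^ CARD('d) * D * h\<^sup>2 * (\<Sum>i\<in>UNIV. (nL2 (wpd i ?u))\<^sup>2) \<le> 2 ^ CARD('d) * D * h\<^sup>2 * (4 * D)"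
        by (intro mult_left_mono g4) (use D in auto)
      moreover have "?u \<in> H10 \<Omega>" using u by auto
      ultimately show ?thesis using cube_inequality[of ?u h] h(1) unfolding au D_def by linarith
    qed
    also have "2 ^ CARD('d) * D * h\<^sup>2 * (4 * D) = \<delta>\<^sup>2 / 2" using h(2) by (simp add: C_def mult_ac)
    also have "(\<Sum>k\<in>?I. (a k (r n) - a k (r n0))\<^sup>2) / h ^ CARD('d) \<le> real (card ?I) * \<eta> / h ^ CARD('d)"
    proof (intro divide_right_mono sum_bounded_above)
      show "(a k (r n) - a k (r n0))\<^sup>2 \<le> \<eta>" if "k \<in> ?I" for k
        using N[OF that, of n n0] n0[OF that] n by auto
    qed (use h in auto)
    also have "real (card ?I) * \<eta> / h ^ CARD('d) < \<delta>\<^sup>2 / 2"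
    proof -
      have "real (card ?I) * \<eta> < c * \<eta>" using \<eta> c by simp
      also have "\<dots> = \<delta>\<^sup>2 / 2 * h ^ CARD('d)" using c by (simp add: \<eta>_def)
      finally show ?thesis using h(1) by (simp add: divide_simps)
    qed
    finally have L: "(nL2 ?u)\<^sup>2 < \<delta>\<^sup>2" by simp
    then have L': "nL2 ?u < \<delta>" using \<delta> by (simp add: power_less_imp_less_base)
    have "(\<Sum>i\<in>UNIV. (nL2 (wpd i ?u))\<^sup>2) \<le> D * (\<delta> * 2)"
    proof -
      have "nL2 ?u * nH2 ?u \<le> \<delta> * 2"
        by (rule mult_mono) (use L' H2' \<delta> H2_norm_nonneg in auto)
      then have "D * (nL2 ?u * nH2 ?u) \<le> D * (\<delta> * 2)"
        by (rule mult_left_mono) (use D in simp)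
      with g show ?thesis by (rule order_trans)
    qed
    moreover have "\<delta>\<^sup>2 \<le> \<delta>" using \<delta> by (simp add: power2_eq_square mult_left_le)
    ultimately have "(nL2 ?u)\<^sup>2 + (\<Sum>i\<in>UNIV. (nL2 (wpd i ?u))\<^sup>2) < \<delta> * (1 + 2 * D)"
      using L by (simp add: algebra_simps)
    then show "(nL2 ?u)\<^sup>2 + (\<Sum>i\<in>UNIV. (nL2 (wpd i ?u))\<^sup>2) < \<epsilon>"
      using \<delta>(3) by linarith
  qed
qed

end

context bounded_domain
begin

text \<open>The pointwise density of the squared \<open>H\<^sup>1\<close> norm. Multipliers act on it, while the norm itself only sees
  its integral.\<close>

definition H1_density :: "'d ae_fun \<Rightarrow> real^'d \<Rightarrow> real" where
  "H1_density v x = (rep v x)\<^sup>2 + (\<Sum>i\<in>UNIV. (rep (wpd i v) x)\<^sup>2)"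

lemma H1_density_nonneg: "H1_density v x \<ge> 0"
  by (simp add: H1_density_def sum_nonneg)

lemma H1_density_measurable[measurable]: "H1_density v \<in> borel_measurable M"
  unfolding H1_density_def by measurable

lemma H1_density_integral:
  assumes "v \<in> H1 \<Omega>"
  shows "integrable M (H1_density v)"
    "(LINT x|M. H1_density v x) = (nL2 v)\<^sup>2 + (\<Sum>i\<in>UNIV. (nL2 (wpd i v))\<^sup>2)"
proof -
  have i: "integrable M (\<lambda>x. (rep v x)\<^sup>2)" "integrable M (\<lambda>x. (rep (wpd i v) x)\<^sup>2)" for i
    using assms H1_L2 H1_weak_pderiv(1) L2_sqint sqint_integrable_square by blast+
  then show "integrable M (H1_density v)"
    "(LINT x|M. H1_density v x) = (nL2 v)\<^sup>2 + (\<Sum>i\<in>UNIV. (nL2 (wpd i v))\<^sup>2)"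
    unfolding H1_density_def L2_norm_sq by simp_all
qed

text \<open>Pointwise form of the triangle inequality, for use under a multiplier.\<close>

lemma H1_density_triangle:
  assumes "u \<in> H1 \<Omega>" "v \<in> H1 \<Omega>"
  shows "AE x in M. H1_density u x \<le> 2 * H1_density (u - v) x + 2 * H1_density v x"
proof -
  have "AE x in M. \<forall>i\<in>UNIV. rep (wpd i (u - v)) x = rep (wpd i u) x - rep (wpd i v) x"
    unfolding H1_diff(2)[OF assms] by (rule AE_finite_allI) (auto intro: rep_diff)
  with rep_diff[of u v] show ?thesis
  proof eventually_elim
    case (elim x)
    have sq: "a\<^sup>2 \<le> 2 * (a - b)\<^sup>2 + 2 * b\<^sup>2" for a b :: real
    proof -
      have "0 \<le> (a - 2 * b)\<^sup>2" by simp
      then show ?thesis by (simp add: power2_diff)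
    qed
    have "H1_density u x \<le> (2 * (rep (u - v) x)\<^sup>2 + 2 * (rep v x)\<^sup>2)
       + (\<Sum>i\<in>UNIV. 2 * (rep (wpd i (u - v)) x)\<^sup>2 + 2 * (rep (wpd i v) x)\<^sup>2)"
      unfolding H1_density_def using elim by (intro add_mono sum_mono) (simp_all add: sq)
    then show ?case by (simp add: H1_density_def sum.distrib sum_distrib_left distrib_left)
  qed
qed

text \<open>Multipliers that are bounded and tend to \<open>0\<close> almost everywhere act compactly on first order terms:
  the \<open>w n\<close> are close in \<open>H\<^sup>1\<close> to one fixed function, for which dominated convergence applies.\<close>

lemma vanishing_multiplier:
  assumes w: "\<And>n::nat. w n \<in> X" and w1: "\<And>n. nH2 (w n) \<le> 1"
    and \<beta>m: "\<And>n. \<beta> n \<in> borel_measurable M"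
    and \<beta>K: "\<And>n. AE x in M. \<bar>\<beta> n x\<bar> \<le> K"
    and \<beta>0: "AE x in M. (\<lambda>n. \<beta> n x) \<longlonglongrightarrow> 0" and \<epsilon>: "\<epsilon> > 0"
  shows "\<exists>n. (LINT x|M. (\<beta> n x)\<^sup>2 * H1_density (w n) x) < \<epsilon>"
proof -
  note [measurable] = \<beta>m
  have wH1: "w n \<in> H1 \<Omega>" for n using w[of n] H10_H1 by blast
  \<comment> \<open>The multiplier may enlarge the squared \<open>H\<^sup>1\<close> distance to the fixed function by \<open>K\<^sup>2\<close>.\<close>
  define \<epsilon>1 where "\<epsilon>1 = \<epsilon> / (4 * (K\<^sup>2 + 1))"
  have K1: "K\<^sup>2 + 1 > 0" by (simp add: add_nonneg_pos)
  have \<epsilon>1: "\<epsilon>1 > 0" "2 * (K\<^sup>2 * \<epsilon>1) < \<epsilon> / 2"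
  proof -
    show e: "\<epsilon>1 > 0" using \<epsilon> K1 by (simp add: \<epsilon>1_def)
    have "K\<^sup>2 * \<epsilon>1 < (K\<^sup>2 + 1) * \<epsilon>1" using e by (intro mult_strict_right_mono) auto
    also have "\<dots> = \<epsilon> / 4"
    proof -
      have "L * (\<epsilon> / (4 * L)) = \<epsilon> / 4" if "L > 0" for L using that by simp
      from this[OF K1] show ?thesis unfolding \<epsilon>1_def .
    qed
    finally show "2 * (K\<^sup>2 * \<epsilon>1) < \<epsilon> / 2" by simp
  qed
  obtain r n0 where r: "strict_mono (r :: nat \<Rightarrow> nat)"
    "\<And>n. n \<ge> n0 \<Longrightarrow> (nL2 (w (r n) - w (r n0)))\<^sup>2 + (\<Sum>i\<in>UNIV. (nL2 (wpd i (w (r n) - w (r n0))))\<^sup>2) < \<epsilon>1"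
    using H1_eps_close_subsequence[of w \<epsilon>1, OF w w1 \<epsilon>1(1)] by blast
  let ?v = "w (r n0)"
  have \<beta>K2: "AE x in M. (\<beta> n x)\<^sup>2 \<le> K\<^sup>2" for n
    using \<beta>K[of n]
  proof eventually_elim
    case (elim x)
    then have "\<bar>\<beta> n x\<bar>\<^sup>2 \<le> K\<^sup>2" by (intro power_mono) auto
    then show ?case by simp
  qed
  have int: "integrable M (\<lambda>x. (\<beta> n x)\<^sup>2 * H1_density u x)" if "u \<in> H1 \<Omega>" for n u
  proof (rule Bochner_Integration.integrable_bound)
    show "integrable M (\<lambda>x. K\<^sup>2 * H1_density u x)" using H1_density_integral(1)[OF that] by simp
    show "AE x in M. norm ((\<beta> n x)\<^sup>2 * H1_density u x) \<le> norm (K\<^sup>2 * H1_density u x)"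
      using \<beta>K2[of n] by eventually_elim (auto simp: abs_mult intro!: mult_right_mono)
  qed measurable
  have "(\<lambda>n. LINT x|M. (\<beta> (r n) x)\<^sup>2 * H1_density ?v x) \<longlonglongrightarrow> (LINT x|M. 0)"
  proof (rule integral_dominated_convergence[where w = "\<lambda>x. K\<^sup>2 * H1_density ?v x"])
    show "integrable M (\<lambda>x. K\<^sup>2 * H1_density ?v x)" using H1_density_integral(1)[OF wH1] by simp
    show "AE x in M. (\<lambda>n. (\<beta> (r n) x)\<^sup>2 * H1_density ?v x) \<longlonglongrightarrow> 0"
      using \<beta>0
    proof eventually_elim
      case (elim x)
      have "(\<lambda>n. \<beta> (r n) x) \<longlonglongrightarrow> 0" using LIMSEQ_subseq_LIMSEQ[OF elim r(1)] by (simp add: o_def)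
      then have "(\<lambda>n. (\<beta> (r n) x)\<^sup>2 * H1_density ?v x) \<longlonglongrightarrow> 0\<^sup>2 * H1_density ?v x"
        by (intro tendsto_intros)
      then show ?case by simp
    qed
    show "AE x in M. norm ((\<beta> (r n) x)\<^sup>2 * H1_density ?v x) \<le> K\<^sup>2 * H1_density ?v x" for n
      using \<beta>K2[of "r n"] by eventually_elim (auto simp: abs_mult H1_density_nonneg intro!: mult_right_mono)
  qed auto
  then have "(\<lambda>n. LINT x|M. (\<beta> (r n) x)\<^sup>2 * H1_density ?v x) \<longlonglongrightarrow> 0" by simp
  then have "eventually (\<lambda>n. (LINT x|M. (\<beta> (r n) x)\<^sup>2 * H1_density ?v x) < \<epsilon> / 8) sequentially"
    using \<epsilon> by (intro order_tendstoD(2)) auto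
  then obtain n1 where n1: "\<And>n. n \<ge> n1 \<Longrightarrow> (LINT x|M. (\<beta> (r n) x)\<^sup>2 * H1_density ?v x) < \<epsilon> / 8"
    by (auto simp: eventually_sequentially)
  define n where "n = max n0 n1"
  have d: "w (r n) - ?v \<in> H1 \<Omega>" by (intro H1_diff wH1)
  have "(LINT x|M. (\<beta> (r n) x)\<^sup>2 * H1_density (w (r n)) x)
     \<le> (LINT x|M. 2 * (K\<^sup>2 * H1_density (w (r n) - ?v) x) + 2 * ((\<beta> (r n) x)\<^sup>2 * H1_density ?v x))"
  proof (rule integral_mono_AE)
    show "AE x in M. (\<beta> (r n) x)\<^sup>2 * H1_density (w (r n)) x
        \<le> 2 * (K\<^sup>2 * H1_density (w (r n) - ?v) x) + 2 * ((\<beta> (r n) x)\<^sup>2 * H1_density ?v x)"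
      using H1_density_triangle[OF wH1 wH1, of "r n" "r n0"] \<beta>K2[of "r n"]
    proof eventually_elim
      case (elim x)
      have "(\<beta> (r n) x)\<^sup>2 * H1_density (w (r n)) x \<le> (\<beta> (r n) x)\<^sup>2 * (2 * H1_density (w (r n) - ?v) x + 2 * H1_density ?v x)"
        using elim by (intro mult_left_mono) auto
      moreover have "(\<beta> (r n) x)\<^sup>2 * H1_density (w (r n) - ?v) x \<le> K\<^sup>2 * H1_density (w (r n) - ?v) x"
        using elim by (intro mult_right_mono H1_density_nonneg)
      ultimately show ?case by (simp add: distrib_left)
    qed
    show "integrable M (\<lambda>x. 2 * (K\<^sup>2 * H1_density (w (r n) - ?v) x) + 2 * ((\<beta> (r n) x)\<^sup>2 * H1_density ?v x))"
      using H1_density_integral(1)[OF d] int[OF wH1] by simp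
  qed (rule int[OF wH1])
  also have "\<dots> = 2 * (K\<^sup>2 * (LINT x|M. H1_density (w (r n) - ?v) x)) + 2 * (LINT x|M. (\<beta> (r n) x)\<^sup>2 * H1_density ?v x)"
    using H1_density_integral(1)[OF d] int[OF wH1] by simp
  also have "\<dots> \<le> 2 * (K\<^sup>2 * \<epsilon>1) + 2 * (\<epsilon> / 8)"
    using r(2)[of n] n1[of n] unfolding H1_density_integral(2)[OF d] n_def[symmetric]
    by (intro add_mono mult_left_mono) (auto simp: n_def)
  also have "\<dots> < \<epsilon>" using \<epsilon>1(2) \<epsilon> by linarith
  finally show ?thesis by blast
qed

end

section \<open>Measurable selection\<close>

text \<open>The type of policies is a compact metric space, and all measurability arguments on it go through
  a fixed dense sequence \<open>s\<close>.\<close>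

locale compact_space =
  fixes s :: "nat \<Rightarrow> 'a::metric_space"
  assumes compact_UNIV: "compact (UNIV :: 'a set)"
    and dense_sequence: "\<And>\<alpha> e. e > 0 \<Longrightarrow> \<exists>n. dist (s n) \<alpha> < e"

lemma compact_space_exists:
  assumes "compact (UNIV :: 'a::metric_space set)"
  shows "\<exists>s :: nat \<Rightarrow> 'a. compact_space s"
proof -
  have "\<forall>n::nat. \<exists>k :: 'a set. finite k \<and> UNIV \<subseteq> (\<Union>x\<in>k. ball x (1 / real (Suc n)))"
  proof
    fix n :: nat
    have "(0::real) < 1 / real (Suc n)" by simp
    then show "\<exists>k :: 'a set. finite k \<and> UNIV \<subseteq> (\<Union>x\<in>k. ball x (1 / real (Suc n)))"
      using seq_compact_imp_totally_bounded[of "UNIV :: 'a set"] assms compact_imp_seq_compact by blast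
  qed
  then obtain k :: "nat \<Rightarrow> 'a set" where k: "\<And>n. finite (k n)" "\<And>n. UNIV \<subseteq> (\<Union>x\<in>k n. ball x (1 / real (Suc n)))"
    by metis
  let ?S = "\<Union>n. k n"
  have c: "countable ?S" using k(1) by (auto intro: countable_finite)
  have "compact_space (from_nat_into ?S)"
  proof
    fix \<alpha> :: 'a and e :: real assume "e > 0"
    then obtain n where n: "inverse (real (Suc n)) < e" using reals_Archimedean by blast
    have "\<alpha> \<in> (\<Union>x\<in>k n. ball x (1 / real (Suc n)))" using k(2)[of n] by blast
    then obtain x where x: "x \<in> k n" "dist x \<alpha> < 1 / real (Suc n)" by (auto simp del: of_nat_Suc)
    then obtain i where "from_nat_into ?S i = x" using from_nat_into_surj[OF c, of x] by blast
    then show "\<exists>i. dist (from_nat_into ?S i) \<alpha> < e" using x n by (intro exI[of _ i]) (auto simp: inverse_eq_divide)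
  qed (rule assms)
  then show ?thesis by blast
qed

definition caratheodory :: "'x measure \<Rightarrow> ('x \<Rightarrow> 'a::metric_space \<Rightarrow> real) \<Rightarrow> bool" where
  "caratheodory M g \<longleftrightarrow> (\<forall>\<alpha>. (\<lambda>x. g x \<alpha>) \<in> borel_measurable M) \<and> (\<forall>x. continuous_on UNIV (g x))"

context compact_space
begin

text \<open>Every open set is a union of balls around members of \<open>s\<close> with radii \<open>1 / (m + 1)\<close>.\<close>

lemma borel_measurable_if_dist:
  assumes "\<And>n. (\<lambda>x. dist (s n) (f x)) \<in> borel_measurable M"
  shows "f \<in> borel_measurable M"
proof (rule borel_measurableI)
  fix U :: "'a set" assume U: "open U"
  let ?I = "{(n, m). ball (s n) (1 / real (Suc m)) \<subseteq> U}"
  have "U = (\<Union>(n, m)\<in>?I. ball (s n) (1 / real (Suc m)))"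
  proof (intro set_eqI iffI)
    fix \<alpha> assume "\<alpha> \<in> U"
    then obtain e where e: "e > 0" "ball \<alpha> e \<subseteq> U" using U openE by blast
    then obtain m where m: "inverse (real (Suc m)) < e / 2" using reals_Archimedean[of "e / 2"] by auto
    obtain n where n: "dist (s n) \<alpha> < 1 / real (Suc m)" using dense_sequence[of "1 / real (Suc m)" \<alpha>] by auto
    have "ball (s n) (1 / real (Suc m)) \<subseteq> ball \<alpha> e"
    proof
      fix \<beta> assume "\<beta> \<in> ball (s n) (1 / real (Suc m))"
      then have "dist (s n) \<beta> < 1 / real (Suc m)" by simp
      then have "dist \<alpha> \<beta> < e" using n m dist_triangle[of \<alpha> \<beta> "s n"] by (simp add: inverse_eq_divide dist_commute)
      then show "\<beta> \<in> ball \<alpha> e" by simp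
    qed
    then show "\<alpha> \<in> (\<Union>(n, m)\<in>?I. ball (s n) (1 / real (Suc m)))" using n e by auto
  qed auto
  moreover have "f -` (\<Union>(n, m)\<in>?I. ball (s n) (1 / real (Suc m))) \<inter> space M
      = (\<Union>(n, m)\<in>?I. {x \<in> space M. dist (s n) (f x) < 1 / real (Suc m)})"
    by (simp add: set_eq_iff split_beta del: of_nat_Suc) blast
  ultimately have "f -` U \<inter> space M = (\<Union>(n, m)\<in>?I. {x \<in> space M. dist (s n) (f x) < 1 / real (Suc m)})"
    by simp
  also have "\<dots> \<in> sets M"
    using assms by (intro sets.countable_UN'') (auto intro!: borel_measurable_less)
  finally show "f -` U \<inter> space M \<in> sets M" .
qed

text \<open>Approximate \<open>q\<close> by functions with values in the range of \<open>s\<close>, taking the first member of \<open>s\<close> within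
  distance \<open>1 / (m + 1)\<close> of \<open>q x\<close>.\<close>

lemma caratheodory_compose:
  fixes g :: "'x \<Rightarrow> 'a \<Rightarrow> real"
  assumes g: "caratheodory M g" and q: "q \<in> borel_measurable M"
  shows "(\<lambda>x. g x (q x)) \<in> borel_measurable M"
proof -
  define k where "k m x = (LEAST n. dist (s n) (q x) < 1 / real (Suc m))" for m x
  have km: "k m \<in> measurable M (count_space UNIV)" for m
    unfolding k_def
  proof (rule measurable_Least)
    fix n
    have "(\<lambda>x. dist (s n) (q x)) \<in> borel_measurable M"
      by (rule measurable_compose[OF q], rule borel_measurable_continuous_onI) (intro continuous_intros)
    then show "Measurable.pred M (\<lambda>x. dist (s n) (q x) < 1 / real (Suc m))" by measurable
  qed
  have kd: "dist (s (k m x)) (q x) < 1 / real (Suc m)" for m x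
    unfolding k_def by (rule LeastI_ex) (rule dense_sequence, simp)
  have lim: "(\<lambda>m. s (k m x)) \<longlonglongrightarrow> q x" for x
  proof (rule metric_LIMSEQ_I)
    fix r :: real assume "r > 0"
    then obtain N where N: "inverse (real (Suc N)) < r" using reals_Archimedean by blast
    have "dist (s (k m x)) (q x) < r" if "m \<ge> N" for m
    proof -
      have "1 / real (Suc m) \<le> inverse (real (Suc N))" using that by (simp add: field_simps)
      then show ?thesis using kd[of m x] N by linarith
    qed
    then show "\<exists>N. \<forall>m\<ge>N. dist (s (k m x)) (q x) < r" by blast
  qed
  show ?thesis
  proof (rule borel_measurable_LIMSEQ_real)
    show "(\<lambda>x. g x (s (k m x))) \<in> borel_measurable M" for m
      by (rule measurable_compose_countable[OF _ km]) (use g in \<open>auto simp: caratheodory_def\<close>)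
    show "(\<lambda>m. g x (s (k m x))) \<longlonglongrightarrow> g x (q x)" for x
    proof -
      have "isCont (g x) (q x)" using g by (simp add: caratheodory_def continuous_on_eq_continuous_at)
      then show ?thesis using lim isCont_tendsto_compose by blast
    qed
  qed
qed

lemma convergent_subsequence:
  fixes a :: "nat \<Rightarrow> 'a"
  obtains l r where "strict_mono (r :: nat \<Rightarrow> nat)" "(a \<circ> r) \<longlonglongrightarrow> l"
  using compact_UNIV unfolding compact_def by blast

text \<open>A compact-valued measurable multifunction is represented as the zero set \<open>{\<alpha>. G x \<alpha> = 0}\<close> of a
  nonnegative Caratheodory function \<open>G\<close>. Minimising another Caratheodory function over it gives
  a multifunction of the same kind.\<close>

definition multifunction :: "'x measure \<Rightarrow> ('x \<Rightarrow> 'a \<Rightarrow> real) \<Rightarrow> bool" where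
  "multifunction M G \<longleftrightarrow> caratheodory M G \<and> (\<forall>x \<alpha>. 0 \<le> G x \<alpha>) \<and> (\<forall>x. \<exists>\<alpha>. G x \<alpha> = 0)"

definition min_over :: "('x \<Rightarrow> 'a \<Rightarrow> real) \<Rightarrow> ('x \<Rightarrow> 'a \<Rightarrow> real) \<Rightarrow> 'x \<Rightarrow> real" where
  "min_over G h x = Inf (h x ` {\<alpha>. G x \<alpha> = 0})"

text \<open>The zero set of \<open>refine_by G h x\<close> consists of the minimisers of \<open>h x\<close> over the zero set of \<open>G x\<close>.\<close>

definition refine_by :: "('x \<Rightarrow> 'a \<Rightarrow> real) \<Rightarrow> ('x \<Rightarrow> 'a \<Rightarrow> real) \<Rightarrow> 'x \<Rightarrow> 'a \<Rightarrow> real" where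
  "refine_by G h x \<alpha> = max (G x \<alpha>) \<bar>h x \<alpha> - min_over G h x\<bar>"

lemma min_over_attained:
  fixes G h :: "'x \<Rightarrow> 'a \<Rightarrow> real"
  assumes G: "multifunction M G" and h: "caratheodory M h"
  shows "\<exists>\<alpha>. G x \<alpha> = 0 \<and> h x \<alpha> = min_over G h x" "\<And>\<beta>. G x \<beta> = 0 \<Longrightarrow> min_over G h x \<le> h x \<beta>"
proof -
  let ?Z = "{\<alpha>. G x \<alpha> = 0}"
  have "closed ?Z"
    using G by (intro closed_Collect_eq continuous_on_const) (auto simp: multifunction_def caratheodory_def)
  then have "compact ?Z" using compact_UNIV compact_Int_closed[of UNIV ?Z] by simp
  moreover have "?Z \<noteq> {}" using G by (auto simp: multifunction_def)
  moreover have "continuous_on ?Z (h x)"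
    using h continuous_on_subset[of UNIV "h x" ?Z] by (auto simp: caratheodory_def)
  ultimately obtain \<alpha> where \<alpha>: "G x \<alpha> = 0" "\<And>\<beta>. G x \<beta> = 0 \<Longrightarrow> h x \<alpha> \<le> h x \<beta>"
    using continuous_attains_inf[of ?Z "h x"] by auto
  then have "min_over G h x = h x \<alpha>" unfolding min_over_def by (intro cInf_eq_minimum) auto
  with \<alpha> show "\<exists>\<alpha>. G x \<alpha> = 0 \<and> h x \<alpha> = min_over G h x" "\<And>\<beta>. G x \<beta> = 0 \<Longrightarrow> min_over G h x \<le> h x \<beta>" by auto
qed

text \<open>By compactness, the minimum is at most \<open>a\<close> if and only if there are members of \<open>s\<close> that approximately
  satisfy both \<open>G x \<alpha> = 0\<close> and \<open>h x \<alpha> \<le> a\<close>; this is a countable condition.\<close>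

lemma min_over_measurable:
  assumes G: "multifunction M G" and h: "caratheodory M h"
  shows "min_over G h \<in> borel_measurable M"
  unfolding borel_measurable_iff_le
proof
  fix a
  have cont: "isCont (G x) \<alpha>" "isCont (h x) \<alpha>" for x \<alpha>
    using G h by (auto simp: multifunction_def caratheodory_def continuous_on_eq_continuous_at)
  have iff: "min_over G h x \<le> a \<longleftrightarrow> (\<forall>n. \<exists>k. G x (s k) < 1 / real (Suc n) \<and> h x (s k) < a + 1 / real (Suc n))" (is "_ \<longleftrightarrow> ?R") for x
  proof
    assume L: "min_over G h x \<le> a"
    obtain \<alpha> where \<alpha>: "G x \<alpha> = 0" "h x \<alpha> = min_over G h x" using min_over_attained(1)[OF G h] by blast
    show ?R
    proof
      fix n :: nat
      have "eventually (\<lambda>\<beta>. G x \<beta> < 1 / real (Suc n)) (nhds \<alpha>)" "eventually (\<lambda>\<beta>. h x \<beta> < a + 1 / real (Suc n)) (nhds \<alpha>)"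
      proof -
        have "(0::real) < 1 / real (Suc n)" by simp
        then have "G x \<alpha> < 1 / real (Suc n)" "h x \<alpha> < a + 1 / real (Suc n)" using \<alpha> L by linarith+
        then show "eventually (\<lambda>\<beta>. G x \<beta> < 1 / real (Suc n)) (nhds \<alpha>)" "eventually (\<lambda>\<beta>. h x \<beta> < a + 1 / real (Suc n)) (nhds \<alpha>)"
          using cont[unfolded continuous_at_imp_continuous_at_within isCont_def tendsto_at_iff_tendsto_nhds]
          by (auto intro!: order_tendstoD(2)[where f = "G x"] order_tendstoD(2)[where f = "h x"])
      qed
      then have "eventually (\<lambda>\<beta>. G x \<beta> < 1 / real (Suc n) \<and> h x \<beta> < a + 1 / real (Suc n)) (nhds \<alpha>)"
        by (rule eventually_conj)
      then obtain e where "e > 0" "\<And>\<beta>. dist \<beta> \<alpha> < e \<Longrightarrow> G x \<beta> < 1 / real (Suc n) \<and> h x \<beta> < a + 1 / real (Suc n)"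
        unfolding eventually_nhds_metric by blast
      then show "\<exists>k. G x (s k) < 1 / real (Suc n) \<and> h x (s k) < a + 1 / real (Suc n)"
        using dense_sequence[of e \<alpha>] by blast
    qed
  next
    assume ?R
    then obtain k where k: "\<And>n. G x (s (k n)) < 1 / real (Suc n)" "\<And>n. h x (s (k n)) < a + 1 / real (Suc n)" by metis
    obtain l r where r: "strict_mono (r :: nat \<Rightarrow> nat)" "((\<lambda>n. s (k n)) \<circ> r) \<longlonglongrightarrow> l"
      by (rule convergent_subsequence)
    have z: "(\<lambda>n. 1 / real (Suc (r n))) \<longlonglongrightarrow> 0"
      using LIMSEQ_subseq_LIMSEQ[OF LIMSEQ_inverse_real_of_nat r(1)] by (simp add: o_def inverse_eq_divide)
    have c: "(\<lambda>n. G x (s (k (r n)))) \<longlonglongrightarrow> G x l" "(\<lambda>n. h x (s (k (r n)))) \<longlonglongrightarrow> h x l"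
      using r(2) isCont_tendsto_compose[OF cont(1)] isCont_tendsto_compose[OF cont(2)] by (auto simp: o_def)
    have "G x l \<le> 0" by (rule LIMSEQ_le[OF c(1) z]) (use k(1) less_imp_le in blast)
    then have "G x l = 0" using G by (auto simp: multifunction_def intro: antisym)
    moreover have "h x l \<le> a + 0"
      by (rule LIMSEQ_le[OF c(2) tendsto_add[OF tendsto_const z]]) (use k(2) less_imp_le in blast)
    ultimately show "min_over G h x \<le> a" using min_over_attained(2)[OF G h, of x l] by simp
  qed
  have [measurable]: "(\<lambda>x. G x \<alpha>) \<in> borel_measurable M" "(\<lambda>x. h x \<alpha>) \<in> borel_measurable M" for \<alpha>
    using G h by (auto simp: multifunction_def caratheodory_def)
  show "{x \<in> space M. min_over G h x \<le> a} \<in> sets M" unfolding iff by measurable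
qed

lemma refine_by_zero:
  assumes "multifunction M G"
  shows "refine_by G h x \<alpha> = 0 \<longleftrightarrow> G x \<alpha> = 0 \<and> h x \<alpha> = min_over G h x"
proof -
  have "max a \<bar>b\<bar> = 0 \<longleftrightarrow> a = 0 \<and> b = 0" if "a \<ge> 0" for a b :: real
    using that by (auto simp: max_def)
  then show ?thesis using assms by (simp add: refine_by_def multifunction_def)
qed

lemma refine_by_multifunction:
  assumes G: "multifunction M G" and h: "caratheodory M h"
  shows "multifunction M (refine_by G h)"
proof -
  have "caratheodory M (refine_by G h)"
    unfolding caratheodory_def
  proof (intro conjI allI)
    have [measurable]: "(\<lambda>x. G x \<alpha>) \<in> borel_measurable M" "(\<lambda>x. h x \<alpha>) \<in> borel_measurable M" for \<alpha>
      using G h by (auto simp: multifunction_def caratheodory_def)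
    note [measurable] = min_over_measurable[OF G h]
    show "(\<lambda>x. refine_by G h x \<alpha>) \<in> borel_measurable M" for \<alpha>
      unfolding refine_by_def by measurable
    show "continuous_on UNIV (refine_by G h x)" for x
      unfolding refine_by_def using G h
      by (intro continuous_on_max continuous_intros) (auto simp: multifunction_def caratheodory_def)
  qed
  moreover have "\<exists>\<alpha>. refine_by G h x \<alpha> = 0" for x
    unfolding refine_by_zero[OF G] by (rule min_over_attained(1)[OF G h])
  moreover have "0 \<le> refine_by G h x \<alpha>" for x \<alpha> by (simp add: refine_by_def le_max_iff_disj)
  ultimately show ?thesis by (simp add: multifunction_def)
qed

text \<open>Minimising successively \<open>- g\<close>, \<open>d\<close> and all distances \<open>dist (s n)\<close> leaves a single point, which
  therefore depends measurably on \<open>x\<close>.\<close>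

theorem measurable_argmax_selection:
  fixes g d :: "'x \<Rightarrow> 'a \<Rightarrow> real"
  assumes g: "caratheodory M g" and d: "caratheodory M d"
  obtains q where "q \<in> borel_measurable M" "\<And>x. q x \<in> Argmax (g x)"
    "\<And>x \<beta>. \<beta> \<in> Argmax (g x) \<Longrightarrow> d x (q x) \<le> d x \<beta>"
proof -
  \<comment> \<open>Minimising \<open>- g\<close> leaves the maximisers of \<open>g\<close>.\<close>
  define h where "h n = (case n of 0 \<Rightarrow> (\<lambda>x \<alpha>. - g x \<alpha>) | Suc 0 \<Rightarrow> d | Suc (Suc k) \<Rightarrow> (\<lambda>x \<alpha>. dist (s k) \<alpha>))" for n
  have h: "caratheodory M (h n)" for n
    using g d by (auto simp: h_def caratheodory_def split: nat.split intro!: continuous_intros)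
  define G where "G = rec_nat (\<lambda>x \<alpha>. 0) (\<lambda>n G. refine_by G (h n))"
  have G0: "G 0 = (\<lambda>x \<alpha>. 0)" and GS: "G (Suc n) = refine_by (G n) (h n)" for n by (simp_all add: G_def)
  have mf: "multifunction M (G n)" for n
  proof (induction n)
    case 0 show ?case by (simp add: G0 multifunction_def caratheodory_def)
  next
    case (Suc n) then show ?case unfolding GS by (rule refine_by_multifunction[OF _ h])
  qed
  have zero_Suc: "G (Suc n) x \<alpha> = 0 \<longleftrightarrow> G n x \<alpha> = 0 \<and> h n x \<alpha> = min_over (G n) (h n) x" for n x \<alpha>
    unfolding GS by (rule refine_by_zero[OF mf])
  have mono: "G n x \<alpha> = 0" if "G m x \<alpha> = 0" "n \<le> m" for n m x \<alpha>
    using that(2,1) by (induction rule: dec_induct) (auto simp: zero_Suc)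
  \<comment> \<open>The zero sets are decreasing, compact and nonempty.\<close>
  have "\<exists>\<alpha>. \<forall>n. G n x \<alpha> = 0" for x
  proof -
    have "\<forall>n. \<exists>\<alpha>. G n x \<alpha> = 0" using mf by (auto simp: multifunction_def)
    then obtain a where a: "\<And>n. G n x (a n) = 0" by metis
    obtain l r where r: "strict_mono (r :: nat \<Rightarrow> nat)" "(a \<circ> r) \<longlonglongrightarrow> l" by (rule convergent_subsequence)
    have "G n x l = 0" for n
    proof -
      have "isCont (G n x) l" using mf[of n] by (auto simp: multifunction_def caratheodory_def continuous_on_eq_continuous_at)
      then have "(\<lambda>k. G n x (a (r k))) \<longlonglongrightarrow> G n x l" using r(2) isCont_tendsto_compose by (fastforce simp: o_def)
      moreover have "eventually (\<lambda>k. G n x (a (r k)) = 0) sequentially"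
        using eventually_ge_at_top[of n]
        by eventually_elim (use a mono seq_suble[OF r(1)] in \<open>meson order_trans\<close>)
      ultimately have "(\<lambda>k. 0) \<longlonglongrightarrow> G n x l" by (rule Lim_transform_eventually)
      then show ?thesis by (simp add: LIMSEQ_const_iff)
    qed
    then show ?thesis by blast
  qed
  then obtain q where q: "\<And>x n. G n x (q x) = 0" by metis
  have val: "h n x (q x) = min_over (G n) (h n) x" for n x using q[of "Suc n" x] zero_Suc by blast
  have att: "G n x \<beta> = 0 \<Longrightarrow> min_over (G n) (h n) x \<le> h n x \<beta>" for n x \<beta>
    by (rule min_over_attained(2)[OF mf h])
  show ?thesis
  proof (rule that)
    show "q \<in> borel_measurable M"
    proof (rule borel_measurable_if_dist)
      fix n
      have "(\<lambda>x. dist (s n) (q x)) = min_over (G (Suc (Suc n))) (h (Suc (Suc n)))"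
        using val[of "Suc (Suc n)"] by (auto simp: h_def)
      then show "(\<lambda>x. dist (s n) (q x)) \<in> borel_measurable M" using min_over_measurable[OF mf h] by simp
    qed
    show arg: "q x \<in> Argmax (g x)" for x
    proof -
      have "g x \<beta> \<le> g x (q x)" for \<beta>
        using val[of 0 x] att[of 0 x \<beta>] by (simp add: h_def G0)
      then show ?thesis by (simp add: Argmax_def)
    qed
    show "d x (q x) \<le> d x \<beta>" if \<beta>: "\<beta> \<in> Argmax (g x)" for x \<beta>
    proof -
      have "g x \<beta> = g x (q x)" using \<beta> arg[of x] by (auto simp: Argmax_def intro: antisym)
      then have "G (Suc 0) x \<beta> = 0" using val[of 0 x] unfolding zero_Suc by (simp add: G0 h_def)
      then show ?thesis using val[of "Suc 0" x] att[of "Suc 0" x \<beta>] by (simp add: h_def)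
    qed
  qed
qed

end

section \<open>The Hamilton--Jacobi--Bellman operator\<close>

text \<open>The Frobenius product is the Euclidean inner product of \<open>real^'d^'d\<close>, so that Cauchy--Schwarz is at hand.\<close>

lemma frobenius_inner: "frobenius M N = M \<bullet> N"
proof -
  have "frobenius M N = (\<Sum>i\<in>UNIV. \<Sum>k\<in>UNIV. M $ k $ i * N $ k $ i)"
    by (simp add: frobenius_def trace_def matrix_matrix_mult_def transpose_def)
  also have "\<dots> = (\<Sum>k\<in>UNIV. \<Sum>i\<in>UNIV. M $ k $ i * N $ k $ i)" by (rule sum.swap)
  finally show ?thesis by (simp add: inner_vec_def)
qed

abbreviation (input) "ev \<equiv> apply_bcontfun"

lemma continuous_on_evaluation: "continuous_on UNIV (\<lambda>F. ev F \<alpha>)"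
proof (rule continuous_on_iff[THEN iffD2], intro ballI allI impI)
  fix F :: "'a \<Rightarrow>\<^sub>C 'b" and e :: real assume "e > 0"
  then show "\<exists>d>0. \<forall>F'\<in>UNIV. dist F' F < d \<longrightarrow> dist (ev F' \<alpha>) (ev F \<alpha>) < e"
    by (intro exI[of _ e]) (auto intro: dist_fun_lt_imp_dist_val_lt)
qed

lemma evaluation_measurable:
  fixes \<psi> :: "'b::metric_space \<Rightarrow> 'c::topological_space"
  assumes "F \<in> borel_measurable M" "continuous_on UNIV \<psi>"
  shows "(\<lambda>x. \<psi> (ev (F x) \<alpha>)) \<in> borel_measurable M"
proof -
  have "continuous_on UNIV (\<lambda>F. \<psi> (ev F \<alpha>))"
    by (rule continuous_on_compose2[OF assms(2) continuous_on_evaluation]) auto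
  from measurable_compose[OF assms(1) borel_measurable_continuous_onI[OF this]] show ?thesis .
qed

lemma sq_sum3: "(x + y + z)\<^sup>2 \<le> 3 * (x\<^sup>2 + y\<^sup>2 + z\<^sup>2)" for x y z :: real
proof -
  have "0 \<le> (x - y)\<^sup>2 + (y - z)\<^sup>2 + (x - z)\<^sup>2" by simp
  then show ?thesis by (simp add: power2_eq_square algebra_simps)
qed

context bounded_domain
begin

lemma H1_density_grad: "H1_density v x = (rep v x)\<^sup>2 + (norm (grad v x))\<^sup>2"
  by (simp add: H1_density_def weak_grad_def norm_vec_def L2_set_def sum_nonneg)

definition H2_density :: "'d ae_fun \<Rightarrow> real^'d \<Rightarrow> real" where
  "H2_density v x = H1_density v x + (norm (hess v x))\<^sup>2"

lemma norm_hessian_sq: "(norm (hess v x))\<^sup>2 = (\<Sum>i\<in>UNIV. \<Sum>j\<in>UNIV. (rep (wpd i (wpd j v)) x)\<^sup>2)"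
  by (simp add: weak_hessian_def norm_vec_def L2_set_def sum_nonneg)

lemma H2_density_nonneg: "H2_density v x \<ge> 0"
  by (simp add: H2_density_def H1_density_nonneg)

lemma H2_density_measurable[measurable]: "H2_density v \<in> borel_measurable M"
  unfolding H2_density_def norm_hessian_sq by measurable

lemma H2_density_integral:
  assumes "v \<in> H2 \<Omega>"
  shows "integrable M (H2_density v)" "(LINT x|M. H2_density v x) = (nH2 v)\<^sup>2"
proof -
  have i: "integrable M (\<lambda>x. (rep (wpd i (wpd j v)) x)\<^sup>2)" for i j
    using H2_H1(2)[OF assms, of j] H1_weak_pderiv(1) L2_sqint sqint_integrable_square by blast
  show "integrable M (H2_density v)" "(LINT x|M. H2_density v x) = (nH2 v)\<^sup>2"
    unfolding H2_density_def norm_hessian_sq H2_norm_sq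
    using i H1_density_integral[OF H2_H1(1)[OF assms]] by (simp_all add: L2_norm_sq)
qed

lemma derivatives_linear:
  assumes "u \<in> H2 \<Omega>" "v \<in> H2 \<Omega>"
  shows "AE x in M. rep (u + v) x = rep u x + rep v x
      \<and> grad (u + v) x = grad u x + grad v x
      \<and> hess (u + v) x = hess u x + hess v x"
    "AE x in M. rep (a *\<^sub>R u) x = a * rep u x
      \<and> grad (a *\<^sub>R u) x = a *\<^sub>R grad u x
      \<and> hess (a *\<^sub>R u) x = a *\<^sub>R hess u x"
proof -
  note h = H2_H1[OF assms(1)] H2_H1[OF assms(2)]
  have "AE x in M. \<forall>i\<in>UNIV. rep (wpd i (u + v)) x = rep (wpd i u) x + rep (wpd i v) x"
    unfolding H1_add(2)[OF h(1) h(3)] by (rule AE_finite_allI) (auto intro: rep_add)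
  moreover have "AE x in M. \<forall>i\<in>UNIV. \<forall>j\<in>UNIV. rep (wpd i (wpd j (u + v))) x
      = rep (wpd i (wpd j u)) x + rep (wpd i (wpd j v)) x"
    unfolding H1_add(2)[OF h(1) h(3)] H1_add(2)[OF h(2) h(4)] by (intro AE_finite_allI) (auto intro: rep_add)
  ultimately show "AE x in M. rep (u + v) x = rep u x + rep v x
      \<and> grad (u + v) x = grad u x + grad v x
      \<and> hess (u + v) x = hess u x + hess v x"
    using rep_add[of u v] by eventually_elim (simp add: weak_grad_def weak_hessian_def vec_eq_iff)
  have "AE x in M. \<forall>i\<in>UNIV. rep (wpd i (a *\<^sub>R u)) x = a * rep (wpd i u) x"
    unfolding H1_scale(2)[OF h(1)] by (rule AE_finite_allI) (auto intro: rep_scale)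
  moreover have "AE x in M. \<forall>i\<in>UNIV. \<forall>j\<in>UNIV. rep (wpd i (wpd j (a *\<^sub>R u))) x
      = a * rep (wpd i (wpd j u)) x"
    unfolding H1_scale(2)[OF h(1)] H1_scale(2)[OF h(2)] by (intro AE_finite_allI) (auto intro: rep_scale)
  ultimately show "AE x in M. rep (a *\<^sub>R u) x = a * rep u x
      \<and> grad (a *\<^sub>R u) x = a *\<^sub>R grad u x
      \<and> hess (a *\<^sub>R u) x = a *\<^sub>R hess u x"
    using rep_scale[of a u] by eventually_elim (simp add: weak_grad_def weak_hessian_def vec_eq_iff)
qed

end

text \<open>Here \<open>L\<close> is the linear operator for a fixed control, \<open>N v\<close> are the maximising policies, \<open>pol q\<close> is the linear
  operator of the policy \<open>q\<close>, \<open>reward v x\<close> is the function that is maximised at \<open>x\<close>, and \<open>\<F>\<close> is the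
  Hamilton--Jacobi--Bellman operator.\<close>

locale hjb = bounded_domain \<Omega> + compact_space s
  for \<Omega> :: "(real^'d::finite) set" and s :: "nat \<Rightarrow> 'a::metric_space" +
  fixes A :: "real^'d \<Rightarrow> ('a \<Rightarrow>\<^sub>C (real^'d^'d))"
    and b :: "real^'d \<Rightarrow> ('a \<Rightarrow>\<^sub>C (real^'d))"
    and c f :: "real^'d \<Rightarrow> ('a \<Rightarrow>\<^sub>C real)"
  assumes A_Linf: "A \<in> bochner_Linf \<Omega>" and b_Linf: "b \<in> bochner_Linf \<Omega>"
    and c_Linf: "c \<in> bochner_Linf \<Omega>" and f_L2: "f \<in> bochner_L2 \<Omega>"
begin

abbreviation "L \<equiv> ell_op \<Omega> A b c"
abbreviation "N \<equiv> max_policies \<Omega> A b c f"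
abbreviation "pol \<equiv> policy_op \<Omega> A b c"
abbreviation "\<F> \<equiv> HJB \<Omega> A b c f"
abbreviation "reward v x \<alpha> \<equiv> L \<alpha> v x - ev (f x) \<alpha>"

lemma data_measurable: "A \<in> borel_measurable M" "b \<in> borel_measurable M" "c \<in> borel_measurable M" "f \<in> borel_measurable M"
  using A_Linf b_Linf c_Linf f_L2 by (auto simp: bochner_Linf_def bochner_L2_def)

lemma data_bounded:
  obtains K where "K \<ge> 0" "AE x in M. \<forall>\<alpha>. norm (ev (A x) \<alpha>) \<le> K \<and> norm (ev (b x) \<alpha>) \<le> K \<and> \<bar>ev (c x) \<alpha>\<bar> \<le> K"
proof -
  obtain CA Cb Cc where C: "AE x in M. norm (A x) \<le> CA" "AE x in M. norm (b x) \<le> Cb" "AE x in M. norm (c x) \<le> Cc"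
    using A_Linf b_Linf c_Linf unfolding bochner_Linf_def by blast
  let ?K = "max 0 (max CA (max Cb Cc))"
  have "AE x in M. \<forall>\<alpha>. norm (ev (A x) \<alpha>) \<le> ?K \<and> norm (ev (b x) \<alpha>) \<le> ?K \<and> \<bar>ev (c x) \<alpha>\<bar> \<le> ?K"
    using C
  proof eventually_elim
    case (elim x)
    show ?case
    proof
      fix \<alpha>
      have "norm (ev (A x) \<alpha>) \<le> norm (A x)" "norm (ev (b x) \<alpha>) \<le> norm (b x)" "norm (ev (c x) \<alpha>) \<le> norm (c x)"
        by (rule norm_bounded)+
      then show "norm (ev (A x) \<alpha>) \<le> ?K \<and> norm (ev (b x) \<alpha>) \<le> ?K \<and> \<bar>ev (c x) \<alpha>\<bar> \<le> ?K"
        using elim unfolding real_norm_def by linarith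
    qed
  qed
  then show ?thesis by (rule that[rotated]) simp
qed

lemma L_inner: "L \<alpha> v x = ev (A x) \<alpha> \<bullet> hess v x + ev (b x) \<alpha> \<bullet> grad v x - ev (c x) \<alpha> * rep v x"
  by (simp add: ell_op_def frobenius_inner)

lemma caratheodory_component:
  "caratheodory M (\<lambda>x \<alpha>. ev (A x) \<alpha> $ i $ j)"
  "caratheodory M (\<lambda>x \<alpha>. ev (b x) \<alpha> $ i)"
  "caratheodory M (\<lambda>x \<alpha>. ev (c x) \<alpha>)"
  "caratheodory M (\<lambda>x \<alpha>. ev (f x) \<alpha>)"
proof -
  have "(\<lambda>x. ev (A x) \<alpha> $ i $ j) \<in> borel_measurable M" for \<alpha>
    by (rule evaluation_measurable[OF data_measurable(1)]) (intro continuous_intros)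
  then show "caratheodory M (\<lambda>x \<alpha>. ev (A x) \<alpha> $ i $ j)"
    by (auto simp: caratheodory_def intro!: continuous_intros)
  have "(\<lambda>x. ev (b x) \<alpha> $ i) \<in> borel_measurable M" for \<alpha>
    by (rule evaluation_measurable[OF data_measurable(2)]) (intro continuous_intros)
  then show "caratheodory M (\<lambda>x \<alpha>. ev (b x) \<alpha> $ i)"
    by (auto simp: caratheodory_def intro!: continuous_intros)
  have "(\<lambda>x. ev (c x) \<alpha>) \<in> borel_measurable M" "(\<lambda>x. ev (f x) \<alpha>) \<in> borel_measurable M" for \<alpha>
    by (rule evaluation_measurable[OF data_measurable(3)], intro continuous_intros)
       (rule evaluation_measurable[OF data_measurable(4)], intro continuous_intros)
  then show "caratheodory M (\<lambda>x \<alpha>. ev (c x) \<alpha>)" "caratheodory M (\<lambda>x \<alpha>. ev (f x) \<alpha>)"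
    by (auto simp: caratheodory_def)
qed

lemma caratheodory_L: "caratheodory M (\<lambda>x \<alpha>. L \<alpha> v x)"
  unfolding caratheodory_def
proof (intro conjI allI)
  have [measurable]: "(\<lambda>x. ev (A x) \<alpha> $ i $ j) \<in> borel_measurable M" "(\<lambda>x. ev (b x) \<alpha> $ i) \<in> borel_measurable M"
    "(\<lambda>x. ev (c x) \<alpha>) \<in> borel_measurable M" for i j \<alpha>
    using caratheodory_component by (auto simp: caratheodory_def)
  show "(\<lambda>x. L \<alpha> v x) \<in> borel_measurable M" for \<alpha>
    unfolding L_inner inner_vec_def weak_hessian_def weak_grad_def by simp
  show "continuous_on UNIV (\<lambda>\<alpha>. L \<alpha> v x)" for x
    unfolding L_inner by (intro continuous_intros) auto
qed

lemma caratheodory_reward: "caratheodory M (reward v)"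
  unfolding caratheodory_def
proof (intro conjI allI)
  show "(\<lambda>x. reward v x \<alpha>) \<in> borel_measurable M" for \<alpha>
    using caratheodory_L[of v] caratheodory_component(4) unfolding caratheodory_def
    by (intro borel_measurable_diff) auto
  show "continuous_on UNIV (reward v x)" for x
    using caratheodory_L[of v] unfolding caratheodory_def by (intro continuous_intros) auto
qed

lemma N_iff: "q \<in> N v \<longleftrightarrow> q \<in> borel_measurable M \<and> (AE x in M. q x \<in> Argmax (reward v x))"
  by (simp add: max_policies_def policies_def)

lemma caratheodory_dist:
  assumes "p \<in> borel_measurable M"
  shows "caratheodory M (\<lambda>x \<alpha>. dist (p x) \<alpha>)"
proof -
  have "(\<lambda>x. dist (p x) \<alpha>) \<in> borel_measurable M" for \<alpha>
    by (rule measurable_compose[OF assms], rule borel_measurable_continuous_onI) (intro continuous_intros)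
  then show ?thesis by (auto simp: caratheodory_def intro!: continuous_intros)
qed

lemma closest_maximiser:
  assumes p: "p \<in> borel_measurable M"
  obtains q where "q \<in> N v" "\<And>x. q x \<in> Argmax (reward v x)"
    "\<And>x \<beta>. \<beta> \<in> Argmax (reward v x) \<Longrightarrow> dist (p x) (q x) \<le> dist (p x) \<beta>"
proof -
  obtain q where q: "q \<in> borel_measurable M" "\<And>x. q x \<in> Argmax (reward v x)"
    "\<And>x \<beta>. \<beta> \<in> Argmax (reward v x) \<Longrightarrow> dist (p x) (q x) \<le> dist (p x) \<beta>"
    using measurable_argmax_selection[OF caratheodory_reward caratheodory_dist[OF p]] by blast
  then have "q \<in> N v" by (simp add: N_iff)
  with q show ?thesis using that by blast
qed

lemma maximiser_exists: obtains q where "q \<in> N v" "\<And>x. q x \<in> Argmax (reward v x)"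
proof (rule closest_maximiser[of "\<lambda>_. s 0" v])
  fix q assume "q \<in> N v" "\<And>x. q x \<in> Argmax (reward v x)"
  then show thesis by (rule that)
qed simp

lemma N_nonempty: "N v \<noteq> {}"
  using maximiser_exists[of v] by blast

text \<open>The pointwise closest maximiser is itself a member of the family, so its distance is the greatest lower
  bound; greatest lower bounds are unique almost everywhere.\<close>

lemma policy_dist_closest:
  assumes p: "p \<in> borel_measurable M" and q: "q \<in> N v"
    "\<And>x \<beta>. \<beta> \<in> Argmax (reward v x) \<Longrightarrow> dist (p x) (q x) \<le> dist (p x) \<beta>"
  shows "policy_dist \<Omega> p (N v) \<in> borel_measurable M" "AE x in M. policy_dist \<Omega> p (N v) x = dist (p x) (q x)"
proof -
  let ?G = "(\<lambda>q x. dist (p x) (q x)) ` N v"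
  let ?g = "\<lambda>x. dist (p x) (q x)"
  have gm: "?g \<in> borel_measurable M"
    by (rule caratheodory_compose[OF caratheodory_dist[OF p]]) (use q in \<open>simp add: N_iff\<close>)
  have low: "AE x in M. ?g x \<le> h x" if h: "h \<in> ?G" for h
  proof -
    obtain q' where q': "q' \<in> N v" "h = (\<lambda>x. dist (p x) (q' x))" using h by blast
    then have "AE x in M. q' x \<in> Argmax (reward v x)" by (simp add: N_iff)
    then show ?thesis by eventually_elim (simp add: q' q)
  qed
  have gG: "?g \<in> ?G" using q(1) by blast
  have "is_ess_inf M ?G ?g"
    unfolding is_ess_inf_def
  proof (intro conjI ballI impI)
    show "AE x in M. k x \<le> ?g x" if "\<forall>h\<in>?G. AE x in M. k x \<le> h x" for k
      using bspec[OF that gG] .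
  qed (use gm low in auto)
  then have "is_ess_inf M ?G (policy_dist \<Omega> p (N v))"
    unfolding policy_dist_def ess_inf_def by (rule someI[of "is_ess_inf M ?G"])
  note e' = this[unfolded is_ess_inf_def]
  note e = e'[THEN conjunct1] e'[THEN conjunct2, THEN conjunct1] e'[THEN conjunct2, THEN conjunct2]
  have 1: "policy_dist \<Omega> p (N v) \<in> borel_measurable M" "AE x in M. policy_dist \<Omega> p (N v) x \<le> ?g x"
    "AE x in M. ?g x \<le> policy_dist \<Omega> p (N v) x"
    using e(1) bspec[OF e(2) gG] mp[OF bspec[OF e(3) gm]] low by simp_all
  then show "policy_dist \<Omega> p (N v) \<in> borel_measurable M" by simp
  from 1(2,3) show "AE x in M. policy_dist \<Omega> p (N v) x = ?g x" by eventually_elim simp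
qed

text \<open>The form in which uniform convergence of policies is used: its quantity bounds the distance to the
  closest maximiser.\<close>

lemma Linf_policy_dist:
  assumes p: "p \<in> borel_measurable M" and q: "q \<in> N v"
    "\<And>x \<beta>. \<beta> \<in> Argmax (reward v x) \<Longrightarrow> dist (p x) (q x) \<le> dist (p x) \<beta>"
  shows "AE x in M. ereal (dist (p x) (q x)) \<le> Linf_norm \<Omega> (policy_dist \<Omega> p (N v))"
proof -
  have "AE x in M. ereal \<bar>policy_dist \<Omega> p (N v) x\<bar> \<le> Linf_norm \<Omega> (policy_dist \<Omega> p (N v))"
    unfolding Linf_norm_def by (rule esssup_AE)
  moreover have "AE x in M. policy_dist \<Omega> p (N v) x = dist (p x) (q x)"
    by (rule policy_dist_closest(2)[OF p q(1)]) (rule q(2))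
  ultimately show ?thesis by eventually_elim simp
qed

text \<open>One constant serves for all policies, which gives boundedness of the linear operators and, through
  dominated integrability, that all compositions with policies are square integrable.\<close>

lemma L_bound:
  "\<exists>C\<ge>0. \<forall>v. AE x in M. \<forall>\<alpha>. (L \<alpha> v x)\<^sup>2 \<le> C * H2_density v x"
proof -
  obtain K where K: "K \<ge> 0" "AE x in M. \<forall>\<alpha>. norm (ev (A x) \<alpha>) \<le> K \<and> norm (ev (b x) \<alpha>) \<le> K \<and> \<bar>ev (c x) \<alpha>\<bar> \<le> K"
    by (rule data_bounded)
  show ?thesis
  proof (intro exI[of _ "3 * K\<^sup>2"] conjI allI)
    show "0 \<le> 3 * K\<^sup>2" by simp
    show "AE x in M. \<forall>\<alpha>. (L \<alpha> v x)\<^sup>2 \<le> 3 * K\<^sup>2 * H2_density v x" for v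
      using K(2)
    proof eventually_elim
      case (elim x)
      show ?case
      proof
        fix \<alpha>
        let ?H = "hess v x" and ?G = "grad v x" and ?u = "rep v x"
        have "\<bar>ev (A x) \<alpha> \<bullet> ?H\<bar> \<le> K * norm ?H"
          using elim by (intro order_trans[OF Cauchy_Schwarz_ineq2] mult_right_mono) auto
        moreover have "\<bar>ev (b x) \<alpha> \<bullet> ?G\<bar> \<le> K * norm ?G"
          using elim by (intro order_trans[OF Cauchy_Schwarz_ineq2] mult_right_mono) auto
        moreover have "\<bar>ev (c x) \<alpha> * ?u\<bar> \<le> K * \<bar>?u\<bar>"
          using elim unfolding abs_mult by (intro mult_right_mono) auto
        ultimately have "\<bar>L \<alpha> v x\<bar> \<le> K * norm ?H + K * norm ?G + K * \<bar>?u\<bar>"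
          unfolding L_inner by linarith
        then have "\<bar>L \<alpha> v x\<bar>\<^sup>2 \<le> (K * norm ?H + K * norm ?G + K * \<bar>?u\<bar>)\<^sup>2" by (rule power_mono) simp
        also have "\<dots> \<le> 3 * ((K * norm ?H)\<^sup>2 + (K * norm ?G)\<^sup>2 + (K * \<bar>?u\<bar>)\<^sup>2)" by (rule sq_sum3)
        also have "\<dots> = 3 * K\<^sup>2 * H2_density v x"
          by (simp add: H2_density_def H1_density_grad power_mult_distrib algebra_simps)
        finally show "(L \<alpha> v x)\<^sup>2 \<le> 3 * K\<^sup>2 * H2_density v x" by simp
      qed
    qed
  qed
qed

lemma L_policy_measurable: "q \<in> borel_measurable M \<Longrightarrow> (\<lambda>x. L (q x) v x) \<in> borel_measurable M"
  by (rule caratheodory_compose[OF caratheodory_L])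

lemma L_policy_sqint:
  assumes q: "q \<in> borel_measurable M" and v: "v \<in> H2 \<Omega>"
  shows "sqint M (\<lambda>x. L (q x) v x)"
proof -
  obtain C where C: "C \<ge> 0" "AE x in M. \<forall>\<alpha>. (L \<alpha> v x)\<^sup>2 \<le> C * H2_density v x" using L_bound by blast
  have "integrable M (\<lambda>x. (L (q x) v x)\<^sup>2)"
  proof (rule Bochner_Integration.integrable_bound)
    show "integrable M (\<lambda>x. C * H2_density v x)" using H2_density_integral(1)[OF v] by simp
    show "AE x in M. norm ((L (q x) v x)\<^sup>2) \<le> norm (C * H2_density v x)"
      using C(2) by eventually_elim (use C(1) H2_density_nonneg in \<open>auto simp: abs_mult\<close>)
  qed (use L_policy_measurable[OF q] in measurable)
  then show ?thesis using L_policy_measurable[OF q] by (simp add: sqint_def)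
qed

lemma f_policy_sqint:
  assumes q: "q \<in> borel_measurable M"
  shows "sqint M (\<lambda>x. ev (f x) (q x))"
proof -
  have m: "(\<lambda>x. ev (f x) (q x)) \<in> borel_measurable M"
    by (rule caratheodory_compose[OF caratheodory_component(4) q])
  have "integrable M (\<lambda>x. (ev (f x) (q x))\<^sup>2)"
  proof (rule Bochner_Integration.integrable_bound)
    show "integrable M (\<lambda>x. (norm (f x))\<^sup>2)" using f_L2 by (simp add: bochner_L2_def)
    show "AE x in M. norm ((ev (f x) (q x))\<^sup>2) \<le> norm ((norm (f x))\<^sup>2)"
      using norm_bounded[of "f _"] by (intro AE_I2) (simp add: power_mono abs_le_square_iff[symmetric])
  qed (use m in measurable)
  then show ?thesis using m by (simp add: sqint_def)
qed

lemma Argmax_Sup: "q \<in> Argmax g \<Longrightarrow> (SUP \<alpha>. g \<alpha>) = g q"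
  unfolding Argmax_def by (intro cSup_eq_maximum) auto

text \<open>The pointwise supremum is attained, and almost everywhere by any maximising policy. This makes the
  supremum measurable and replaces it by a composition.\<close>

lemma HJB_maximiser:
  assumes q: "q \<in> N v"
  shows "\<F> v = cls (\<lambda>x. reward v x (q x))"
proof -
  obtain q0 where q0: "q0 \<in> N v" "\<And>x. q0 x \<in> Argmax (reward v x)" using maximiser_exists[of v] by blast
  have "(\<lambda>x. SUP \<alpha>. reward v x \<alpha>) = (\<lambda>x. reward v x (q0 x))"
    using Argmax_Sup[OF q0(2)] by auto
  then have "\<F> v = cls (\<lambda>x. reward v x (q0 x))" unfolding HJB_def by simp
  also have "\<dots> = cls (\<lambda>x. reward v x (q x))"
  proof (rule class_on_cong_AE)
    show "(\<lambda>x. reward v x (q0 x)) \<in> borel_measurable M" "(\<lambda>x. reward v x (q x)) \<in> borel_measurable M"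
      using q q0 by (auto simp: N_iff intro!: caratheodory_compose[OF caratheodory_reward])
    have "AE x in M. q x \<in> Argmax (reward v x)" using q by (simp add: N_iff)
    then show "AE x in M. reward v x (q0 x) = reward v x (q x)"
      by eventually_elim (use q0(2) in \<open>auto simp: Argmax_def intro: antisym\<close>)
  qed
  finally show ?thesis .
qed

lemma HJB_L2:
  assumes "v \<in> H2 \<Omega>"
  shows "\<F> v \<in> L2 \<Omega>"
proof -
  obtain q where q: "q \<in> N v" using maximiser_exists[of v] by blast
  then have qm: "q \<in> borel_measurable M" by (simp add: N_iff)
  have "sqint M (\<lambda>x. L (q x) v x + (-1) * ev (f x) (q x))"
    by (intro sqint_add sqint_scale L_policy_sqint f_policy_sqint qm assms)
  then show ?thesis unfolding HJB_maximiser[OF q] by (intro class_on_L2) simp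
qed

lemma policy_op_bounded:
  assumes q: "q \<in> borel_measurable M"
  shows "pol q \<in> bounded_operators X nH2 (L2 \<Omega>) nL2"
proof -
  obtain C where C: "C \<ge> 0" "\<And>v. AE x in M. \<forall>\<alpha>. (L \<alpha> v x)\<^sup>2 \<le> C * H2_density v x" using L_bound by blast
  have "pol q (u + v) = pol q u + pol q v" if "u \<in> H2 \<Omega>" "v \<in> H2 \<Omega>" for u v
  proof -
    have "pol q (u + v) = cls (\<lambda>x. L (q x) u x + L (q x) v x)"
      unfolding policy_op_def
    proof (rule class_on_cong_AE)
      show "AE x in M. L (q x) (u + v) x = L (q x) u x + L (q x) v x"
        using derivatives_linear(1)[OF that] by eventually_elim (simp add: L_inner inner_add_right distrib_left)
    qed (use L_policy_measurable[OF q] in auto)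
    then show ?thesis unfolding policy_op_def by (simp add: class_on_add L_policy_measurable q)
  qed
  moreover have "pol q (a *\<^sub>R u) = a *\<^sub>R pol q u" if "u \<in> H2 \<Omega>" for a u
  proof -
    have "pol q (a *\<^sub>R u) = cls (\<lambda>x. a * L (q x) u x)"
      unfolding policy_op_def
    proof (rule class_on_cong_AE)
      show "AE x in M. L (q x) (a *\<^sub>R u) x = a * L (q x) u x"
        using derivatives_linear(2)[OF that that, of a]
        by eventually_elim (simp add: L_inner distrib_left right_diff_distrib)
    qed (use L_policy_measurable[OF q] in auto)
    then show ?thesis unfolding policy_op_def by (simp add: class_on_scale L_policy_measurable q)
  qed
  moreover have "nL2 (pol q u) \<le> sqrt C * nH2 u" if u: "u \<in> H2 \<Omega>" for u
  proof -
    have "nL2 (pol q u) = sqrt (LINT x|M. (L (q x) u x)\<^sup>2)"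
      unfolding policy_op_def by (rule L2_norm_cong[OF _ class_on_rep(1)]) (rule L_policy_measurable[OF q])+
    also have "\<dots> \<le> sqrt (LINT x|M. C * H2_density u x)"
    proof (rule real_sqrt_le_mono, rule integral_mono_AE)
      show "AE x in M. (L (q x) u x)\<^sup>2 \<le> C * H2_density u x" using C(2)[of u] by eventually_elim simp
    qed (use L_policy_sqint[OF q u] H2_density_integral(1)[OF u] in \<open>auto simp: sqint_def\<close>)
    also have "\<dots> = sqrt C * nH2 u"
      using H2_density_integral[OF u] H2_norm_nonneg by (simp add: real_sqrt_mult)
    finally show ?thesis .
  qed
  moreover have "pol q u \<in> L2 \<Omega>" if "u \<in> H2 \<Omega>" for u
    unfolding policy_op_def by (rule class_on_L2[OF L_policy_sqint[OF q that]])
  ultimately show ?thesis unfolding bounded_operators_def by blast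
qed

end

section \<open>Concentrated perturbations\<close>

lemma pderiv_at_rescale:
  assumes "\<And>y. G differentiable (at y)"
  shows "pderiv_at m (\<lambda>x. G (r *\<^sub>R (x - x0))) = (\<lambda>x. r * pderiv_at m G (r *\<^sub>R (x - x0)))"
proof
  fix x
  let ?D = "frechet_derivative G (at (r *\<^sub>R (x - x0)))"
  have D: "(G has_derivative ?D) (at (r *\<^sub>R (x - x0)))" using assms frechet_derivative_works by blast
  have "((\<lambda>x. r *\<^sub>R (x - x0)) has_derivative (\<lambda>h. r *\<^sub>R h)) (at x)"
    by (auto intro!: derivative_eq_intros)
  then have "((\<lambda>x. G (r *\<^sub>R (x - x0))) has_derivative (\<lambda>h. ?D (r *\<^sub>R h))) (at x)"
    using D by (rule has_derivative_compose)
  from pderiv_at_eq[OF this]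
  have "pderiv_at m (\<lambda>x. G (r *\<^sub>R (x - x0))) x = ?D (r *\<^sub>R axis m 1)" .
  also have "\<dots> = r * pderiv_at m G (r *\<^sub>R (x - x0))"
    using linear_scale[OF has_derivative_linear[OF D]] by (simp add: pderiv_at_def)
  finally show "pderiv_at m (\<lambda>x. G (r *\<^sub>R (x - x0))) x = r * pderiv_at m G (r *\<^sub>R (x - x0))" .
qed

lemma differentiable_rescale:
  assumes "\<And>y. G differentiable (at y)"
  shows "(\<lambda>x. G (r *\<^sub>R (x - x0))) differentiable (at x)"
proof -
  have "((\<lambda>x. r *\<^sub>R (x - x0)) has_derivative (\<lambda>h. r *\<^sub>R h)) (at x)"
    by (auto intro!: derivative_eq_intros)
  from has_derivative_compose[OF this frechet_derivative_works[THEN iffD1, OF assms]]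
  show ?thesis by (auto simp: differentiable_def)
qed

lemma smooth_fun_rescale:
  assumes "smooth_fun G" shows "smooth_fun (\<lambda>x. G (r *\<^sub>R (x - x0)))"
proof -
  have "kdiff n G \<Longrightarrow> kdiff n (\<lambda>x. G (r *\<^sub>R (x - x0)))" for n and G :: "real^'a \<Rightarrow> real"
  proof (induction n arbitrary: G)
    case 0
    then show ?case by (auto intro: differentiable_rescale)
  next
    case (Suc n)
    have d: "\<And>y. G differentiable (at y)" using kdiff_differentiable[OF Suc.prems] .
    have "(\<lambda>x. G (r *\<^sub>R (x - x0))) differentiable (at x)" for x by (rule differentiable_rescale[OF d])
    moreover have "kdiff n (\<lambda>x. r * pderiv_at i G (r *\<^sub>R (x - x0)))" for i
      using Suc.prems by (intro kdiff_mult kdiff_const Suc.IH) auto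
    ultimately show ?case by (simp add: pderiv_at_rescale[OF d])
  qed
  then show ?thesis using assms by (simp add: smooth_fun_iff)
qed

text \<open>The product \<open>y\<^sub>i y\<^sub>j\<close>, cut off by a product of plateau functions that equals \<open>1\<close> on the unit ball.\<close>

lemma quadratic_test_fun:
  fixes i j :: "'d::finite"
  obtains Q :: "real^'d \<Rightarrow> real" where "Q \<in> test_funs UNIV" "\<And>y. norm y > 2 * real CARD('d) \<Longrightarrow> Q y = 0"
    "\<And>y. norm y < 1 \<Longrightarrow> Q y = y $ i * y $ j"
    "\<And>y m. norm y < 1 \<Longrightarrow> pderiv_at m Q y = (if m = i then y $ j else 0) + (if m = j then y $ i else 0)"
    "\<And>y l m. norm y < 1 \<Longrightarrow> pderiv_at l (pderiv_at m Q) y = (if m = i \<and> l = j then 1 else 0) + (if m = j \<and> l = i then 1 else 0)"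
proof -
  define Q where "Q y = (y $ i * y $ j) * (\<Prod>l\<in>UNIV. plateau (y $ l))" for y :: "real^'d"
  have sm: "smooth_fun Q" unfolding Q_def
    by (intro smooth_fun_mult smooth_fun_prod smooth_fun_component[of "\<lambda>t. t"] smooth_fun_component ntimes_diff_id ntimes_diff_plateau) auto
  have out: "Q y = 0" if "norm y > 2 * real CARD('d)" for y
  proof -
    have "\<exists>l. \<bar>y $ l\<bar> > 2"
    proof (rule ccontr)
      assume "\<nexists>l. \<bar>y $ l\<bar> > 2"
      then have "(\<Sum>l\<in>UNIV. \<bar>y $ l\<bar>) \<le> real CARD('d) * 2" by (intro sum_bounded_above) (auto simp: not_less)
      then show False using that norm_le_l1_cart[of y] by simp
    qed
    then obtain l where "plateau (y $ l) = 0" using plateau_0 less_imp_le by blast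
    then have "(\<Prod>l\<in>UNIV. plateau (y $ l)) = 0" by (intro prod_zero) auto
    then show ?thesis by (simp add: Q_def)
  qed
  have tf: "Q \<in> test_funs UNIV"
    by (rule test_funsI[OF sm compact_cball[of 0 "2 * real CARD('d)"]]) (use out in auto)
  have in1: "Q y = y $ i * y $ j" if "norm y < 1" for y
  proof -
    have "plateau (y $ l) = 1" for l using component_le_norm_cart[of y l] that by (intro plateau_1) linarith
    then show ?thesis by (simp add: Q_def)
  qed
  have id: "\<And>t. ((\<lambda>t. t) has_real_derivative 1) (at t)" by simp
  note comp = pderiv_at_component[OF id]
  have op: "open {y::real^'d. norm y < 1}" by (intro open_Collect_less continuous_intros)
  have in2: "pderiv_at m Q y = (if m = i then y $ j else 0) + (if m = j then y $ i else 0)" if "norm y < 1" for y m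
  proof -
    have "pderiv_at m Q y = pderiv_at m (\<lambda>y. y $ i * y $ j) y"
    proof (rule pderiv_at_local[OF op])
      show "(\<lambda>y::real^'d. y $ i * y $ j) differentiable (at y)" by (rule differentiable_mult[OF comp(1) comp(1)])
    qed (use that in1 in auto)
    also have "\<dots> = (if m = i then y $ j else 0) + (if m = j then y $ i else 0)"
      by (subst pderiv_at_mult) (auto simp: comp)
    finally show ?thesis .
  qed
  have in3: "pderiv_at l (pderiv_at m Q) y = (if m = i \<and> l = j then 1 else 0) + (if m = j \<and> l = i then 1 else 0)" if "norm y < 1" for y l m
  proof -
    have d: "(\<lambda>y::real^'d. (if P then y $ k else 0)) differentiable (at y)" for P k y
      by (cases P) (auto simp: comp(1))
    have pd: "pderiv_at l (\<lambda>y::real^'d. (if P then y $ k else 0)) y = (if P \<and> l = k then 1 else 0)" for P k and y :: "real^'d"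
      by (cases P) (simp_all add: comp pderiv_at_const)
    have "pderiv_at l (pderiv_at m Q) y = pderiv_at l (\<lambda>y. (if m = i then y $ j else 0) + (if m = j then y $ i else 0)) y"
      by (rule pderiv_at_local[OF op]) (use that in2 in \<open>auto intro!: differentiable_add d\<close>)
    also have "\<dots> = (if m = i \<and> l = j then 1 else 0) + (if m = j \<and> l = i then 1 else 0)"
      unfolding pderiv_at_add[OF d d] pd ..
    finally show ?thesis .
  qed
  show ?thesis by (rule that[OF tf out in1 in2 in3])
qed

text \<open>Second derivatives of \<open>t\<^sup>2 Q (x / t)\<close> are rescaled copies without a factor, so they stay bounded as \<open>t\<close> tends to \<open>0\<close>;
  their \<open>L\<^sub>2\<close> norms tend to \<open>0\<close> only because the supports shrink. First derivatives and values carry additional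
  powers of \<open>t\<close>, whence the factor \<open>t ^ k\<close>.\<close>

lemma concentrating_L2_limit:
  fixes G :: "real^'d::finite \<Rightarrow> real"
  assumes G: "G \<in> test_funs UNIV" and t: "\<And>n::nat. 0 < t n" "\<And>n. t n \<le> 1" "t \<longlonglongrightarrow> 0"
  shows "(\<lambda>n. LINT x|lborel. (t n ^ k * G ((1 / t n) *\<^sub>R (x - x0)))\<^sup>2) \<longlonglongrightarrow> 0"
proof -
  note [measurable] = test_funs_borel[OF G]
  obtain C where C: "C \<ge> 0" "\<And>x. \<bar>G x\<bar> \<le> C" using test_funs_bounded[OF G] by metis
  obtain K where K: "compact K" "\<And>x. x \<notin> K \<Longrightarrow> G x = 0" using test_funs_compact[OF G] by metis
  obtain R0 where R0: "\<And>x. x \<in> K \<Longrightarrow> norm x \<le> R0" using K(1) compact_imp_bounded bounded_iff by metis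
  define R where "R = \<bar>R0\<bar>"
  have R: "R \<ge> 0" "\<And>x. x \<in> K \<Longrightarrow> norm x \<le> R" using R0 by (force simp: R_def)+
  have G0: "G x = 0" if "norm x > R" for x
  proof -
    have "x \<notin> K" using R(2)[of x] that by linarith
    then show ?thesis by (rule K(2))
  qed
  let ?g = "\<lambda>n x. (t n ^ k * G ((1 / t n) *\<^sub>R (x - x0)))\<^sup>2"
  have nrm: "norm ((1 / t n) *\<^sub>R (x - x0)) = norm (x - x0) / t n" for n x using t(1)[of n] by simp
  have "(\<lambda>n. LINT x|lborel. ?g n x) \<longlonglongrightarrow> (LINT x::real^'d|lborel. 0)"
  proof (rule integral_dominated_convergence[where w = "\<lambda>x. C\<^sup>2 * indicator (cball x0 R) x"])
    show "integrable lborel (\<lambda>x. C\<^sup>2 * indicator (cball x0 R) x :: real)"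
      by (intro integrable_mult_right integrable_real_indicator emeasure_lborel_cball_finite) auto
    have "AE x in lborel. x \<notin> {x0}" by (intro AE_not_in) (simp add: null_sets_def)
    then show "AE x in lborel. (\<lambda>n. ?g n x) \<longlonglongrightarrow> 0"
    proof eventually_elim
      case (elim x)
      then have p: "norm (x - x0) > 0" by simp
      have "(\<lambda>n. t n * (R + 1)) \<longlonglongrightarrow> 0 * (R + 1)" by (intro tendsto_intros t(3))
      then have "eventually (\<lambda>n. t n * (R + 1) < norm (x - x0)) sequentially"
        by (rule order_tendstoD(2)) (use p in simp)
      then have "eventually (\<lambda>n. ?g n x = 0) sequentially"
      proof eventually_elim
        case (elim n)
        have "t n * R < norm (x - x0)" using elim t(1)[of n] by (simp add: distrib_left)
        then have "R < norm (x - x0) / t n" using t(1)[of n] by (simp add: less_divide_eq mult.commute)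
        then have "G ((1 / t n) *\<^sub>R (x - x0)) = 0" unfolding nrm[symmetric] by (rule G0)
        then show ?case by simp
      qed
      then show ?case by (rule tendsto_eventually)
    qed
    show "AE x in lborel. norm (?g n x) \<le> C\<^sup>2 * indicator (cball x0 R) x" for n
    proof (rule AE_I2)
      fix x
      show "norm (?g n x) \<le> C\<^sup>2 * indicator (cball x0 R) x"
      proof (cases "norm (x - x0) \<le> R")
        case True
        have "t n ^ k \<le> 1" using t(1,2)[of n] by (intro power_le_one) auto
        then have "\<bar>t n ^ k * G ((1 / t n) *\<^sub>R (x - x0))\<bar> \<le> 1 * C"
          unfolding abs_mult using C t(1)[of n] by (intro mult_mono) auto
        then have "\<bar>t n ^ k * G ((1 / t n) *\<^sub>R (x - x0))\<bar>\<^sup>2 \<le> (1 * C)\<^sup>2" by (rule power_mono) simp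
        then show ?thesis using True by (simp add: dist_norm norm_minus_commute)
      next
        case False
        then have "R < norm (x - x0)" by simp
        also have "norm (x - x0) \<le> norm (x - x0) / t n"
          using t(1,2)[of n] by (simp add: le_divide_eq mult_left_le)
        finally have "G ((1 / t n) *\<^sub>R (x - x0)) = 0" unfolding nrm[symmetric] by (rule G0)
        then show ?thesis by simp
      qed
    qed
  qed auto
  then show ?thesis by simp
qed

text \<open>The Hessian of \<open>y\<^sub>i y\<^sub>j\<close>.\<close>

definition sym_unit :: "'d \<Rightarrow> 'd \<Rightarrow> real^'d^'d::finite" where
  "sym_unit i j = (\<chi> l m. (if m = i \<and> l = j then 1 else 0) + (if m = j \<and> l = i then 1 else 0))"

lemma norm_axis: "norm (axis i a :: real^'d::finite) = \<bar>a\<bar>"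
proof -
  have "axis i a = a *\<^sub>R (axis i 1 :: real^'d)" by (simp add: vec_eq_iff axis_def)
  then show ?thesis by simp
qed

lemma inner_sym_unit: "N \<bullet> sym_unit i j = N $ j $ i + N $ i $ j"
proof -
  have "N \<bullet> sym_unit i j = (\<Sum>l\<in>UNIV. \<Sum>m\<in>UNIV. (if m = i then (if l = j then N $ l $ m else 0) else 0) + (if m = j then (if l = i then N $ l $ m else 0) else 0))"
    by (auto simp: inner_vec_def sym_unit_def intro!: sum.cong)
  also have "\<dots> = N $ j $ i + N $ i $ j" by (simp add: sum.distrib)
  finally show ?thesis .
qed

context bounded_domain
begin

lemma test_fun_derivatives:
  assumes "\<phi> \<in> test_funs \<Omega>"
  shows "AE x in M. rep (cls \<phi>) x = \<phi> x \<and> grad (cls \<phi>) x = (\<chi> m. pderiv_at m \<phi> x)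
     \<and> hess (cls \<phi>) x = (\<chi> l m. pderiv_at l (pderiv_at m \<phi>) x)"
proof -
  have "AE x in M. \<forall>m\<in>UNIV. rep (cls (pderiv_at m \<phi>)) x = pderiv_at m \<phi> x"
    by (intro AE_finite_allI class_on_rep(1) test_measurable test_funs_pderiv assms) auto
  moreover have "AE x in M. \<forall>l\<in>UNIV. \<forall>m\<in>UNIV. rep (cls (pderiv_at l (pderiv_at m \<phi>))) x = pderiv_at l (pderiv_at m \<phi>) x"
    by (intro AE_finite_allI class_on_rep(1) test_measurable test_funs_pderiv assms) auto
  ultimately show ?thesis using class_on_rep(1)[OF test_measurable[OF assms]]
    by eventually_elim (simp add: weak_grad_def weak_hessian_def vec_eq_iff test_weak_pderiv assms test_funs_pderiv)
qed

text \<open>The point of the perturbations: second derivatives can be changed from \<open>k E\<close> to \<open>- k E\<close> on a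
  small ball, for arbitrarily large \<open>k\<close>, at arbitrarily small cost in \<open>H\<^sup>2\<close> and while values and
  gradients stay bounded there.\<close>

lemma hessian_flip:
  assumes x0: "x0 \<in> \<Omega>" and k: "k > 0"
  obtains v vs r where "v \<in> X" "\<And>n::nat. vs n \<in> X" "(\<lambda>n. nH2 (vs n - v)) \<longlonglongrightarrow> 0" "\<And>n. r n > 0"
    "\<And>n. AE x in M. x \<in> ball x0 (r n) \<longrightarrow>
       \<bar>rep v x\<bar> \<le> 1 \<and> norm (grad v x) \<le> 1 \<and> hess v x = k *\<^sub>R sym_unit i j
     \<and> \<bar>rep (vs n) x\<bar> \<le> 1 \<and> norm (grad (vs n) x) \<le> 1 \<and> hess (vs n) x = (- k) *\<^sub>R sym_unit i j"
proof -
  obtain Q :: "real^'d \<Rightarrow> real" where Q: "Q \<in> test_funs UNIV" "\<And>y. norm y > 2 * real CARD('d) \<Longrightarrow> Q y = 0"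
    "\<And>y. norm y < 1 \<Longrightarrow> Q y = y $ i * y $ j"
    "\<And>y m. norm y < 1 \<Longrightarrow> pderiv_at m Q y = (if m = i then y $ j else 0) + (if m = j then y $ i else 0)"
    "\<And>y l m. norm y < 1 \<Longrightarrow> pderiv_at l (pderiv_at m Q) y = (if m = i \<and> l = j then 1 else 0) + (if m = j \<and> l = i then 1 else 0)"
    by (rule quadratic_test_fun[of i j]) blast
  define D where "D = 2 * real CARD('d)"
  have D: "D > 0" by (simp add: D_def)
  obtain e where e: "e > 0" "cball x0 e \<subseteq> \<Omega>" using open_domain x0 open_contains_cball by blast
  \<comment> \<open>The support has to fit into the domain, and values and gradients of \<open>k y\<^sub>i y\<^sub>j\<close> have to be at
    most \<open>1\<close> on the ball of radius \<open>t0\<close>.\<close>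
  define t0 where "t0 = min (min 1 (e / D)) (1 / (2 * k))"
  have t0: "t0 > 0" "t0 \<le> 1" "t0 * D \<le> e" "t0 * (2 * k) \<le> 1"
  proof -
    show "t0 > 0" "t0 \<le> 1" using e D k by (auto simp: t0_def)
    have "t0 \<le> e / D" by (simp add: t0_def)
    then show "t0 * D \<le> e" using D by (simp add: field_simps)
    have "t0 \<le> 1 / (2 * k)" by (simp add: t0_def)
    then show "t0 * (2 * k) \<le> 1" using k by (simp add: field_simps)
  qed
  define \<phi> where "\<phi> t x = t\<^sup>2 * Q ((1 / t) *\<^sub>R (x - x0))" for t :: real and x
  note sQ = test_funs_smooth[OF Q(1)]
  have \<phi>_test: "\<phi> t \<in> test_funs \<Omega>" if t: "0 < t" "t \<le> t0" for t
  proof (rule test_funsI)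
    show "smooth_fun (\<phi> t)" unfolding \<phi>_def by (intro smooth_fun_mult smooth_fun_const smooth_fun_rescale sQ)
    show "compact (cball x0 e)" "cball x0 e \<subseteq> \<Omega>" using e by auto
    show "\<phi> t x = 0" if "x \<notin> cball x0 e" for x
    proof -
      have "t * D \<le> t0 * D" using t D by (intro mult_right_mono) auto
      then have "t * D < norm (x - x0)" using t0(3) that by (simp add: dist_norm norm_minus_commute)
      then have "D < norm (x - x0) / t" using t by (simp add: less_divide_eq mult.commute)
      also have "\<dots> = norm ((1 / t) *\<^sub>R (x - x0))" using t by simp
      finally have "norm ((1 / t) *\<^sub>R (x - x0)) > D" .
      then show ?thesis using Q(2) by (simp add: \<phi>_def D_def)
    qed
  qed
  have d1: "pderiv_at m (\<phi> t) = (\<lambda>x. t * pderiv_at m Q ((1 / t) *\<^sub>R (x - x0)))" if t: "t > 0" for t m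
  proof -
    have "pderiv_at m (\<phi> t) = (\<lambda>x. t\<^sup>2 * ((1 / t) * pderiv_at m Q ((1 / t) *\<^sub>R (x - x0))))"
      unfolding \<phi>_def by (subst pderiv_at_scale) (auto intro: smooth_fun_differentiable smooth_fun_rescale sQ simp: pderiv_at_rescale smooth_fun_differentiable[OF sQ])
    then show ?thesis using t by (simp add: power2_eq_square)
  qed
  have d2: "pderiv_at l (pderiv_at m (\<phi> t)) = (\<lambda>x. pderiv_at l (pderiv_at m Q) ((1 / t) *\<^sub>R (x - x0)))" if t: "t > 0" for t l m
  proof -
    have s: "smooth_fun (pderiv_at m Q)" by (rule smooth_fun_pderiv[OF sQ])
    have "pderiv_at l (pderiv_at m (\<phi> t)) = (\<lambda>x. t * ((1 / t) * pderiv_at l (pderiv_at m Q) ((1 / t) *\<^sub>R (x - x0))))"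
      unfolding d1[OF t] by (subst pderiv_at_scale) (auto intro: smooth_fun_differentiable smooth_fun_rescale s simp: pderiv_at_rescale smooth_fun_differentiable[OF s])
    then show ?thesis using t by simp
  qed
  define w where "w t = cls (\<phi> t)" for t
  have wX: "w t \<in> X" if "0 < t" "t \<le> t0" for t unfolding w_def by (rule test_X[OF \<phi>_test[OF that]])
  have loc: "AE x in M. x \<in> ball x0 t \<longrightarrow> \<bar>rep (w t) x\<bar> \<le> t \<and> norm (grad (w t) x) \<le> 2 * t \<and> hess (w t) x = sym_unit i j
      \<and> rep (w t) x = (x - x0) $ i * (x - x0) $ j \<and> grad (w t) x = (\<chi> m. (if m = i then (x - x0) $ j else 0) + (if m = j then (x - x0) $ i else 0))"
    if t: "0 < t" "t \<le> t0" for t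
    using test_fun_derivatives[OF \<phi>_test[OF t]]
  proof eventually_elim
    case (elim x)
    show ?case
    proof
      assume x: "x \<in> ball x0 t"
      define y where "y = (1 / t) *\<^sub>R (x - x0)"
      have xt: "norm (x - x0) < t" using x by (simp add: dist_norm norm_minus_commute)
      then have y: "norm y < 1" using t by (simp add: y_def)
      have xy: "(x - x0) $ l = t * y $ l" for l using t by (simp add: y_def)
      have xl: "\<bar>(x - x0) $ l\<bar> \<le> t" for l using component_le_norm_cart[of "x - x0" l] xt by linarith
      have v: "rep (w t) x = (x - x0) $ i * (x - x0) $ j"
        unfolding xy using elim Q(3)[OF y] by (simp add: w_def \<phi>_def y_def[symmetric] power2_eq_square)
      have g: "grad (w t) x = (\<chi> m. (if m = i then (x - x0) $ j else 0) + (if m = j then (x - x0) $ i else 0))"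
        unfolding xy using elim Q(4)[OF y] by (simp add: w_def d1[OF t(1)] y_def[symmetric] vec_eq_iff distrib_left)
      have h: "hess (w t) x = sym_unit i j"
      proof -
        have "hess (w t) x = (\<chi> l m. pderiv_at l (pderiv_at m (\<phi> t)) x)" using elim by (simp add: w_def)
        then show ?thesis unfolding d2[OF t(1)] y_def[symmetric] by (simp add: Q(5)[OF y] sym_unit_def)
      qed
      have "\<bar>(x - x0) $ i * (x - x0) $ j\<bar> \<le> t * 1"
        unfolding abs_mult using xl[of i] xl[of j] t t0 by (intro mult_mono) linarith+
      moreover have "norm (grad (w t) x) \<le> 2 * t"
      proof -
        have "grad (w t) x = axis i ((x - x0) $ j) + axis j ((x - x0) $ i)"
          unfolding g by (auto simp: vec_eq_iff axis_def)
        then have "norm (grad (w t) x) \<le> \<bar>(x - x0) $ j\<bar> + \<bar>(x - x0) $ i\<bar>"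
          using norm_triangle_ineq[of "axis i ((x - x0) $ j)" "axis j ((x - x0) $ i)"]
          unfolding norm_axis by simp
        then show ?thesis using xl[of i] xl[of j] by linarith
      qed
      ultimately show "\<bar>rep (w t) x\<bar> \<le> t \<and> norm (grad (w t) x) \<le> 2 * t \<and> hess (w t) x = sym_unit i j
        \<and> rep (w t) x = (x - x0) $ i * (x - x0) $ j \<and> grad (w t) x = (\<chi> m. (if m = i then (x - x0) $ j else 0) + (if m = j then (x - x0) $ i else 0))"
        using v g h by simp
    qed
  qed
  define t where "t n = t0 / real (Suc n)" for n
  have t: "0 < t n" "t n \<le> t0" "t n \<le> 1" for n
  proof -
    show "0 < t n" using t0 by (simp add: t_def)
    show "t n \<le> t0" using t0 by (simp add: t_def field_simps)
    then show "t n \<le> 1" using t0 by simp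
  qed
  have tlim: "t \<longlonglongrightarrow> 0"
    using tendsto_mult_left[OF LIMSEQ_inverse_real_of_nat, of t0] by (simp add: t_def[abs_def] inverse_eq_divide)
  have wlim: "(\<lambda>n. nH2 (w (t n))) \<longlonglongrightarrow> 0"
  proof -
    have nrm: "(nL2 (cls \<psi>))\<^sup>2 = (LINT x|lborel. (\<psi> x)\<^sup>2)" if "\<psi> \<in> test_funs \<Omega>" for \<psi>
      by (rule class_on_integral(2)[OF that borel_measurable_const[of 0]])
    have "(nH2 (w (t n)))\<^sup>2 = (LINT x|lborel. (\<phi> (t n) x)\<^sup>2) + (\<Sum>m\<in>UNIV. LINT x|lborel. (pderiv_at m (\<phi> (t n)) x)\<^sup>2)
        + (\<Sum>l\<in>UNIV. \<Sum>m\<in>UNIV. LINT x|lborel. (pderiv_at l (pderiv_at m (\<phi> (t n))) x)\<^sup>2)" for n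
      unfolding H2_norm_sq w_def
      using \<phi>_test[OF t(1,2), of n] by (simp add: test_weak_pderiv test_funs_pderiv nrm)
    then have sq: "(nH2 (w (t n)))\<^sup>2 = (LINT x|lborel. (t n ^ 2 * Q ((1 / t n) *\<^sub>R (x - x0)))\<^sup>2)
        + (\<Sum>m\<in>UNIV. LINT x|lborel. (t n ^ 1 * pderiv_at m Q ((1 / t n) *\<^sub>R (x - x0)))\<^sup>2)
        + (\<Sum>l\<in>UNIV. \<Sum>m\<in>UNIV. LINT x|lborel. (t n ^ 0 * pderiv_at l (pderiv_at m Q) ((1 / t n) *\<^sub>R (x - x0)))\<^sup>2)" for n
      unfolding d2[OF t(1)] unfolding d1[OF t(1)] unfolding \<phi>_def by simp
    have "(\<lambda>n. (nH2 (w (t n)))\<^sup>2) \<longlonglongrightarrow> 0 + (\<Sum>m\<in>(UNIV::'d set). 0) + (\<Sum>l\<in>(UNIV::'d set). \<Sum>m\<in>(UNIV::'d set). 0)"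
      unfolding sq by (intro tendsto_add tendsto_sum concentrating_L2_limit[OF _ t(1,3) tlim] test_funs_pderiv Q(1))
    then have "(\<lambda>n. sqrt ((nH2 (w (t n)))\<^sup>2)) \<longlonglongrightarrow> sqrt 0" by (intro tendsto_real_sqrt) simp
    then show ?thesis using H2_norm_nonneg by simp
  qed
  define v where "v = k *\<^sub>R w t0"
  \<comment> \<open>All \<open>w t\<close> coincide with \<open>y\<^sub>i y\<^sub>j\<close>, \<open>y = x - x0\<close>, near \<open>x0\<close>; subtracting twice the smaller bump changes the sign.\<close>
  define vs where "vs n = v + (- 2 * k) *\<^sub>R w (t n)" for n
  have vX: "v \<in> X" "vs n \<in> X" for n
    unfolding vs_def v_def by (intro X_add X_scale wX t t0(1) order_refl)+
  show ?thesis
  proof (rule that[of v vs t])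
    have "nH2 (vs n - v) = 2 * k * nH2 (w (t n))" for n
      using H2_norm_scale[of "w (t n)" "- 2 * k"] wX[OF t(1,2)] k by (simp add: vs_def abs_mult)
    then show "(\<lambda>n. nH2 (vs n - v)) \<longlonglongrightarrow> 0"
      using tendsto_mult_left[OF wlim, of "2 * k"] by simp
    fix n
    have H2: "w t0 \<in> H2 \<Omega>" "w (t n) \<in> H2 \<Omega>" "v \<in> H2 \<Omega>" "(- 2 * k) *\<^sub>R w (t n) \<in> H2 \<Omega>"
      using wX[OF t0(1) order_refl] wX[OF t(1)[of n] t(2)[of n]] vX(1) X_scale[OF wX[OF t(1)[of n] t(2)[of n]], where a = "- 2 * k"] by auto
    from loc[OF t0(1) order_refl] loc[OF t(1,2), of n] derivatives_linear(2)[OF H2(1) H2(1), of k]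
      derivatives_linear(2)[OF H2(2) H2(2), of "- 2 * k"] derivatives_linear(1)[OF H2(3,4)]
    show "AE x in M. x \<in> ball x0 (t n) \<longrightarrow>
       \<bar>rep v x\<bar> \<le> 1 \<and> norm (grad v x) \<le> 1 \<and> hess v x = k *\<^sub>R sym_unit i j
     \<and> \<bar>rep (vs n) x\<bar> \<le> 1 \<and> norm (grad (vs n) x) \<le> 1 \<and> hess (vs n) x = (- k) *\<^sub>R sym_unit i j"
    proof eventually_elim
      case (elim x)
      show ?case
      proof
        assume x: "x \<in> ball x0 (t n)"
        then have x': "x \<in> ball x0 t0" using t(2)[of n] by auto
        have same: "rep (w (t n)) x = rep (w t0) x" "grad (w (t n)) x = grad (w t0) x"
          "hess (w (t n)) x = sym_unit i j" "hess (w t0) x = sym_unit i j"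
          using elim(1,2) x x' by simp_all
        have vv: "rep v x = k * rep (w t0) x" "grad v x = k *\<^sub>R grad (w t0) x" "hess v x = k *\<^sub>R sym_unit i j"
          using elim(3) same by (simp_all add: v_def)
        have vn: "rep (vs n) x = - k * rep (w t0) x" "grad (vs n) x = (- k) *\<^sub>R grad (w t0) x" "hess (vs n) x = (- k) *\<^sub>R sym_unit i j"
        proof -
          have c: "k *\<^sub>R g + (- 2 * k) *\<^sub>R g = (- k) *\<^sub>R g" for g :: "'z::real_vector"
            by (simp only: scaleR_add_left[symmetric]) simp
          have "rep (vs n) x = rep v x + (- 2 * k) * rep (w (t n)) x"
            "grad (vs n) x = grad v x + (- 2 * k) *\<^sub>R grad (w (t n)) x"
            "hess (vs n) x = hess v x + (- 2 * k) *\<^sub>R hess (w (t n)) x"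
            using elim(4,5) unfolding vs_def by simp_all
          then show "rep (vs n) x = - k * rep (w t0) x" "grad (vs n) x = (- k) *\<^sub>R grad (w t0) x"
            "hess (vs n) x = (- k) *\<^sub>R sym_unit i j"
            unfolding same vv c by simp_all
        qed
        have "\<bar>rep (w t0) x\<bar> \<le> t0" "norm (grad (w t0) x) \<le> 2 * t0" using elim(1) x' by auto
        then have "k * \<bar>rep (w t0) x\<bar> \<le> k * t0" "k * norm (grad (w t0) x) \<le> k * (2 * t0)"
          using k by (auto intro: mult_left_mono)
        moreover have "k * (2 * t0) \<le> 1" "0 < k * t0" using t0(1,4) k by (simp_all add: mult_ac)
        ultimately have "k * \<bar>rep (w t0) x\<bar> \<le> 1" "k * norm (grad (w t0) x) \<le> 1"
          by linarith+
        then show "\<bar>rep v x\<bar> \<le> 1 \<and> norm (grad v x) \<le> 1 \<and> hess v x = k *\<^sub>R sym_unit i j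
           \<and> \<bar>rep (vs n) x\<bar> \<le> 1 \<and> norm (grad (vs n) x) \<le> 1 \<and> hess (vs n) x = (- k) *\<^sub>R sym_unit i j"
          using vv vn k by (simp add: abs_mult)
      qed
    qed
  qed (use vX t in auto)
qed

text \<open>A property that fails to be null fails to be null near some point: otherwise countably many balls on
  which it is null would cover the domain.\<close>

lemma localise_non_null:
  assumes "\<not> (AE x in M. \<not> P x)"
  obtains x0 where "x0 \<in> \<Omega>" "\<And>r. r > 0 \<Longrightarrow> \<not> (AE x in M. x \<in> ball x0 r \<longrightarrow> \<not> P x)"
proof -
  have "\<exists>x0\<in>\<Omega>. \<forall>r>0. \<not> (AE x in M. x \<in> ball x0 r \<longrightarrow> \<not> P x)"
  proof (rule ccontr)
    assume "\<not> ?thesis"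
    then obtain r where r: "\<And>x0. x0 \<in> \<Omega> \<Longrightarrow> r x0 > 0" "\<And>x0. x0 \<in> \<Omega> \<Longrightarrow> AE x in M. x \<in> ball x0 (r x0) \<longrightarrow> \<not> P x"
      by metis
    obtain F where F: "F \<subseteq> (\<lambda>x0. ball x0 (r x0)) ` \<Omega>" "countable F" "\<Union>F = (\<Union>x0\<in>\<Omega>. ball x0 (r x0))"
      using Lindelof[of "(\<lambda>x0. ball x0 (r x0)) ` \<Omega>"] by (metis (no_types, lifting) imageE open_ball)
    have "AE x in M. \<forall>B\<in>F. x \<in> B \<longrightarrow> \<not> P x"
      unfolding AE_ball_countable[OF F(2)] using F(1) r(2) by blast
    moreover have "\<exists>B\<in>F. x \<in> B" if "x \<in> \<Omega>" for x
    proof -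
      have "x \<in> \<Union>F" unfolding F(3) using that r(1)[OF that] by force
      then show ?thesis by blast
    qed
    moreover have "AE x in M. x \<in> \<Omega>" unfolding AE_domain by simp
    ultimately have "AE x in M. \<not> P x" by (auto elim: eventually_elim2)
    then show False using assms by simp
  qed
  then show ?thesis using that by blast
qed

end

section \<open>Uniform convergence of policies determines the leading coefficient\<close>

context hjb
begin

text \<open>Quantitative failure of constancy. The product \<open>A : E\<close> oscillates by at least \<open>1 / (n + 1)\<close>, but by less than
  half of this over policies closer than \<open>1 / (m + 1)\<close>; and \<open>f\<close> is bounded by \<open>m\<close>, which limits how far
  it can shift the maximisers. Countably many pairs
  \<open>(n, m)\<close> cover all points at which constancy fails.\<close>

definition steep_at :: "'d \<Rightarrow> 'd \<Rightarrow> nat \<Rightarrow> nat \<Rightarrow> real^'d \<Rightarrow> bool" where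
  "steep_at i j n m x \<longleftrightarrow> (\<exists>\<alpha> \<beta>. ev (A x) \<alpha> \<bullet> sym_unit i j - ev (A x) \<beta> \<bullet> sym_unit i j \<ge> 1 / real (Suc n))
     \<and> norm (f x) \<le> real m
     \<and> (\<forall>\<alpha> \<beta>. dist \<alpha> \<beta> < 1 / real (Suc m) \<longrightarrow>
          \<bar>ev (A x) \<alpha> \<bullet> sym_unit i j - ev (A x) \<beta> \<bullet> sym_unit i j\<bar> < 1 / (2 * real (Suc n)))"

lemma steep_if_not_constant:
  assumes "ev (A x) \<alpha> \<bullet> sym_unit i j \<noteq> ev (A x) \<beta> \<bullet> sym_unit i j"
  shows "\<exists>n m. steep_at i j n m x"
proof -
  let ?a = "\<lambda>\<alpha>. ev (A x) \<alpha> \<bullet> sym_unit i j"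
  have "\<exists>\<alpha> \<beta>. 0 < ?a \<alpha> - ?a \<beta>"
  proof (cases "?a \<alpha> < ?a \<beta>")
    case True then show ?thesis by (intro exI[of _ \<beta>] exI[of _ \<alpha>]) simp
  next
    case False then show ?thesis using assms by (intro exI[of _ \<alpha>] exI[of _ \<beta>]) simp
  qed
  then obtain \<alpha>' \<beta>' where p: "0 < ?a \<alpha>' - ?a \<beta>'" by blast
  obtain n where n: "inverse (real (Suc n)) < ?a \<alpha>' - ?a \<beta>'" using reals_Archimedean[OF p] by blast
  \<comment> \<open>The modulus of continuity at the single point \<open>x\<close>.\<close>
  have "continuous_on UNIV ?a" by (intro continuous_intros) auto
  then have uc: "uniformly_continuous_on UNIV ?a" by (rule compact_uniformly_continuous[OF _ compact_UNIV])
  have "0 < 1 / (2 * real (Suc n))" by simp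
  then obtain \<delta> where \<delta>: "\<delta> > 0" "\<And>\<alpha> \<beta>. dist \<alpha> \<beta> < \<delta> \<Longrightarrow> dist (?a \<alpha>) (?a \<beta>) < 1 / (2 * real (Suc n))"
    using uc unfolding uniformly_continuous_on_def by (metis UNIV_I)
  obtain m1 where m1: "inverse (real (Suc m1)) < \<delta>" using reals_Archimedean[OF \<delta>(1)] by blast
  obtain m2 where m2: "norm (f x) \<le> real m2" using real_arch_simple by blast
  define m where "m = max m1 m2"
  have "1 / real (Suc m) \<le> inverse (real (Suc m1))" by (simp add: m_def field_simps)
  then have "1 / real (Suc m) < \<delta>" using m1 by linarith
  moreover have "norm (f x) \<le> real m" using m2 by (simp add: m_def)
  moreover have "1 / real (Suc n) \<le> ?a \<alpha>' - ?a \<beta>'" using n by (simp add: inverse_eq_divide)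
  moreover have "\<bar>?a \<alpha> - ?a \<beta>\<bar> < 1 / (2 * real (Suc n))" if "dist \<alpha> \<beta> < 1 / real (Suc m)" for \<alpha> \<beta>
    using \<delta>(2)[of \<alpha> \<beta>] that calculation(1) unfolding dist_real_def by linarith
  ultimately have "steep_at i j n m x"
    unfolding steep_at_def by blast
  then show ?thesis by blast
qed

text \<open>If some \<open>steep_at\<close> were not null, it would not be null near some point \<open>x\<^sub>0\<close>. Around \<open>x\<^sub>0\<close> flip a Hessian from
  \<open>k E\<close> to \<open>- k E\<close>. At steep points the maximisers before and after the flip differ in \<open>A : E\<close> by
  more than half of \<open>1 / (n + 1)\<close>, hence have distance at least \<open>1 / (m + 1)\<close>, no matter how small the
  ball is. As the perturbations tend to \<open>0\<close> in \<open>H\<^sup>2\<close>, this contradicts uniform convergence of policies.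
  Symmetry of \<open>A\<close> enters at the end, since Hessians only see the symmetric part.\<close>

theorem leading_coefficient_constant:
  assumes upc: "uniform_policy_convergence \<Omega> A b c f"
    and sym: "AE x in M. \<forall>\<alpha>. transpose (ev (A x) \<alpha>) = ev (A x) \<alpha>"
  shows "AE x in M. \<forall>\<alpha> \<beta>. ev (A x) \<alpha> = ev (A x) \<beta>"
proof -
  have no_steep: "AE x in M. \<not> steep_at i j n m x" for i j n m
  proof (rule ccontr)
    assume "\<not> ?thesis"
    then obtain x0 where x0: "x0 \<in> \<Omega>" "\<And>r. r > 0 \<Longrightarrow> \<not> (AE x in M. x \<in> ball x0 r \<longrightarrow> \<not> steep_at i j n m x)"
      by (rule localise_non_null) blast
    obtain K where K: "K \<ge> 0" "AE x in M. \<forall>\<alpha>. norm (ev (A x) \<alpha>) \<le> K \<and> norm (ev (b x) \<alpha>) \<le> K \<and> \<bar>ev (c x) \<alpha>\<bar> \<le> K"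
      by (rule data_bounded)
    \<comment> \<open>A bound for all terms of the reward other than the second order one.\<close>
    define C where "C = 2 * K + real m"
    have C: "C \<ge> 0" using K by (simp add: C_def)
    \<comment> \<open>So large that the lower order terms shift \<open>A : E\<close> at the two maximisers by less than half of
      \<open>1 / (n + 1)\<close> in total.\<close>
    define k where "k = 8 * C * real (Suc n) + 1"
    have k: "k > 0" "4 * C / k < 1 / (2 * real (Suc n))"
    proof -
      show k0: "k > 0" using C by (simp add: k_def add_nonneg_pos)
      have "8 * C * real (Suc n) < k" by (simp add: k_def)
      then show "4 * C / k < 1 / (2 * real (Suc n))" using k0 by (simp add: field_simps)
    qed
    obtain v vs r where v: "v \<in> X" "\<And>n::nat. vs n \<in> X" "(\<lambda>n. nH2 (vs n - v)) \<longlonglongrightarrow> 0" and r: "\<And>n. r n > 0"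
      and flip: "\<And>n. AE x in M. x \<in> ball x0 (r n) \<longrightarrow>
         \<bar>rep v x\<bar> \<le> 1 \<and> norm (grad v x) \<le> 1 \<and> hess v x = k *\<^sub>R sym_unit i j
       \<and> \<bar>rep (vs n) x\<bar> \<le> 1 \<and> norm (grad (vs n) x) \<le> 1 \<and> hess (vs n) x = (- k) *\<^sub>R sym_unit i j"
      using hessian_flip[OF x0(1) k(1), of i j] by blast
    have "\<forall>l. \<exists>q. q \<in> N (vs l)" using N_nonempty by blast
    then obtain qs where qs: "\<And>l. qs l \<in> N (vs l)" by metis
    have "(\<lambda>l. Linf_norm \<Omega> (policy_dist \<Omega> (qs l) (N v))) \<longlonglongrightarrow> 0"
      using upc v qs unfolding uniform_policy_convergence_def by blast
    then have "eventually (\<lambda>l. Linf_norm \<Omega> (policy_dist \<Omega> (qs l) (N v)) < ereal (1 / real (Suc m))) sequentially"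
      by (rule order_tendstoD(2)) simp
    then obtain l where l: "Linf_norm \<Omega> (policy_dist \<Omega> (qs l) (N v)) < ereal (1 / real (Suc m))"
      by (auto simp: eventually_sequentially)
    have qm: "qs l \<in> borel_measurable M" "AE x in M. qs l x \<in> Argmax (reward (vs l) x)" using qs[of l] by (simp_all add: N_iff)
    obtain p where p: "p \<in> N v" "\<And>x. p x \<in> Argmax (reward v x)"
      "\<And>x \<beta>. \<beta> \<in> Argmax (reward v x) \<Longrightarrow> dist (qs l x) (p x) \<le> dist (qs l x) \<beta>"
      using closest_maximiser[OF qm(1), of v] by blast
    have close: "AE x in M. ereal (dist (qs l x) (p x)) \<le> Linf_norm \<Omega> (policy_dist \<Omega> (qs l) (N v))"
      by (rule Linf_policy_dist[OF qm(1) p(1)]) (rule p(3))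
    from K(2) flip[of l] qm(2) close have "AE x in M. x \<in> ball x0 (r l) \<longrightarrow> \<not> steep_at i j n m x"
    proof eventually_elim
      case (elim x)
      show ?case
      proof (intro impI notI)
        assume x: "x \<in> ball x0 (r l)" and steep: "steep_at i j n m x"
        let ?a = "\<lambda>\<alpha>. ev (A x) \<alpha> \<bullet> sym_unit i j"
        have low: "\<bar>ev (b x) \<alpha> \<bullet> g - ev (c x) \<alpha> * u - ev (f x) \<alpha>\<bar> \<le> C"
          if "norm g \<le> 1" "\<bar>u\<bar> \<le> 1" for \<alpha> g u
        proof -
          have "\<bar>ev (b x) \<alpha> \<bullet> g\<bar> \<le> K * 1"
            using elim(1) that K(1) by (intro order_trans[OF Cauchy_Schwarz_ineq2] mult_mono) auto
          moreover have "\<bar>ev (c x) \<alpha> * u\<bar> \<le> K * 1"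
            using elim(1) that K(1) unfolding abs_mult by (intro mult_mono) auto
          moreover have "\<bar>ev (f x) \<alpha>\<bar> \<le> real m"
            using norm_bounded[of "f x" \<alpha>] steep by (auto simp: steep_at_def)
          ultimately show ?thesis unfolding C_def by linarith
        qed
        have 1: "\<bar>reward v x \<alpha> - k * ?a \<alpha>\<bar> \<le> C" for \<alpha>
        proof -
          have "reward v x \<alpha> - k * ?a \<alpha> = ev (b x) \<alpha> \<bullet> grad v x - ev (c x) \<alpha> * rep v x - ev (f x) \<alpha>"
            using elim(2) x by (simp add: L_inner)
          moreover have "norm (grad v x) \<le> 1" "\<bar>rep v x\<bar> \<le> 1" using elim(2) x by blast+
          ultimately show ?thesis using low by metis
        qed
        have 2: "\<bar>reward (vs l) x \<alpha> + k * ?a \<alpha>\<bar> \<le> C" for \<alpha>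
        proof -
          have "reward (vs l) x \<alpha> + k * ?a \<alpha> = ev (b x) \<alpha> \<bullet> grad (vs l) x - ev (c x) \<alpha> * rep (vs l) x - ev (f x) \<alpha>"
            using elim(2) x by (simp add: L_inner)
          moreover have "norm (grad (vs l) x) \<le> 1" "\<bar>rep (vs l) x\<bar> \<le> 1" using elim(2) x by blast+
          ultimately show ?thesis using low by metis
        qed
        obtain \<alpha> \<beta> where osc: "?a \<alpha> - ?a \<beta> \<ge> 1 / real (Suc n)" using steep unfolding steep_at_def by blast
        have "k * ?a \<alpha> \<le> k * ?a (p x) + 2 * C"
          using 1[of \<alpha>] 1[of "p x"] p(2)[of x] unfolding Argmax_def by (auto simp: abs_le_iff dest!: spec[of _ \<alpha>])
        moreover have "k * ?a (qs l x) \<le> k * ?a \<beta> + 2 * C"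
          using 2[of \<beta>] 2[of "qs l x"] elim(3) unfolding Argmax_def by (auto simp: abs_le_iff dest!: spec[of _ \<beta>])
        ultimately have "k * (?a \<alpha> - ?a \<beta>) \<le> k * (?a (p x) - ?a (qs l x)) + 4 * C" by (simp add: algebra_simps)
        then have "?a \<alpha> - ?a \<beta> \<le> ?a (p x) - ?a (qs l x) + 4 * C / k"
          using k(1) by (simp add: field_simps)
        then have "?a (p x) - ?a (qs l x) > 1 / real (Suc n) - 1 / (2 * real (Suc n))" using osc k(2) by linarith
        also have "1 / real (Suc n) - 1 / (2 * real (Suc n)) = 1 / (2 * real (Suc n))" by (simp add: field_simps)
        finally have "\<not> \<bar>?a (qs l x) - ?a (p x)\<bar> < 1 / (2 * real (Suc n))" by linarith
        moreover have "dist (qs l x) (p x) < 1 / real (Suc m)"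
          using order_le_less_trans[OF elim(4) l] by simp
        ultimately show False using steep unfolding steep_at_def by blast
      qed
    qed
    then show False using x0(2)[OF r] by blast
  qed
  have "AE x in M. \<forall>i\<in>UNIV. \<forall>j\<in>UNIV. \<forall>n m. \<not> steep_at i j n m x"
    by (intro AE_finite_allI) (auto simp: AE_all_countable no_steep)
  with sym show ?thesis
  proof eventually_elim
    case (elim x)
    show ?case
    proof (intro allI)
      fix \<alpha> \<beta>
      have "ev (A x) \<alpha> $ i $ j = ev (A x) \<beta> $ i $ j" for i j
      proof -
        have "ev (A x) \<alpha> \<bullet> sym_unit i j = ev (A x) \<beta> \<bullet> sym_unit i j"
          using steep_if_not_constant[of x \<alpha> i j \<beta>] elim(2) by blast
        moreover have "ev (A x) \<gamma> $ j $ i = ev (A x) \<gamma> $ i $ j" for \<gamma>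
        proof -
          have "transpose (ev (A x) \<gamma>) $ j $ i = ev (A x) \<gamma> $ i $ j" by (simp add: transpose_def)
          then show ?thesis using elim(1) by simp
        qed
        ultimately show ?thesis by (simp add: inner_sym_unit)
      qed
      then show "ev (A x) \<alpha> = ev (A x) \<beta>" by (simp add: vec_eq_iff)
    qed
  qed
qed

section \<open>Newton differentiability\<close>

text \<open>With the leading coefficient out of the way, the two one-sided estimates of the residual involve only
  first order terms.\<close>

lemma residual_bound:
  assumes const: "AE x in M. \<forall>\<alpha> \<beta>. ev (A x) \<alpha> = ev (A x) \<beta>"
    and v: "v \<in> H2 \<Omega>" "e \<in> H2 \<Omega>" and q: "q \<in> N (v + e)" and p: "p \<in> N v"
  shows "AE x in M. (reward (v + e) x (q x) - reward v x (p x) - L (q x) e x)\<^sup>2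
    \<le> 2 * ((norm (ev (b x) (p x) - ev (b x) (q x)) + \<bar>ev (c x) (p x) - ev (c x) (q x)\<bar>)\<^sup>2 * H1_density e x)"
proof -
  have "AE x in M. q x \<in> Argmax (reward (v + e) x)" "AE x in M. p x \<in> Argmax (reward v x)"
    using p q by (simp_all add: N_iff)
  with const derivatives_linear(1)[OF v] show ?thesis
  proof eventually_elim
    case (elim x)
    let ?R = "reward (v + e) x (q x) - reward v x (p x) - L (q x) e x"
    let ?b = "ev (b x) (p x) - ev (b x) (q x)" and ?c = "ev (c x) (p x) - ev (c x) (q x)"
    have lin: "reward (v + e) x \<alpha> = reward v x \<alpha> + L \<alpha> e x" for \<alpha>
      using elim(2) by (simp add: L_inner inner_add_right distrib_left)
    have "reward v x (q x) \<le> reward v x (p x)" using elim(4) by (simp add: Argmax_def)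
    then have up: "?R \<le> 0" unfolding lin by simp
    have "reward (v + e) x (p x) \<le> reward (v + e) x (q x)" using elim(3) by (simp add: Argmax_def)
    then have "L (p x) e x - L (q x) e x \<le> ?R" unfolding lin by simp
    also have "L (p x) e x - L (q x) e x = ?b \<bullet> grad e x - ?c * rep e x"
      using elim(1)[rule_format, of "p x" "q x"] by (simp add: L_inner inner_diff_left left_diff_distrib)
    finally have "\<bar>?R\<bar> \<le> \<bar>?b \<bullet> grad e x\<bar> + \<bar>?c * rep e x\<bar>" using up by linarith
    also have "\<dots> \<le> norm ?b * norm (grad e x) + \<bar>?c\<bar> * \<bar>rep e x\<bar>"
      using Cauchy_Schwarz_ineq2[of ?b "grad e x"] by (simp add: abs_mult)
    also have "\<dots> \<le> (norm ?b + \<bar>?c\<bar>) * norm (grad e x) + (norm ?b + \<bar>?c\<bar>) * \<bar>rep e x\<bar>"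
      by (intro add_mono mult_right_mono) auto
    also have "\<dots> = (norm ?b + \<bar>?c\<bar>) * (norm (grad e x) + \<bar>rep e x\<bar>)" by (simp add: distrib_left)
    finally have "\<bar>?R\<bar>\<^sup>2 \<le> ((norm ?b + \<bar>?c\<bar>) * (norm (grad e x) + \<bar>rep e x\<bar>))\<^sup>2" by (rule power_mono) simp
    also have "\<dots> = (norm ?b + \<bar>?c\<bar>)\<^sup>2 * (norm (grad e x) + \<bar>rep e x\<bar>)\<^sup>2" by (rule power_mult_distrib)
    also have "\<dots> \<le> (norm ?b + \<bar>?c\<bar>)\<^sup>2 * (2 * H1_density e x)"
      using sum_squares_bound[of "norm (grad e x)" "\<bar>rep e x\<bar>"]
      by (intro mult_left_mono) (auto simp: H1_density_grad power2_sum)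
    finally show ?case by (simp add: mult_ac)
  qed
qed

lemma residual_norm:
  assumes v: "v \<in> H2 \<Omega>" "e \<in> H2 \<Omega>" and q: "q \<in> N (v + e)" and p: "p \<in> N v"
  shows "(nL2 (\<F> (v + e) - \<F> v - pol q e))\<^sup>2
     = (LINT x|M. (reward (v + e) x (q x) - reward v x (p x) - L (q x) e x)\<^sup>2)"
    "sqint M (\<lambda>x. reward (v + e) x (q x) - reward v x (p x) - L (q x) e x)"
proof -
  have m: "q \<in> borel_measurable M" "p \<in> borel_measurable M" using p q by (simp_all add: N_iff)
  have rm: "(\<lambda>x. reward (v + e) x (q x)) \<in> borel_measurable M" "(\<lambda>x. reward v x (p x)) \<in> borel_measurable M" "(\<lambda>x. L (q x) e x) \<in> borel_measurable M"
    using m by (auto intro: caratheodory_compose[OF caratheodory_reward] L_policy_measurable)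
  let ?u = "\<F> (v + e) - \<F> v - pol q e"
  have "AE x in M. rep ?u x = reward (v + e) x (q x) - reward v x (p x) - L (q x) e x"
    using rep_diff[of "\<F> (v + e) - \<F> v" "pol q e"] rep_diff[of "\<F> (v + e)" "\<F> v"]
      class_on_rep(1)[OF rm(1), folded HJB_maximiser[OF q]] class_on_rep(1)[OF rm(2), folded HJB_maximiser[OF p]]
      class_on_rep(1)[OF rm(3), folded policy_op_def]
    by eventually_elim simp
  then have "nL2 ?u = sqrt (LINT x|M. (reward (v + e) x (q x) - reward v x (p x) - L (q x) e x)\<^sup>2)"
    by (rule L2_norm_cong[rotated]) (use rm in measurable)
  then show "(nL2 ?u)\<^sup>2 = (LINT x|M. (reward (v + e) x (q x) - reward v x (p x) - L (q x) e x)\<^sup>2)" by simp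
  have "sqint M (\<lambda>x. (L (q x) (v + e) x + (-1) * ev (f x) (q x)) + (-1) * (L (p x) v x + (-1) * ev (f x) (p x)) + (-1) * L (q x) e x)"
    by (intro sqint_add sqint_scale L_policy_sqint f_policy_sqint m v H2_add)
  then show "sqint M (\<lambda>x. reward (v + e) x (q x) - reward v x (p x) - L (q x) e x)" by (simp add: algebra_simps)
qed

text \<open>Newton differentiability is proved by contradiction, along a sequence of increments. The increments are
  normalised in \<open>H\<^sup>2\<close>, so that \<open>vanishing_multiplier\<close> applies; one small residual per sequence is enough.\<close>

lemma residual_small:
  assumes upc: "uniform_policy_convergence \<Omega> A b c f"
    and sym: "AE x in M. \<forall>\<alpha>. transpose (ev (A x) \<alpha>) = ev (A x) \<alpha>"
    and v: "v \<in> X" and e: "\<And>n::nat. e n \<in> X" and pos: "\<And>n. 0 < nH2 (e n)"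
    and lim: "(\<lambda>n. nH2 (e n)) \<longlonglongrightarrow> 0" and q: "\<And>n. q n \<in> N (v + e n)" and \<epsilon>: "\<epsilon> > 0"
  shows "\<exists>n. nL2 (\<F> (v + e n) - \<F> v - pol (q n) (e n)) < \<epsilon> * nH2 (e n)"
proof -
  note const = leading_coefficient_constant[OF upc sym]
  have qm: "q n \<in> borel_measurable M" for n using q[of n] by (simp add: N_iff)
  have "\<forall>n. \<exists>p. p \<in> N v \<and> (\<forall>x. \<forall>\<beta>\<in>Argmax (reward v x). dist (q n x) (p x) \<le> dist (q n x) \<beta>)"
  proof
    fix n
    obtain p where "p \<in> N v" "\<And>x. p x \<in> Argmax (reward v x)"
      "\<And>x \<beta>. \<beta> \<in> Argmax (reward v x) \<Longrightarrow> dist (q n x) (p x) \<le> dist (q n x) \<beta>"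
      using closest_maximiser[OF qm[of n], of v] by blast
    then show "\<exists>p. p \<in> N v \<and> (\<forall>x. \<forall>\<beta>\<in>Argmax (reward v x). dist (q n x) (p x) \<le> dist (q n x) \<beta>)"
      by blast
  qed
  from choice[OF this] obtain p where
    p': "\<forall>n. p n \<in> N v \<and> (\<forall>x. \<forall>\<beta>\<in>Argmax (reward v x). dist (q n x) (p n x) \<le> dist (q n x) \<beta>)" ..
  have p: "p n \<in> N v" "\<beta> \<in> Argmax (reward v x) \<Longrightarrow> dist (q n x) (p n x) \<le> dist (q n x) \<beta>" for n x \<beta>
    using p'[rule_format, of n] by simp_all
  have pm: "p n \<in> borel_measurable M" for n using p(1)[of n] by (simp add: N_iff)
  have "(\<lambda>n. Linf_norm \<Omega> (policy_dist \<Omega> (q n) (N v))) \<longlonglongrightarrow> 0"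
    using upc[unfolded uniform_policy_convergence_def, rule_format, of "\<lambda>n. v + e n" v q] v e q lim X_add by simp
  moreover have "AE x in M. \<forall>n. ereal (dist (q n x) (p n x)) \<le> Linf_norm \<Omega> (policy_dist \<Omega> (q n) (N v))"
    unfolding AE_all_countable by (intro allI Linf_policy_dist[OF qm p(1)] p(2))
  ultimately have dist0: "AE x in M. (\<lambda>n. dist (q n x) (p n x)) \<longlonglongrightarrow> 0"
  proof (elim eventually_mono)
    fix x assume l: "(\<lambda>n. Linf_norm \<Omega> (policy_dist \<Omega> (q n) (N v))) \<longlonglongrightarrow> 0"
      and b: "\<forall>n. ereal (dist (q n x) (p n x)) \<le> Linf_norm \<Omega> (policy_dist \<Omega> (q n) (N v))"
    have "(\<lambda>n. ereal (dist (q n x) (p n x))) \<longlonglongrightarrow> 0"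
      by (rule tendsto_sandwich[OF _ _ tendsto_const l]) (use b in auto)
    then show "(\<lambda>n. dist (q n x) (p n x)) \<longlonglongrightarrow> 0" by (simp add: zero_ereal_def)
  qed
  define \<beta> where "\<beta> n x = norm (ev (b x) (p n x) - ev (b x) (q n x)) + \<bar>ev (c x) (p n x) - ev (c x) (q n x)\<bar>" for n x
  have \<beta>m: "\<beta> n \<in> borel_measurable M" for n
  proof -
    have [measurable]: "(\<lambda>x. ev (b x) (p n x) $ i) \<in> borel_measurable M" "(\<lambda>x. ev (b x) (q n x) $ i) \<in> borel_measurable M"
      "(\<lambda>x. ev (c x) (p n x)) \<in> borel_measurable M" "(\<lambda>x. ev (c x) (q n x)) \<in> borel_measurable M" for i
      using caratheodory_compose[OF caratheodory_component(2) pm] caratheodory_compose[OF caratheodory_component(2) qm]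
        caratheodory_compose[OF caratheodory_component(3) pm] caratheodory_compose[OF caratheodory_component(3) qm] by auto
    show ?thesis unfolding \<beta>_def[abs_def] norm_vec_def L2_set_def by simp
  qed
  have \<beta>0: "AE x in M. (\<lambda>n. \<beta> n x) \<longlonglongrightarrow> 0"
    using dist0
  proof eventually_elim
    case (elim x)
    have ucb: "uniformly_continuous_on UNIV (ev (b x))" "uniformly_continuous_on UNIV (ev (c x))"
      by (auto intro: compact_uniformly_continuous compact_UNIV)
    have elim': "(\<lambda>n. dist (p n x) (q n x)) \<longlonglongrightarrow> 0" using elim by (simp add: dist_commute)
    have "(\<lambda>n. dist (ev (b x) (p n x)) (ev (b x) (q n x))) \<longlonglongrightarrow> 0"
      "(\<lambda>n. dist (ev (c x) (p n x)) (ev (c x) (q n x))) \<longlonglongrightarrow> 0"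
      using elim' ucb unfolding uniformly_continuous_on_sequentially by auto
    from tendsto_add[OF this] show ?case by (simp add: \<beta>_def dist_norm)
  qed
  obtain K where K: "K \<ge> 0" "AE x in M. \<forall>\<alpha>. norm (ev (A x) \<alpha>) \<le> K \<and> norm (ev (b x) \<alpha>) \<le> K \<and> \<bar>ev (c x) \<alpha>\<bar> \<le> K"
    by (rule data_bounded)
  have \<beta>K: "AE x in M. \<bar>\<beta> n x\<bar> \<le> 4 * K" for n
    using K(2)
  proof eventually_elim
    case (elim x)
    have "norm (ev (b x) (p n x) - ev (b x) (q n x)) \<le> K + K"
      using elim by (intro order_trans[OF norm_triangle_ineq4] add_mono) auto
    moreover have "\<bar>ev (c x) (p n x)\<bar> \<le> K" "\<bar>ev (c x) (q n x)\<bar> \<le> K" using elim by auto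
    ultimately have "\<beta> n x \<le> 4 * K" unfolding \<beta>_def by linarith
    moreover have "0 \<le> \<beta> n x" by (simp add: \<beta>_def)
    ultimately show ?case by simp
  qed
  define w where "w n = (1 / nH2 (e n)) *\<^sub>R e n" for n
  have wX: "w n \<in> X" for n unfolding w_def by (rule X_scale[OF e])
  have eH2: "e n \<in> H2 \<Omega>" for n using e by auto
  have w1: "nH2 (w n) \<le> 1" for n using pos[of n] by (simp add: w_def H2_norm_scale[OF eH2])
  have "\<epsilon>\<^sup>2 / 2 > 0" using \<epsilon> by simp
  then obtain n where n: "(LINT x|M. (\<beta> n x)\<^sup>2 * H1_density (w n) x) < \<epsilon>\<^sup>2 / 2"
    using vanishing_multiplier[of w \<beta> "4 * K", OF wX w1 \<beta>m \<beta>K \<beta>0] by blast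
  let ?t = "nH2 (e n)"
  have dens: "AE x in M. H1_density (w n) x = (1 / ?t)\<^sup>2 * H1_density (e n) x"
    using derivatives_linear(2)[OF eH2 eH2, of "1 / ?t" n]
    by eventually_elim (simp add: w_def H1_density_grad power_mult_distrib distrib_left power_divide add_divide_distrib)
  have vH2: "v \<in> H2 \<Omega>" using v by simp
  have bint: "integrable M (\<lambda>x. (\<beta> n x)\<^sup>2 * H1_density (e n) x)"
  proof (rule Bochner_Integration.integrable_bound)
    show "integrable M (\<lambda>x. (4 * K)\<^sup>2 * H1_density (e n) x)" using H1_density_integral(1)[OF H2_H1(1)[OF eH2]] by simp
    show "AE x in M. norm ((\<beta> n x)\<^sup>2 * H1_density (e n) x) \<le> norm ((4 * K)\<^sup>2 * H1_density (e n) x)"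
      using \<beta>K[of n]
    proof eventually_elim
      case (elim x)
      have "\<bar>\<beta> n x\<bar>\<^sup>2 \<le> (4 * K)\<^sup>2" using elim by (intro power_mono) auto
      then show ?case using H1_density_nonneg[of "e n" x] by (simp add: abs_mult mult_right_mono)
    qed
  qed (use \<beta>m in measurable)
  have "(nL2 (\<F> (v + e n) - \<F> v - pol (q n) (e n)))\<^sup>2
      \<le> (LINT x|M. 2 * ((\<beta> n x)\<^sup>2 * H1_density (e n) x))"
    unfolding residual_norm(1)[OF vH2 eH2 q p(1)[of n]]
  proof (rule integral_mono_AE)
    show "integrable M (\<lambda>x. (reward (v + e n) x (q n x) - reward v x (p n x) - L (q n x) (e n) x)\<^sup>2)"
      using residual_norm(2)[OF vH2 eH2 q p(1)[of n]] by (simp add: sqint_def)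
    show "integrable M (\<lambda>x. 2 * ((\<beta> n x)\<^sup>2 * H1_density (e n) x))" using bint by simp
    show "AE x in M. (reward (v + e n) x (q n x) - reward v x (p n x) - L (q n x) (e n) x)\<^sup>2 \<le> 2 * ((\<beta> n x)\<^sup>2 * H1_density (e n) x)"
      unfolding \<beta>_def by (rule residual_bound[OF const vH2 eH2 q p(1)])
  qed
  also have "\<dots> = 2 * ?t\<^sup>2 * (LINT x|M. (\<beta> n x)\<^sup>2 * H1_density (w n) x)"
  proof -
    have "(LINT x|M. (\<beta> n x)\<^sup>2 * H1_density (w n) x) = (LINT x|M. (1 / ?t)\<^sup>2 * ((\<beta> n x)\<^sup>2 * H1_density (e n) x))"
      by (rule integral_cong_AE) (use \<beta>m dens in \<open>auto elim!: eventually_mono\<close>)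
    then show ?thesis using pos[of n] by (simp add: power_divide)
  qed
  also have "\<dots> < 2 * ?t\<^sup>2 * (\<epsilon>\<^sup>2 / 2)" using n pos[of n] by (intro mult_strict_left_mono) auto
  also have "\<dots> = (\<epsilon> * ?t)\<^sup>2" by (simp add: power_mult_distrib)
  finally have "nL2 (\<F> (v + e n) - \<F> v - pol (q n) (e n)) < \<epsilon> * ?t"
    by (rule power_less_imp_less_base) (use \<epsilon> pos[of n] in simp)
  then show ?thesis by blast
qed

theorem HJB_newton_differentiable_at:
  assumes upc: "uniform_policy_convergence \<Omega> A b c f"
    and sym: "AE x in M. \<forall>\<alpha>. transpose (ev (A x) \<alpha>) = ev (A x) \<alpha>"
    and v: "v \<in> X"
  shows "newton_differentiable_at X nH2 (L2 \<Omega>) nL2 X \<F>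
           (\<lambda>v. {pol q | q. q \<in> N v}) v"
  unfolding newton_differentiable_at_def
proof
  let ?DF = "\<lambda>v. {pol q | q. q \<in> N v}"
  let ?F = "\<F>"
  have "?DF y \<noteq> {}" for y using N_nonempty[of y] by blast
  moreover have "?DF y \<subseteq> bounded_operators X nH2 (L2 \<Omega>) nL2" for y
    using policy_op_bounded by (auto simp: N_iff)
  moreover have "norm_open X nH2 X" unfolding norm_open_def by (auto intro: exI[of _ 1])
  ultimately show "\<exists>U. norm_open X nH2 U \<and> v \<in> U \<and> U \<subseteq> X \<and> (\<forall>y\<in>U. ?DF y \<noteq> {} \<and> ?DF y \<subseteq> bounded_operators X nH2 (L2 \<Omega>) nL2)"
    using v by (intro exI[of _ X]) blast
  let ?S = "\<lambda>e. SUP D\<in>?DF (v + e). ennreal (nL2 (?F (v + e) - ?F v - D e))"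
  show "((\<lambda>e. ?S e / ennreal (nH2 e)) \<longlongrightarrow> 0) (inf (filtercomap nH2 (at_right 0)) (principal X))"
  proof (rule order_tendstoI)
    fix a :: ennreal assume a: "0 < a"
    obtain y where y: "0 < y" "y < a" using dense[OF a] by blast
    define \<epsilon> where "\<epsilon> = enn2real y"
    have "y < top" using y(2) top_greatest[of a] by (rule order_less_le_trans)
    then have \<epsilon>: "0 < \<epsilon>" "ennreal \<epsilon> < a" using y by (simp_all add: \<epsilon>_def enn2real_positive_iff)
    have "\<exists>\<delta>>0. \<forall>e\<in>X. 0 < nH2 e \<longrightarrow> nH2 e < \<delta> \<longrightarrow> (\<forall>q\<in>N (v + e). nL2 (?F (v + e) - ?F v - pol q e) < \<epsilon> * nH2 e)"
    proof (rule ccontr)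
      assume neg: "\<not> ?thesis"
      have "\<forall>n. \<exists>e q. e \<in> X \<and> 0 < nH2 e \<and> nH2 e < inverse (real (Suc n)) \<and> q \<in> N (v + e)
          \<and> \<not> nL2 (?F (v + e) - ?F v - pol q e) < \<epsilon> * nH2 e"
      proof
        fix n
        have "inverse (real (Suc n)) > 0" by simp
        then show "\<exists>e q. e \<in> X \<and> 0 < nH2 e \<and> nH2 e < inverse (real (Suc n)) \<and> q \<in> N (v + e)
          \<and> \<not> nL2 (?F (v + e) - ?F v - pol q e) < \<epsilon> * nH2 e"
          using neg by blast
      qed
      then obtain e q where eq: "\<And>n. e n \<in> X" "\<And>n. 0 < nH2 (e n)" "\<And>n. nH2 (e n) < inverse (real (Suc n))"
        "\<And>n. q n \<in> N (v + e n)" "\<And>n. \<not> nL2 (?F (v + e n) - ?F v - pol (q n) (e n)) < \<epsilon> * nH2 (e n)"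
        by metis
      have "(\<lambda>n. nH2 (e n)) \<longlonglongrightarrow> 0"
        by (rule tendsto_sandwich[OF _ _ tendsto_const LIMSEQ_inverse_real_of_nat])
           (use eq(3) H2_norm_nonneg less_imp_le in \<open>auto intro!: always_eventually\<close>)
      from residual_small[of v e q, OF upc sym v eq(1,2) this eq(4) \<epsilon>(1)] eq(5) show False by blast
    qed
    then obtain \<delta> where \<delta>: "\<delta> > 0" "\<And>e q. e \<in> X \<Longrightarrow> 0 < nH2 e \<Longrightarrow> nH2 e < \<delta> \<Longrightarrow> q \<in> N (v + e) \<Longrightarrow>
        nL2 (?F (v + e) - ?F v - pol q e) < \<epsilon> * nH2 e" by blast
    have quot: "?S e / ennreal (nH2 e) < a" if e: "e \<in> X" "0 < nH2 e" "nH2 e < \<delta>" for e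
    proof -
      have "?S e \<le> ennreal (\<epsilon> * nH2 e)"
      proof (rule SUP_least)
        fix D assume "D \<in> ?DF (v + e)"
        then obtain q where "q \<in> N (v + e)" "D = pol q" by blast
        then show "ennreal (nL2 (?F (v + e) - ?F v - D e)) \<le> ennreal (\<epsilon> * nH2 e)"
          using \<delta>(2)[OF e] by (auto intro: ennreal_leI less_imp_le)
      qed
      then have "?S e / ennreal (nH2 e) \<le> ennreal (\<epsilon> * nH2 e) / ennreal (nH2 e)"
        by (rule divide_right_mono_ennreal)
      also have "\<dots> = ennreal \<epsilon>" using \<epsilon>(1) e(2) by (simp add: divide_ennreal)
      finally show ?thesis using \<epsilon>(2) by simp
    qed
    have "eventually (\<lambda>r. 0 < r \<and> r < \<delta>) (at_right (0::real))"
      unfolding eventually_at_right_field using \<delta>(1) by (intro exI[of _ \<delta>]) auto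
    then have "eventually (\<lambda>e. 0 < nH2 e \<and> nH2 e < \<delta>) (filtercomap nH2 (at_right 0))"
      by (rule eventually_filtercomapI)
    then show "eventually (\<lambda>e. ?S e / ennreal (nH2 e) < a) (inf (filtercomap nH2 (at_right 0)) (principal X))"
      unfolding eventually_inf_principal by (rule eventually_mono) (use quot in blast)
  qed simp
qed

end

theorem theorem3p9:
  fixes \<Omega> :: "(real^'d::finite) set"
    and A :: "real^'d \<Rightarrow> ('a::metric_space \<Rightarrow>\<^sub>C (real^'d^'d))"
    and b :: "real^'d \<Rightarrow> ('a \<Rightarrow>\<^sub>C (real^'d))"
    and c f :: "real^'d \<Rightarrow> ('a \<Rightarrow>\<^sub>C real)"
  assumes "compact (UNIV :: 'a set)"
    and "open \<Omega>" and "convex \<Omega>" and "bounded \<Omega>" and "\<Omega> \<noteq> {}"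
    and "A \<in> bochner_Linf \<Omega>"
    and "AE x in lebesgue_on \<Omega>. \<forall>\<alpha>. transpose (apply_bcontfun (A x) \<alpha>) = apply_bcontfun (A x) \<alpha>"
    and "b \<in> bochner_Linf \<Omega>" and "c \<in> bochner_Linf \<Omega>" and "f \<in> bochner_L2 \<Omega>"
    and "uniform_policy_convergence \<Omega> A b c f"
  shows "newton_differentiable_on (H2 \<Omega> \<inter> H10 \<Omega>) (H2_norm \<Omega>) (L2 \<Omega>) (L2_norm \<Omega>)
           (H2 \<Omega> \<inter> H10 \<Omega>) (HJB \<Omega> A b c f)
           (\<lambda>v. {policy_op \<Omega> A b c q | q. q \<in> max_policies \<Omega> A b c f v})"
proof -
  obtain s :: "nat \<Rightarrow> 'a" where s: "compact_space s" using compact_space_exists[OF assms(1)] by blast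
  interpret hjb \<Omega> s A b c f
    using s assms by (intro hjb.intro bounded_domain.intro hjb_axioms.intro)
  have at: "newton_differentiable_at X nH2 (L2 \<Omega>) nL2 X \<F>
       (\<lambda>v. {pol q | q. q \<in> N v}) v" if "v \<in> X" for v
    by (rule HJB_newton_differentiable_at[OF assms(11,7) that])
  have "(\<lambda>x. 0) \<in> test_funs \<Omega>"
    by (rule test_funsI[of _ "{}"]) (auto intro: smooth_fun_const)
  then have "X \<noteq> {}" using test_X by blast
  moreover have "\<F> ` X \<subseteq> L2 \<Omega>" using HJB_L2 by auto
  moreover have "{pol q | q. q \<in> N v} \<noteq> {}
      \<and> {pol q | q. q \<in> N v} \<subseteq> bounded_operators X nH2 (L2 \<Omega>) nL2" for v
    using N_nonempty[of v] policy_op_bounded by (auto simp: N_iff)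
  ultimately show ?thesis unfolding newton_differentiable_on_def using at by blast
qed

end
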